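(* Let ${}_5Q$ be the queue length process of a Mittag-Leffler $GI/GI/1$ queue of orders $\alpha,\beta\in(0,1]$ with $\min\{\alpha,\beta\}<1$ and generalized inter-arrival and service rates $\lambda,\mu>0$. Let ${}_5\mathbf{Q}_n(t)=n^{-1}\,{}_5Q(n^\gamma t)$ with $\gamma=\min\{\alpha^{-1},\beta^{-1}\}$. Let $\sigma^{\mathsf a}_\alpha$ and $\sigma^{\mathsf d}_\beta$ be independent $\alpha$-stable and $\beta$-stable subordinators with inverses $L^{\mathsf a}_\alpha$ and $L^{\mathsf d}_\beta$ (where $\sigma_1^{\mathsf a}=\iota$ and $\sigma_1^{\mathsf d}=\iota$). Then, as $n\to+\infty$: (i) if $\alpha>\beta$, then ${}_5\mathbf{Q}_n\overset{\mathsf U}{\Rightarrow}L^{\mathsf a}_\alpha\circ\iota_{\lambda^{1/\alpha}}$; (ii) if $\alpha=\beta$, then $${}_5\mathbf{Q}_n\overset{\mathsf{M_1}}{\Rightarrow}L^{\mathsf a}_\alpha\circ\iota_{\lambda^{1/\alpha}}-L^{\mathsf d}_\alpha\circ\iota_{\mu^{1/\alpha}}\circ\mathbf{B},\qquad \mathbf{B}=\iota-\Psi\bigl(\mu^{-\frac1\alpha}\sigma^{\mathsf d}_\alpha\circ L^{\mathsf a}_\alpha\circ\iota_{\lambda^{1/\alpha}}-\iota\bigr);$$ (iii) if $\alpha<\beta$, then ${}_5\mathbf{Q}_n\overset{\mathsf U}{\Rightarrow}\mathbf{0}$.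
   Context: $E_\alpha(x)=\sum_{k\ge0} x^k/\Gamma(\alpha k+1)$ is the Mittag-Leffler function; $X\sim\mathsf{ML}_\alpha(\lambda)$ means $X\ge0$ and $\mathbb{P}(X>t)=E_\alpha(-\lambda t^\alpha)$ for $t\ge 0$. $\Psi(f)(t)=\sup_{0\le s\le t}\max\{-f(s),0\}$ and $\Phi(f)=f+\Psi(f)$ are the Skorokhod regulator and reflection maps. Mittag-Leffler $GI/GI/1$ queue: let $(T_k)_{k\ge1}$ be i.i.d. $\mathsf{ML}_\alpha(\lambda)$ (inter-arrival times) and $(S_k)_{k\ge1}$ i.i.d. $\mathsf{ML}_\beta(\mu)$ (service times), the two sequences being independent. Put $A_0=CS_0=0$, $A_k=A_{k-1}+T_k$, $CS_k=CS_{k-1}+S_k$, $N^{\mathsf a}(t)=\max\{k\ge0:A_k\le t\}$, $N^{\mathsf d}(t)=\max\{k\ge0:CS_k\le t\}$, $C(t)=CS_{N^{\mathsf a}(t)}$, $X(t)=C(t)-t$, $L(t)=\Phi(X)(t)$, $B(t)=C(t)-L(t)$ and $D(t)=N^{\mathsf d}(B(t))$. The queue length process is ${}_5Q(t)=N^{\mathsf a}(t)-D(t)$ (this is the single-server queue started empty). An $a$-stable subordinator $\sigma_a$ ($a\in(0,1)$) is the L\'evy process with $\mathbb{E}[e^{-z\sigma_a(t)}]=e^{-tz^a}$; its inverse is $L_a(t)=\min\{s\ge0:\sigma_a(s)\ge t\}$. $\iota_c(t)=ct$, $\iota=\iota_1$, and $\mathbf{0}$ is the zero process. $\overset{\mathsf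 U}{\Rightarrow}$ and $\overset{\mathsf{M_1}}{\Rightarrow}$ denote convergence in distribution of processes in the space $\mathbb{D}$ of c\`adl\`ag functions $[0,+\infty)\to\mathbb{R}$ with, respectively, the topology of uniform convergence on compact sets and Skorokhod's $M_1$ topology ($f_n\to f$ if for each continuity point $T$ of $f$ the restrictions to $[0,T]$ converge in the $M_1$ metric, i.e. the infimum over nondecreasing continuous parametrizations of the completed graphs of the uniform distance between the parametrizations). *)

theory Defs
  imports "HOL-Probability.Probability"
begin

subsection \<open>The path space\<close>

text \<open>Paths are functions on the whole real line of which only the values on \<open>[0, \<infinity>)\<close>
  matter: neither the convergences nor the sigma-algebra below see negative times.\<close>

definition cadlag :: "(real \<Rightarrow> real) set" where
  "cadlag = {f. (\<forall>t\<ge>0. (f \<longlongrightarrow> f t) (at_right t)) \<and> (\<forall>t>0. \<exists>l. (f \<longlongrightarrow> l) (at_left t))}"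

definition path_algebra :: "(real \<Rightarrow> real) measure" where
  "path_algebra = sigma cadlag {{f \<in> cadlag. f t \<in> A} | t A. 0 \<le> t \<and> A \<in> sets borel}"

text \<open>The topology on \<^term>\<open>cadlag\<close> whose open sets are the sequentially open sets of a notion of
  convergence of sequences. When the convergence comes from a metric, as do the two used below,
  this is the topology of that metric.\<close>

definition seq_open :: "((nat \<Rightarrow> real \<Rightarrow> real) \<Rightarrow> (real \<Rightarrow> real) \<Rightarrow> bool) \<Rightarrow> (real \<Rightarrow> real) set \<Rightarrow> bool" where
  "seq_open conv U \<longleftrightarrow> U \<subseteq> cadlag \<and>
     (\<forall>f\<in>U. \<forall>x. range x \<subseteq> cadlag \<and> conv x f \<longrightarrow> (\<forall>\<^sub>F n in sequentially. x n \<in> U))"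

definition seq_topology :: "((nat \<Rightarrow> real \<Rightarrow> real) \<Rightarrow> (real \<Rightarrow> real) \<Rightarrow> bool) \<Rightarrow> (real \<Rightarrow> real) topology" where
  "seq_topology conv = topology (seq_open conv)"

lemma istopology_seq_open: "istopology (seq_open conv)"
  unfolding istopology_def
proof (intro conjI allI impI)
  fix A B assume "seq_open conv A" "seq_open conv B"
  then show "seq_open conv (A \<inter> B)"
    unfolding seq_open_def by (auto simp: eventually_conj_iff)
next
  fix K assume K: "\<forall>A\<in>K. seq_open conv A"
  show "seq_open conv (\<Union>K)"
    unfolding seq_open_def
  proof (intro conjI ballI allI impI)
    show "\<Union>K \<subseteq> cadlag" using K unfolding seq_open_def by blast
  next
    fix f x assume "f \<in> \<Union>K" and x: "range x \<subseteq> cadlag \<and> conv x f"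
    then obtain A where A: "A \<in> K" "f \<in> A" by blast
    with K x have "\<forall>\<^sub>F n in sequentially. x n \<in> A" unfolding seq_open_def by blast
    then show "\<forall>\<^sub>F n in sequentially. x n \<in> \<Union>K"
      by eventually_elim (use A in blast)
  qed
qed

lemma openin_seq_topology: "openin (seq_topology conv) U \<longleftrightarrow> seq_open conv U"
  by (simp add: seq_topology_def istopology_seq_open)

lemma topspace_seq_topology: "topspace (seq_topology conv) = cadlag"
proof (rule antisym)
  show "topspace (seq_topology conv) \<subseteq> cadlag"
    unfolding topspace_def openin_seq_topology seq_open_def by blast
  have "seq_open conv cadlag"
    unfolding seq_open_def by (auto intro!: always_eventually)
  then show "cadlag \<subseteq> topspace (seq_topology conv)"
    unfolding topspace_def openin_seq_topology by blast
qed

definition U_conv :: "(nat \<Rightarrow> real \<Rightarrow> real) \<Rightarrow> (real \<Rightarrow> real) \<Rightarrow> bool" where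
  "U_conv x f \<longleftrightarrow> (\<forall>T>0. uniform_limit {0..T} x f sequentially)"

definition left_value :: "(real \<Rightarrow> real) \<Rightarrow> real \<Rightarrow> real" where
  "left_value f t = (if t \<le> 0 then f 0 else Lim (at_left t) f)"

definition completed_graph :: "(real \<Rightarrow> real) \<Rightarrow> real \<Rightarrow> (real \<times> real) set" where
  "completed_graph f T = {(z, t). t \<in> {0..T} \<and> z \<in> closed_segment (left_value f t) (f t)}"

fun graph_le :: "(real \<Rightarrow> real) \<Rightarrow> real \<times> real \<Rightarrow> real \<times> real \<Rightarrow> bool" where
  "graph_le f (z, t) (z', t') \<longleftrightarrow>
     t < t' \<or> (t = t' \<and> \<bar>left_value f t - z\<bar> \<le> \<bar>left_value f t - z'\<bar>)"

definition parametrizations :: "(real \<Rightarrow> real) \<Rightarrow> real \<Rightarrow> (real \<Rightarrow> real \<times> real) set" where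
  "parametrizations f T =
     {p. continuous_on {0..1} p \<and> p ` {0..1} = completed_graph f T \<and>
         (\<forall>s\<in>{0..1}. \<forall>s'\<in>{0..1}. s \<le> s' \<longrightarrow> graph_le f (p s) (p s'))}"

definition M1_dist :: "real \<Rightarrow> (real \<Rightarrow> real) \<Rightarrow> (real \<Rightarrow> real) \<Rightarrow> real" where
  "M1_dist T f g =
     (INF (p, q) \<in> parametrizations f T \<times> parametrizations g T.
        SUP s\<in>{0..1}. max \<bar>fst (p s) - fst (q s)\<bar> \<bar>snd (p s) - snd (q s)\<bar>)"

definition M1_conv :: "(nat \<Rightarrow> real \<Rightarrow> real) \<Rightarrow> (real \<Rightarrow> real) \<Rightarrow> bool" where
  "M1_conv x f \<longleftrightarrow> (\<forall>T>0. isCont f T \<longrightarrow> (\<lambda>n. M1_dist T (x n) f) \<longlonglongrightarrow> 0)"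

definition U_topology :: "(real \<Rightarrow> real) topology" where
  "U_topology = seq_topology U_conv"

definition M1_topology :: "(real \<Rightarrow> real) topology" where
  "M1_topology = seq_topology M1_conv"

subsection \<open>Convergence in distribution\<close>

text \<open>Sample paths are only required to be cadlag almost surely. All measurability is therefore
  taken with respect to the completion of the underlying measure, so that modifying a process on a
  subset of a null set changes nothing.\<close>

definition cadlag_process :: "'a measure \<Rightarrow> ('a \<Rightarrow> real \<Rightarrow> real) \<Rightarrow> bool" where
  "cadlag_process M X \<longleftrightarrow>
     (\<forall>t\<ge>0. (\<lambda>\<omega>. X \<omega> t) \<in> borel_measurable (completion M)) \<and> (AE \<omega> in M. X \<omega> \<in> cadlag)"

text \<open>The test functionals are bounded, continuous, and measurable for the sigma-algebra generated
  by the evaluations. For the \<open>M\<^sub>1\<close> topology, whose Borel sets are generated by the evaluations,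
  measurability is automatic. For the non-separable uniform topology it is the usual requirement,
  since a process with jumps at random times is in general not Borel measurable there; for limits
  with continuous paths the notion agrees with the one defined through outer expectations and
  arbitrary bounded continuous functionals.\<close>

definition converges_in_distribution ::
  "(real \<Rightarrow> real) topology \<Rightarrow> 'a measure \<Rightarrow> (nat \<Rightarrow> 'a \<Rightarrow> real \<Rightarrow> real) \<Rightarrow>
   'b measure \<Rightarrow> ('b \<Rightarrow> real \<Rightarrow> real) \<Rightarrow> bool" where
  "converges_in_distribution \<tau> M X N Y \<longleftrightarrow>
     (\<forall>n. cadlag_process M (X n)) \<and> cadlag_process N Y \<and>
     (\<forall>F. F \<in> borel_measurable path_algebra \<and> continuous_map \<tau> euclideanreal F \<and>
           bounded (F ` cadlag) \<longrightarrow>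
        (\<lambda>n. \<integral>\<omega>. F (X n \<omega>) \<partial>completion M) \<longlonglongrightarrow> (\<integral>\<omega>. F (Y \<omega>) \<partial>completion N))"

subsection \<open>Stable subordinators and their inverses\<close>

definition levy_process :: "'a measure \<Rightarrow> ('a \<Rightarrow> real \<Rightarrow> real) \<Rightarrow> bool" where
  "levy_process M X \<longleftrightarrow>
     (\<forall>t\<ge>0. (\<lambda>\<omega>. X \<omega> t) \<in> borel_measurable M) \<and>
     (AE \<omega> in M. X \<omega> 0 = 0) \<and>
     (AE \<omega> in M. X \<omega> \<in> cadlag) \<and>
     (\<forall>(s :: nat \<Rightarrow> real) k. 0 \<le> s 0 \<and> (\<forall>i<k. s i \<le> s (Suc i)) \<longrightarrow>
        prob_space.indep_vars M (\<lambda>_. borel) (\<lambda>i \<omega>. X \<omega> (s (Suc i)) - X \<omega> (s i)) {..<k}) \<and>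
     (\<forall>t\<ge>0. \<forall>h\<ge>0. distr M borel (\<lambda>\<omega>. X \<omega> (t + h) - X \<omega> t) = distr M borel (\<lambda>\<omega>. X \<omega> h))"

text \<open>For \<open>a = 1\<close> the subordinator is by convention the identity.\<close>

definition stable_subordinator :: "'a measure \<Rightarrow> real \<Rightarrow> ('a \<Rightarrow> real \<Rightarrow> real) \<Rightarrow> bool" where
  "stable_subordinator M a \<sigma> \<longleftrightarrow>
     (if a = 1 then AE \<omega> in M. \<forall>t\<ge>0. \<sigma> \<omega> t = t
      else levy_process M \<sigma> \<and> (AE \<omega> in M. mono_on {0..} (\<sigma> \<omega>)) \<and>
           (\<forall>t\<ge>0. \<forall>z\<ge>0. (\<integral>\<omega>. exp (- z * \<sigma> \<omega> t) \<partial>M) = exp (- t * z powr a)))"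

definition indep_processes ::
  "'a measure \<Rightarrow> ('a \<Rightarrow> real \<Rightarrow> real) \<Rightarrow> ('a \<Rightarrow> real \<Rightarrow> real) \<Rightarrow> bool" where
  "indep_processes M X Y \<longleftrightarrow>
     prob_space.indep_var M (PiM {0..} (\<lambda>_. borel)) (\<lambda>\<omega>. restrict (X \<omega>) {0..})
                            (PiM {0..} (\<lambda>_. borel)) (\<lambda>\<omega>. restrict (Y \<omega>) {0..})"

definition inverse_path :: "(real \<Rightarrow> real) \<Rightarrow> real \<Rightarrow> real" where
  "inverse_path \<sigma> t = (LEAST s. 0 \<le> s \<and> t \<le> \<sigma> s)"

subsection \<open>The Mittag-Leffler queue\<close>

definition skorokhod_regulator :: "(real \<Rightarrow> real) \<Rightarrow> real \<Rightarrow> real" where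
  "skorokhod_regulator f t = (SUP s\<in>{0..t}. max (- f s) 0)"

definition skorokhod_reflection :: "(real \<Rightarrow> real) \<Rightarrow> real \<Rightarrow> real" where
  "skorokhod_reflection f t = f t + skorokhod_regulator f t"

definition mittag_leffler :: "real \<Rightarrow> real \<Rightarrow> real" where
  "mittag_leffler a x = (\<Sum>k. x ^ k / Gamma (a * real k + 1))"

definition mittag_leffler_distributed :: "'a measure \<Rightarrow> real \<Rightarrow> real \<Rightarrow> ('a \<Rightarrow> real) \<Rightarrow> bool" where
  "mittag_leffler_distributed M a l X \<longleftrightarrow>
     X \<in> borel_measurable M \<and> (AE \<omega> in M. 0 \<le> X \<omega>) \<and>
     (\<forall>t\<ge>0. measure M {\<omega> \<in> space M. t < X \<omega>} = mittag_leffler a (- l * t powr a))"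

text \<open>Inter-arrival times \<open>T k\<close> and service times \<open>S k\<close> are indexed by \<open>k \<ge> 1\<close>.\<close>

definition mittag_leffler_queue ::
  "'a measure \<Rightarrow> real \<Rightarrow> real \<Rightarrow> real \<Rightarrow> real \<Rightarrow> (nat \<Rightarrow> 'a \<Rightarrow> real) \<Rightarrow> (nat \<Rightarrow> 'a \<Rightarrow> real) \<Rightarrow> bool" where
  "mittag_leffler_queue M \<alpha> \<beta> l \<mu> T S \<longleftrightarrow>
     (\<forall>k\<ge>1. mittag_leffler_distributed M \<alpha> l (T k)) \<and> prob_space.indep_vars M (\<lambda>_. borel) T {1..} \<and>
     (\<forall>k\<ge>1. mittag_leffler_distributed M \<beta> \<mu> (S k)) \<and> prob_space.indep_vars M (\<lambda>_. borel) S {1..} \<and>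
     prob_space.indep_var M (PiM {1..} (\<lambda>_. borel)) (\<lambda>\<omega>. \<lambda>k\<in>{1..}. T k \<omega>)
                            (PiM {1..} (\<lambda>_. borel)) (\<lambda>\<omega>. \<lambda>k\<in>{1..}. S k \<omega>)"

definition partial_sum :: "(nat \<Rightarrow> real) \<Rightarrow> nat \<Rightarrow> real" where
  "partial_sum T k = (\<Sum>i=1..k. T i)"

text \<open>The set below is finite for almost every realisation of the queue.\<close>

definition counting :: "(nat \<Rightarrow> real) \<Rightarrow> real \<Rightarrow> nat" where
  "counting T t = Max {k. partial_sum T k \<le> t}"

definition cumulative_input :: "(nat \<Rightarrow> real) \<Rightarrow> (nat \<Rightarrow> real) \<Rightarrow> real \<Rightarrow> real" where
  "cumulative_input T S t = partial_sum S (counting T t)"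

definition workload :: "(nat \<Rightarrow> real) \<Rightarrow> (nat \<Rightarrow> real) \<Rightarrow> real \<Rightarrow> real" where
  "workload T S = skorokhod_reflection (\<lambda>t. cumulative_input T S t - t)"

definition busy_time :: "(nat \<Rightarrow> real) \<Rightarrow> (nat \<Rightarrow> real) \<Rightarrow> real \<Rightarrow> real" where
  "busy_time T S t = cumulative_input T S t - workload T S t"

definition departures :: "(nat \<Rightarrow> real) \<Rightarrow> (nat \<Rightarrow> real) \<Rightarrow> real \<Rightarrow> nat" where
  "departures T S t = counting S (busy_time T S t)"

definition queue_length :: "(nat \<Rightarrow> real) \<Rightarrow> (nat \<Rightarrow> real) \<Rightarrow> real \<Rightarrow> real" where
  "queue_length T S t = real (counting T t) - real (departures T S t)"

end

theory Submission
  imports Defs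
begin

text \<open>
  A Mittag-Leffler variable is a stable subordinator evaluated at an independent exponential time.
  Hence, for every \<open>n\<close>, the inter-arrival and service times divided by \<open>n\<^sup>\<gamma>\<close> have the same joint law as
  the increments of multiples of \<open>\<sigma>\<^sup>a\<close> and \<open>\<sigma>\<^sup>d\<close> along two fixed sequences of partial sums of
  exponential variables, the latter divided by \<open>n\<^sup>\<gamma>\<^sup>\<alpha>\<close> and \<open>n\<^sup>\<gamma>\<^sup>\<beta>\<close>. This couples all rescaled queues and the
  limit on one probability space, and it suffices to prove almost sure convergence there.

  By the law of large numbers the rescaled exponential sums become the identity, so the two counting
  processes, divided by \<open>n\<^sup>\<gamma>\<^sup>\<alpha>\<close> and \<open>n\<^sup>\<gamma>\<^sup>\<beta>\<close>, converge uniformly on compact sets to the inverses of the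
  subordinators, which are continuous. If \<open>\<alpha> = \<beta>\<close>, the busy times converge because \<open>\<sigma>\<^sup>a\<close> and \<open>\<sigma>\<^sup>d\<close>
  almost surely have no common jump; the limit of the queue length is again continuous, so that the
  convergence is even uniform, which implies \<open>M\<^sub>1\<close> convergence.
\<close>

subsection \<open>Arrival sequences and step paths\<close>

definition arrival_seq :: "(nat \<Rightarrow> real) \<Rightarrow> bool" where
  "arrival_seq x \<longleftrightarrow> (\<forall>k\<ge>1. 0 < x k) \<and> (\<forall>K::nat. \<exists>k. real K < partial_sum x k)"

lemma partial_sum_0 [simp]: "partial_sum x 0 = 0"
  by (simp add: partial_sum_def)

lemma partial_sum_Suc [simp]: "partial_sum x (Suc k) = partial_sum x k + x (Suc k)"
  by (simp add: partial_sum_def)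

lemma partial_sum_cong: "(\<And>k. 1 \<le> k \<Longrightarrow> x k = y k) \<Longrightarrow> partial_sum x = partial_sum y"
  by (auto simp: partial_sum_def intro!: sum.cong)

lemma partial_sum_divide: "partial_sum (\<lambda>k. x k / c) k = partial_sum x k / c"
  by (simp add: partial_sum_def sum_divide_distrib)

lemma arrival_seq_divide:
  assumes "arrival_seq x" "0 < c"
  shows "arrival_seq (\<lambda>k. x k / c)"
  unfolding arrival_seq_def
proof (intro conjI allI impI)
  fix k :: nat assume "1 \<le> k" then show "0 < x k / c"
    using assms by (simp add: arrival_seq_def)
next
  fix K :: nat
  obtain K' :: nat where "real K * c \<le> real K'" using real_arch_simple by blast
  moreover obtain k where "real K' < partial_sum x k"
    using assms by (auto simp: arrival_seq_def)
  ultimately have "real K * c < partial_sum x k" by simp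
  then have "real K < partial_sum (\<lambda>k. x k / c) k"
    using assms by (simp add: partial_sum_divide field_simps)
  then show "\<exists>k. real K < partial_sum (\<lambda>k. x k / c) k" ..
qed

lemma strict_mono_partial_sum: "arrival_seq x \<Longrightarrow> strict_mono (partial_sum x)"
  by (rule strict_monoI_Suc) (simp add: arrival_seq_def)

lemma finite_partial_sum_le:
  assumes "arrival_seq x"
  shows "finite {k. partial_sum x k \<le> t}"
proof -
  obtain K :: nat where "t \<le> real K" using real_arch_simple by blast
  moreover obtain k where "real K < partial_sum x k"
    using assms by (auto simp: arrival_seq_def)
  ultimately have "j < k" if "partial_sum x j \<le> t" for j
    using that strict_mono_partial_sum[OF assms, THEN strict_mono_less, of j k] by linarith
  then show ?thesis
    using finite_subset[of "{k. partial_sum x k \<le> t}" "{..<k}"] by auto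
qed

lemma le_counting_iff:
  assumes "arrival_seq x" "0 \<le> t"
  shows "k \<le> counting x t \<longleftrightarrow> partial_sum x k \<le> t"
proof -
  let ?A = "{k. partial_sum x k \<le> t}"
  have ne: "?A \<noteq> {}" using assms(2) by (auto intro!: exI[of _ 0])
  have "Max ?A \<in> ?A" by (rule Max_in[OF finite_partial_sum_le[OF assms(1)] ne])
  then have "partial_sum x k \<le> t" if "k \<le> Max ?A"
    using that strict_mono_partial_sum[OF assms(1), THEN strict_mono_less_eq, of k "Max ?A"]
    by simp
  moreover have "k \<le> Max ?A" if "partial_sum x k \<le> t"
    using that finite_partial_sum_le[OF assms(1)] by (intro Max_ge) auto
  ultimately show ?thesis by (auto simp: counting_def)
qed

lemma counting_less_iff:
  assumes "arrival_seq x" "0 \<le> t"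
  shows "counting x t < k \<longleftrightarrow> t < partial_sum x k"
  using le_counting_iff[OF assms, of k] by linarith

lemma partial_sum_counting_le: "arrival_seq x \<Longrightarrow> 0 \<le> t \<Longrightarrow> partial_sum x (counting x t) \<le> t"
  using le_counting_iff by blast

lemma less_partial_sum_Suc_counting:
  "arrival_seq x \<Longrightarrow> 0 \<le> t \<Longrightarrow> t < partial_sum x (Suc (counting x t))"
  using counting_less_iff by blast

lemma mono_on_counting: "arrival_seq x \<Longrightarrow> mono_on {0..} (counting x)"
proof (intro mono_onI)
  fix r s :: real assume x: "arrival_seq x" and rs: "r \<in> {0..}" "s \<in> {0..}" "r \<le> s"
  then have "partial_sum x (counting x r) \<le> s"
    using partial_sum_counting_le[OF x, of r] by simp
  with x rs show "counting x r \<le> counting x s" by (simp add: le_counting_iff)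
qed

lemma counting_partial_sum: "arrival_seq x \<Longrightarrow> counting x (partial_sum x k) = k"
proof -
  assume x: "arrival_seq x"
  have "0 \<le> partial_sum x k"
    using strict_mono_partial_sum[OF x, THEN strict_mono_less_eq, of 0 k] by simp
  from le_counting_iff[OF x this] show ?thesis
    using strict_mono_partial_sum[OF x, THEN strict_mono_less_eq] by (metis le_antisym order_refl)
qed

lemma partial_sum_nonneg: "arrival_seq x \<Longrightarrow> 0 \<le> partial_sum x k"
  using strict_mono_partial_sum[THEN strict_mono_less_eq, of x 0 k] by simp

lemma counting_divide: "0 < c \<Longrightarrow> counting (\<lambda>k. x k / c) t = counting x (c * t)"
  by (simp add: counting_def partial_sum_divide field_simps)

definition step_path :: "(real \<Rightarrow> 'b) \<Rightarrow> bool" where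
  "step_path f \<longleftrightarrow> (\<forall>t\<ge>0. \<exists>u>t. \<forall>s\<in>{t..<u}. f s = f t) \<and>
     (\<forall>t>0. \<exists>u\<in>{0..<t}. \<forall>s\<in>{u..<t}. f s = f u)"

lemma step_path_comp2:
  assumes f: "step_path f" and g: "step_path g"
  shows "step_path (\<lambda>t. h (f t) (g t))"
  unfolding step_path_def
proof (intro conjI allI impI)
  fix t :: real assume t: "0 \<le> t"
  from f t obtain u where u: "t < u" "\<And>s. s\<in>{t..<u} \<Longrightarrow> f s = f t" unfolding step_path_def by blast
  from g t obtain v where v: "t < v" "\<And>s. s\<in>{t..<v} \<Longrightarrow> g s = g t" unfolding step_path_def by blast
  have "h (f s) (g s) = h (f t) (g t)" if "s \<in> {t..<min u v}" for s
    using u(2)[of s] v(2)[of s] that by simp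
  then show "\<exists>u>t. \<forall>s\<in>{t..<u}. h (f s) (g s) = h (f t) (g t)"
    using u(1) v(1) by (meson min_less_iff_conj)
next
  fix t :: real assume t: "0 < t"
  from f t obtain u where u: "u\<in>{0..<t}" "\<And>s. s\<in>{u..<t} \<Longrightarrow> f s = f u" unfolding step_path_def by blast
  from g t obtain v where v: "v\<in>{0..<t}" "\<And>s. s\<in>{v..<t} \<Longrightarrow> g s = g v" unfolding step_path_def by blast
  have "h (f s) (g s) = h (f (max u v)) (g (max u v))" if "s \<in> {max u v..<t}" for s
    using u(2)[of s] v(2)[of s] u(2)[of "max u v"] v(2)[of "max u v"] that u(1) v(1) by simp
  then show "\<exists>u\<in>{0..<t}. \<forall>s\<in>{u..<t}. h (f s) (g s) = h (f u) (g u)"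
    using u(1) v(1) by (meson atLeastLessThan_iff max.coboundedI1 max_less_iff_conj)
qed

lemma step_path_comp: "step_path f \<Longrightarrow> step_path (\<lambda>t. h (f t))"
  using step_path_comp2[of f f "\<lambda>x y. h x"] by simp

lemma step_path_const: "step_path (\<lambda>t. c)"
  unfolding step_path_def
proof (intro conjI allI impI)
  show "\<exists>u>t. \<forall>s\<in>{t..<u}. c = c" for t :: real by (auto intro: gt_ex)
  show "\<exists>u\<in>{0..<t}. \<forall>s\<in>{u..<t}. c = c" if "0 < t" for t :: real
    using that by (intro bexI[of _ 0]) auto
qed

lemma step_path_cadlag:
  fixes f :: "real \<Rightarrow> real"
  assumes "step_path f"
  shows "f \<in> cadlag"
  unfolding cadlag_def
proof (intro CollectI conjI allI impI)
  fix t :: real assume "0 \<le> t"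
  then obtain u where u: "t < u" "\<forall>s\<in>{t..<u}. f s = f t" using assms unfolding step_path_def by blast
  have "eventually (\<lambda>s. f t = f s) (at_right t)"
    unfolding eventually_at_right_field using u by (metis atLeastLessThan_iff less_imp_le)
  then show "(f \<longlongrightarrow> f t) (at_right t)"
    by (rule Lim_transform_eventually[OF tendsto_const])
next
  fix t :: real assume "0 < t"
  then obtain u where u: "u\<in>{0..<t}" "\<forall>s\<in>{u..<t}. f s = f u" using assms unfolding step_path_def by blast
  have "eventually (\<lambda>s. f u = f s) (at_left t)"
    unfolding eventually_at_left_field using u by (metis atLeastLessThan_iff less_imp_le)
  then show "\<exists>l. (f \<longlongrightarrow> l) (at_left t)"
    using Lim_transform_eventually[OF tendsto_const] by blast
qed

lemma isCont_at_left: "isCont f (t :: real) \<Longrightarrow> (f \<longlongrightarrow> f t) (at_left t)"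
  unfolding isCont_def by (rule filterlim_mono) (auto simp: at_le)

lemma continuous_on_isCont: "continuous_on {0..} f \<Longrightarrow> 0 < t \<Longrightarrow> isCont f (t :: real)"
  by (rule continuous_on_interior) (auto simp: interior_real_atLeast)

lemma cadlag_cong:
  assumes "\<And>t. 0 \<le> t \<Longrightarrow> f t = g t"
  shows "f \<in> cadlag \<longleftrightarrow> g \<in> cadlag"
proof -
  have *: "g \<in> cadlag" if f: "f \<in> cadlag" and eq: "\<And>t. 0 \<le> t \<Longrightarrow> f t = g t" for f g
    unfolding cadlag_def
  proof (intro CollectI conjI allI impI)
    fix t :: real assume t: "0 \<le> t"
    have "eventually (\<lambda>s. f s = g s) (at_right t)"
      unfolding eventually_at_right_field using t eq by (intro exI[of _ "t + 1"]) auto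
    moreover have "(f \<longlongrightarrow> g t) (at_right t)" using f t unfolding eq[OF t, symmetric] by (simp add: cadlag_def)
    ultimately show "(g \<longlongrightarrow> g t) (at_right t)" by (rule Lim_transform_eventually[rotated])
  next
    fix t :: real assume t: "0 < t"
    have "eventually (\<lambda>s. f s = g s) (at_left t)"
      unfolding eventually_at_left_field using t eq by (intro exI[of _ 0]) auto
    moreover obtain l where "(f \<longlongrightarrow> l) (at_left t)" using f t by (auto simp: cadlag_def)
    ultimately show "\<exists>l. (g \<longlongrightarrow> l) (at_left t)" using Lim_transform_eventually by blast
  qed
  show ?thesis using *[of f g] *[of g f] assms by auto
qed

lemma continuous_cadlag:
  assumes f: "continuous_on {0..} f"
  shows "f \<in> cadlag"
  unfolding cadlag_def
proof (intro CollectI conjI allI impI)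
  fix t :: real assume t: "0 \<le> t"
  then have "(f \<longlongrightarrow> f t) (at t within {0..})" using f by (simp add: continuous_on_def)
  then show "(f \<longlongrightarrow> f t) (at_right t)" by (rule tendsto_within_subset) (use t in auto)
next
  fix t :: real assume t: "0 < t"
  then have "isCont f t" using f by (intro continuous_on_interior[OF f]) (auto simp: interior_real_atLeast)
  then have "(f \<longlongrightarrow> f t) (at_left t)" unfolding isCont_def by (rule filterlim_mono) (auto simp: at_le)
  then show "\<exists>l. (f \<longlongrightarrow> l) (at_left t)" by blast
qed

lemma mono_nat_step_left:
  fixes h :: "real \<Rightarrow> nat"
  assumes h: "mono_on {0..} h" and t: "0 < t"
  shows "\<exists>u\<in>{0..<t}. \<forall>s\<in>{u..<t}. h s = h u"
proof -
  have "h ` {0..<t} \<subseteq> {..h t}" using h by (auto simp: mono_on_def)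
  then have fin: "finite (h ` {0..<t})" by (rule finite_subset) simp
  moreover have "h ` {0..<t} \<noteq> {}" using t by simp
  ultimately have "Max (h ` {0..<t}) \<in> h ` {0..<t}" by (rule Max_in)
  then obtain u where u: "u \<in> {0..<t}" "Max (h ` {0..<t}) = h u" by blast
  have "h s = h u" if "s \<in> {u..<t}" for s
  proof (rule antisym)
    have "s \<in> {0..<t}" using that u(1) by auto
    then have "h s \<le> Max (h ` {0..<t})" using fin by (intro Max_ge) auto
    then show "h s \<le> h u" using u(2) by simp
    show "h u \<le> h s" using that u(1) by (intro mono_onD[OF h]) auto
  qed
  with u(1) show ?thesis by blast
qed

lemma step_path_counting_comp:
  assumes x: "arrival_seq x" and b: "continuous_on {0..} b" "mono_on {0..} b"
    and b0: "\<And>t. 0 \<le> t \<Longrightarrow> 0 \<le> b t"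
  shows "step_path (\<lambda>t. counting x (b t))"
proof -
  have m: "mono_on {0..} (\<lambda>t. counting x (b t))"
    using b(2) b0 mono_on_counting[OF x] by (auto simp: mono_on_def)
  show ?thesis
    unfolding step_path_def
  proof (intro conjI allI impI mono_nat_step_left[OF m])
    fix t :: real assume t: "0 \<le> t"
    let ?p = "partial_sum x (Suc (counting x (b t)))"
    have "b t < ?p" using x b0[OF t] by (rule less_partial_sum_Suc_counting)
    moreover have "(b \<longlongrightarrow> b t) (at t within {0..})"
      using b(1) t by (simp add: continuous_on_def)
    ultimately have "eventually (\<lambda>s. b s < ?p) (at t within {0..})"
      by (simp add: order_tendsto_iff)
    then obtain d where d: "0 < d" "\<forall>s\<in>{0..}. s \<noteq> t \<and> dist s t < d \<longrightarrow> b s < ?p"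
      unfolding eventually_at by blast
    have "counting x (b s) = counting x (b t)" if s: "s \<in> {t..<t + d}" for s
    proof (cases "s = t")
      case False
      have "b s < ?p" using d(2) s t False by (auto simp: dist_real_def)
      then have "counting x (b s) < Suc (counting x (b t))"
        using s t by (subst counting_less_iff[OF x b0]) auto
      moreover have "counting x (b t) \<le> counting x (b s)"
        using m s t by (auto simp: mono_on_def)
      ultimately show ?thesis by simp
    qed simp
    then show "\<exists>u>t. \<forall>s\<in>{t..<u}. counting x (b s) = counting x (b t)"
      using d(1) by (meson less_add_same_cancel1)
  qed
qed

subsection \<open>Inverses of subordinator paths and the regulator\<close>

definition subordinator_path :: "(real \<Rightarrow> real) \<Rightarrow> bool" where
  "subordinator_path a \<longleftrightarrow> a 0 = 0 \<and> strict_mono_on {0..} a \<and>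
     (\<forall>t\<ge>0. (a \<longlongrightarrow> a t) (at_right t)) \<and> (\<forall>K::nat. \<exists>t\<ge>0. real K < a t)"

lemma subordinator_path_less_iff:
  "subordinator_path a \<Longrightarrow> 0 \<le> s \<Longrightarrow> 0 \<le> t \<Longrightarrow> a s < a t \<longleftrightarrow> s < t"
  unfolding subordinator_path_def by (metis atLeast_iff strict_mono_on_less)

lemma subordinator_path_le_iff:
  "subordinator_path a \<Longrightarrow> 0 \<le> s \<Longrightarrow> 0 \<le> t \<Longrightarrow> a s \<le> a t \<longleftrightarrow> s \<le> t"
  using subordinator_path_less_iff[of a t s] by linarith

lemma subordinator_path_nonneg: "subordinator_path a \<Longrightarrow> 0 \<le> s \<Longrightarrow> 0 \<le> a s"
  using subordinator_path_le_iff[of a 0 s] by (simp add: subordinator_path_def)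

lemma inverse_path:
  assumes a: "subordinator_path a"
  shows inverse_path_nonneg: "0 \<le> inverse_path a t"
    and le_inverse_path: "t \<le> a (inverse_path a t)"
    and inverse_path_least: "0 \<le> s \<Longrightarrow> t \<le> a s \<Longrightarrow> inverse_path a t \<le> s"
proof -
  define A where "A = {s. 0 \<le> s \<and> t \<le> a s}"
  define m where "m = Inf A"
  obtain K :: nat where "t \<le> real K" using real_arch_simple by blast
  moreover obtain s0 where "0 \<le> s0" "real K < a s0" using a by (auto simp: subordinator_path_def)
  ultimately have ne: "A \<noteq> {}" by (auto simp: A_def intro!: exI[of _ s0])
  have bdd: "bdd_below A" by (auto simp: A_def intro!: bdd_belowI[of _ 0])
  have m0: "0 \<le> m" unfolding m_def using ne by (intro cInf_greatest) (auto simp: A_def)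
  have mt: "t \<le> a m"
  proof (rule ccontr)
    assume neg: "\<not> t \<le> a m"
    have "(a \<longlongrightarrow> a m) (at_right m)" using a m0 by (auto simp: subordinator_path_def)
    then have "eventually (\<lambda>s. a s < t) (at_right m)"
      using neg by (simp add: order_tendsto_iff)
    then obtain b where b: "m < b" "\<And>s. m < s \<Longrightarrow> s < b \<Longrightarrow> a s < t"
      unfolding eventually_at_right_field by blast
    obtain s where s: "s \<in> A" "s < b"
      using cInf_lessD[OF ne, of b] b(1) by (auto simp: m_def)
    then have "m \<le> s" unfolding m_def using bdd by (intro cInf_lower)
    then have "a s < t" using b(2)[of s] s(2) neg by (cases "s = m") auto
    with s(1) show False by (simp add: A_def)
  qed
  have min: "m \<le> s" if "0 \<le> s \<and> t \<le> a s" for s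
    unfolding m_def using that bdd by (intro cInf_lower) (auto simp: A_def)
  have eq: "inverse_path a t = m"
    unfolding inverse_path_def by (rule Least_equality) (use m0 mt min in auto)
  show "0 \<le> inverse_path a t" "t \<le> a (inverse_path a t)"
    "0 \<le> s \<Longrightarrow> t \<le> a s \<Longrightarrow> inverse_path a t \<le> s"
    using m0 mt min by (auto simp: eq)
qed

lemma inverse_path_le_iff:
  assumes a: "subordinator_path a" and s: "0 \<le> s"
  shows "inverse_path a t \<le> s \<longleftrightarrow> t \<le> a s"
  using inverse_path[OF a] s subordinator_path_le_iff[OF a, of "inverse_path a t" s]
  by (meson order_trans)

lemma less_inverse_path_iff:
  "subordinator_path a \<Longrightarrow> 0 \<le> s \<Longrightarrow> s < inverse_path a t \<longleftrightarrow> a s < t"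
  using inverse_path_le_iff[of a s t] by linarith

lemma inverse_path_path:
  assumes a: "subordinator_path a" and s: "0 \<le> s"
  shows "inverse_path a (a s) = s"
proof (rule antisym)
  show "inverse_path a (a s) \<le> s" using a s by (simp add: inverse_path_le_iff)
  show "s \<le> inverse_path a (a s)"
    using le_inverse_path[OF a, of "a s"] a s by (simp add: subordinator_path_le_iff inverse_path_nonneg)
qed

lemma inverse_path_0: "subordinator_path a \<Longrightarrow> inverse_path a 0 = 0"
  using inverse_path_path[of a 0] by (simp add: subordinator_path_def)

lemma mono_inverse_path: "subordinator_path a \<Longrightarrow> mono (inverse_path a)"
  by (intro monoI) (meson inverse_path_least inverse_path_nonneg le_inverse_path order_trans)

lemma isCont_inverse_path:
  assumes a: "subordinator_path a"
  shows "isCont (inverse_path a) t"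
  unfolding isCont_def
proof (rule order_tendstoI)
  fix y assume y: "y < inverse_path a t"
  show "eventually (\<lambda>s. y < inverse_path a s) (at t)"
  proof (cases "y < 0")
    case True
    then show ?thesis using inverse_path_nonneg[OF a] by (auto intro!: always_eventually less_le_trans[OF True])
  next
    case False
    with y have "a y < t" by (simp add: less_inverse_path_iff[OF a])
    then have "eventually (\<lambda>s. a y < s) (at t)"
      using order_tendstoD(1)[OF tendsto_ident_at] by blast
    then show ?thesis using False by (simp add: less_inverse_path_iff[OF a])
  qed
next
  fix y assume y: "inverse_path a t < y"
  define z where "z = (inverse_path a t + y) / 2"
  have z: "inverse_path a t < z" "z < y" "0 \<le> z"
    using y inverse_path_nonneg[OF a, of t] by (auto simp: z_def)
  have "a (inverse_path a t) < a z"
    using z inverse_path_nonneg[OF a, of t] by (simp add: subordinator_path_less_iff[OF a])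
  then have "t < a z" using le_inverse_path[OF a, of t] by linarith
  then have "eventually (\<lambda>s. s < a z) (at t)"
    using order_tendstoD(2)[OF tendsto_ident_at] by blast
  then show "eventually (\<lambda>s. inverse_path a s < y) (at t)"
  proof eventually_elim
    case (elim s)
    then have "inverse_path a s \<le> z" using z(3) by (simp add: inverse_path_le_iff[OF a])
    then show ?case using z(2) by linarith
  qed
qed

lemma continuous_on_inverse_path: "subordinator_path a \<Longrightarrow> continuous_on A (inverse_path a)"
  by (simp add: continuous_at_imp_continuous_on isCont_inverse_path)

text \<open>For the cumulative input \<open>C\<close> of the queue this is the busy time \<open>B = C - \<Phi>(C - \<iota>)\<close>, since the
  \<open>C\<close> cancels and \<open>t - \<Psi>(C - \<iota>)(t)\<close> remains.\<close>

definition busy :: "(real \<Rightarrow> real) \<Rightarrow> real \<Rightarrow> real" where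
  "busy C t = t - skorokhod_regulator (\<lambda>s. C s - s) t"

context
  fixes C :: "real \<Rightarrow> real"
  assumes C_nonneg: "\<And>s. 0 \<le> s \<Longrightarrow> 0 \<le> C s"
begin

lemma bdd_above_regulator: "bdd_above ((\<lambda>s. max (- (C s - s)) 0) ` {0..t})"
  by (rule bdd_aboveI[of _ "max t 0"]) (use C_nonneg in \<open>fastforce simp: max_def\<close>)

lemma regulator_ge: "0 \<le> s \<Longrightarrow> s \<le> t \<Longrightarrow> s - C s \<le> skorokhod_regulator (\<lambda>s. C s - s) t"
  unfolding skorokhod_regulator_def
  by (rule order_trans[OF _ cSUP_upper[OF _ bdd_above_regulator, of s]]) auto

lemma regulator_nonneg: "0 \<le> t \<Longrightarrow> 0 \<le> skorokhod_regulator (\<lambda>s. C s - s) t"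
  unfolding skorokhod_regulator_def
  by (rule order_trans[OF _ cSUP_upper[OF _ bdd_above_regulator, of 0]]) auto

lemma regulator_le:
  "0 \<le> t \<Longrightarrow> 0 \<le> r \<Longrightarrow> (\<And>s. 0 \<le> s \<Longrightarrow> s \<le> t \<Longrightarrow> s - C s \<le> r) \<Longrightarrow> skorokhod_regulator (\<lambda>s. C s - s) t \<le> r"
  unfolding skorokhod_regulator_def by (rule cSUP_least) auto

lemma busy_le: "0 \<le> t \<Longrightarrow> busy C t \<le> t"
  using regulator_nonneg[of t] by (simp add: busy_def)

lemma busy_le_input: "0 \<le> t \<Longrightarrow> busy C t \<le> C t"
  using regulator_ge[of t t] by (simp add: busy_def)

lemma busy_nonneg: "0 \<le> t \<Longrightarrow> 0 \<le> busy C t"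
  using regulator_le[of t t] C_nonneg by (force simp: busy_def)

context
  assumes C_mono: "mono_on {0..} C"
begin

lemma busy_increment:
  assumes "0 \<le> s" "s \<le> t"
  shows "busy C s \<le> busy C t" "busy C t \<le> busy C s + (t - s)"
proof -
  have "skorokhod_regulator (\<lambda>s. C s - s) t \<le> skorokhod_regulator (\<lambda>s. C s - s) s + (t - s)"
  proof (rule regulator_le)
    fix u assume u: "0 \<le> u" "u \<le> t"
    show "u - C u \<le> skorokhod_regulator (\<lambda>s. C s - s) s + (t - s)"
    proof (cases "u \<le> s")
      case True
      then show ?thesis using regulator_ge[of u s] u assms by simp
    next
      case False
      then have "C s \<le> C u" using assms u by (intro mono_onD[OF C_mono]) auto
      then show ?thesis using regulator_ge[of s s] u assms by simp
    qed
  qed (use assms regulator_nonneg[of s] in auto)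
  then show "busy C s \<le> busy C t" by (simp add: busy_def)
  have "skorokhod_regulator (\<lambda>s. C s - s) s \<le> skorokhod_regulator (\<lambda>s. C s - s) t"
    by (rule regulator_le) (use assms regulator_nonneg[of t] regulator_ge in auto)
  then show "busy C t \<le> busy C s + (t - s)" by (simp add: busy_def)
qed

lemma mono_on_busy: "mono_on {0..} (busy C)"
  by (intro mono_onI) (auto intro: busy_increment)

lemma continuous_on_busy: "continuous_on {0..} (busy C)"
proof (rule continuous_onI)
  fix t e :: real assume t: "t \<in> {0..}" and e: "0 < e"
  show "\<exists>d>0. \<forall>s\<in>{0..}. dist s t < d \<longrightarrow> dist (busy C s) (busy C t) \<le> e"
  proof (intro exI[of _ e] conjI ballI impI e)
    fix s assume s: "s \<in> {0..}" and d: "dist s t < e"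
    show "dist (busy C s) (busy C t) \<le> e"
    proof (cases "s \<le> t")
      case True
      then show ?thesis using busy_increment[of s t] s d by (auto simp: dist_real_def)
    next
      case False
      then show ?thesis using busy_increment[of t s] t d by (auto simp: dist_real_def)
    qed
  qed
qed

end
end

lemma busy_time_eq: "busy_time T S t = busy (cumulative_input T S) t"
  by (simp add: busy_time_def workload_def skorokhod_reflection_def busy_def)

lemma mono_tendsto_uniform_limit:
  fixes f :: "nat \<Rightarrow> real \<Rightarrow> real"
  assumes T: "0 < T" and mono: "eventually (\<lambda>n. mono_on {0..} (f n)) sequentially"
    and g: "continuous_on {0..} g"
    and lim: "\<And>t. 0 \<le> t \<Longrightarrow> (\<lambda>n. f n t) \<longlonglongrightarrow> g t"
  shows "uniform_limit {0..T} f g sequentially"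
proof (rule uniform_limitI)
  fix e :: real assume e: "0 < e"
  have "uniformly_continuous_on {0..T} g"
    using g by (intro compact_uniformly_continuous continuous_on_subset[OF g]) auto
  then obtain d where d: "0 < d" "\<And>s t. s \<in> {0..T} \<Longrightarrow> t \<in> {0..T} \<Longrightarrow> dist s t < d \<Longrightarrow> dist (g s) (g t) < e / 2"
    unfolding uniformly_continuous_on_def using e by (metis half_gt_zero)
  define h where "h = d / 2"
  have h: "0 < h" "h < d" using d(1) by (auto simp: h_def)
  define p where "p i = min (real i * h) T" for i
  have p: "0 \<le> p i" "p i \<le> T" for i using h T by (auto simp: p_def)
  have "eventually (\<lambda>n. \<forall>i\<in>{..Suc (nat \<lfloor>T / h\<rfloor>)}. dist (f n (p i)) (g (p i)) < e / 2) sequentially"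
    using e by (intro eventually_ball_finite ballI tendstoD lim p) auto
  with mono show "eventually (\<lambda>n. \<forall>t\<in>{0..T}. dist (f n t) (g t) < e) sequentially"
  proof eventually_elim
    case (elim n)
    show ?case
    proof
      fix t assume t: "t \<in> {0..T}"
      define i where "i = nat \<lfloor>t / h\<rfloor>"
      have ti: "real i * h \<le> t" "t \<le> real (Suc i) * h"
      proof -
        have "0 \<le> t / h" using t h by simp
        then have "real i = real_of_int \<lfloor>t / h\<rfloor>" by (simp add: i_def)
        then have "real i \<le> t / h" "t / h \<le> real (Suc i)"
          using real_of_int_floor_add_one_gt[of "t / h"] of_int_floor_le[of "t / h"] by linarith+
        then show "real i * h \<le> t" "t \<le> real (Suc i) * h"
          using h by (auto simp: field_simps)
      qed
      then have pt: "p i \<le> t" "t \<le> p (Suc i)" using t by (auto simp: p_def)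
      have "p (Suc i) - p i \<le> h" using h by (auto simp: p_def algebra_simps min_def)
      then have dd: "dist (p i) t < d" "dist (p (Suc i)) t < d" using pt h by (auto simp: dist_real_def)
      have "nat \<lfloor>t / h\<rfloor> \<le> nat \<lfloor>T / h\<rfloor>"
        using t h by (intro nat_mono floor_mono divide_right_mono) auto
      then have "i \<in> {..Suc (nat \<lfloor>T / h\<rfloor>)}" "Suc i \<in> {..Suc (nat \<lfloor>T / h\<rfloor>)}" by (auto simp: i_def)
      then have "dist (f n (p i)) (g (p i)) < e / 2" "dist (f n (p (Suc i))) (g (p (Suc i))) < e / 2"
        using elim(2) by blast+
      moreover have "f n (p i) \<le> f n t" "f n t \<le> f n (p (Suc i))"
        using pt p t by (auto intro!: mono_onD[OF elim(1)])
      moreover have "dist (g (p i)) (g t) < e / 2" "dist (g (p (Suc i))) (g t) < e / 2"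
        using d(2) dd p t by auto
      ultimately show "dist (f n t) (g t) < e" by (auto simp: dist_real_def abs_if split: if_splits)
    qed
  qed
qed

lemma lln_bound:
  fixes G :: "nat \<Rightarrow> real"
  assumes "(\<lambda>k. G k / real k) \<longlonglongrightarrow> 1" "0 < d"
  obtains M where "0 \<le> M" "\<And>k. \<bar>G k - real k\<bar> \<le> d * real k + M"
proof -
  from tendstoD[OF assms] obtain k0 where k0: "\<And>k. k0 \<le> k \<Longrightarrow> dist (G k / real k) 1 < d"
    unfolding eventually_sequentially by blast
  define M where "M = (\<Sum>k\<le>k0. \<bar>G k - real k\<bar>)"
  have M0: "0 \<le> M" by (simp add: M_def sum_nonneg)
  have "\<bar>G k - real k\<bar> \<le> d * real k + M" for k
  proof (cases "k \<le> k0")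
    case True
    then have "\<bar>G k - real k\<bar> \<le> M" unfolding M_def by (intro member_le_sum) auto
    moreover have "0 \<le> d * real k" using assms by simp
    ultimately show ?thesis by linarith
  next
    case False
    then have k: "0 < real k" "dist (G k / real k) 1 < d" using k0[of k] by auto
    have "G k - real k = (G k / real k - 1) * real k" using k by (simp add: field_simps)
    then have "\<bar>G k - real k\<bar> = \<bar>G k / real k - 1\<bar> * real k" using k by (simp add: abs_mult)
    also have "\<dots> \<le> d * real k" using k by (intro mult_right_mono) (auto simp: dist_real_def)
    finally show ?thesis using M0 by linarith
  qed
  with M0 show ?thesis by (rule that)
qed

lemma lln_subsequence:
  fixes G :: "nat \<Rightarrow> real" and k :: "nat \<Rightarrow> nat" and m :: "nat \<Rightarrow> real"
  assumes G: "(\<lambda>k. G k / real k) \<longlonglongrightarrow> 1" and m: "filterlim m at_top sequentially"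
    and k: "(\<lambda>n. real (k n) / m n) \<longlonglongrightarrow> u"
  shows "(\<lambda>n. G (k n) / m n) \<longlonglongrightarrow> u"
proof -
  have "(\<lambda>n. G (k n) / m n - real (k n) / m n) \<longlonglongrightarrow> 0"
  proof (rule tendstoI)
    fix e :: real assume e: "0 < e"
    define d where "d = e / (2 * (\<bar>u\<bar> + 2))"
    have d: "0 < d" using e by (simp add: d_def)
    obtain M where M: "0 \<le> M" "\<And>k. \<bar>G k - real k\<bar> \<le> d * real k + M"
      by (rule lln_bound[OF G d]) blast
    have "((\<lambda>n. M / m n)) \<longlonglongrightarrow> 0"
      by (rule tendsto_divide_0[OF tendsto_const filterlim_at_top_imp_at_infinity[OF m]])
    then have 1: "eventually (\<lambda>n. M / m n < e / 2) sequentially"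
      using e by (intro order_tendstoD) auto
    have 2: "eventually (\<lambda>n. real (k n) / m n < \<bar>u\<bar> + 1) sequentially"
      by (rule order_tendstoD(2)[OF k]) simp
    have 3: "eventually (\<lambda>n. 0 < m n) sequentially"
      using m by (auto simp: filterlim_at_top_dense)
    from 1 2 3 show "eventually (\<lambda>n. dist (G (k n) / m n - real (k n) / m n) 0 < e) sequentially"
    proof eventually_elim
      case (elim n)
      have "\<bar>G (k n) / m n - real (k n) / m n\<bar> = \<bar>G (k n) - real (k n)\<bar> / m n"
        using elim(3) by (simp add: diff_divide_distrib[symmetric])
      also have "\<dots> \<le> (d * real (k n) + M) / m n"
        using elim(3) M(2) by (intro divide_right_mono) auto
      also have "\<dots> = d * (real (k n) / m n) + M / m n" by (simp add: add_divide_distrib)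
      also have "\<dots> < d * (\<bar>u\<bar> + 1) + e / 2"
        using elim d by (intro add_le_less_mono mult_left_mono) auto
      also have "\<dots> \<le> d * (\<bar>u\<bar> + 2) + e / 2" using d by (simp add: algebra_simps)
      also have "\<dots> = e" using e by (simp add: d_def add_pos_nonneg field_simps)
      finally show ?case by (simp add: dist_real_def)
    qed
  qed
  from tendsto_add[OF this k] show ?thesis by simp
qed

lemma lln_renewal:
  fixes G :: "nat \<Rightarrow> real" and k :: "nat \<Rightarrow> nat" and m :: "nat \<Rightarrow> real"
  assumes G: "(\<lambda>k. G k / real k) \<longlonglongrightarrow> 1" and m: "filterlim m at_top sequentially" and u: "0 \<le> u"
    and k: "eventually (\<lambda>n. G (k n) \<le> m n * u \<and> m n * u \<le> G (Suc (k n))) sequentially"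
  shows "(\<lambda>n. real (k n) / m n) \<longlonglongrightarrow> u"
proof (rule tendstoI)
  fix e :: real assume e: "0 < e"
  define d where "d = min (1 / 2) (e / (2 * (2 * u + 3)))"
  have d: "0 < d" using e u by (simp add: d_def)
  have d2: "d \<le> 1 / 2" unfolding d_def by (rule min.cobounded1)
  have "d * (2 * u + 3) \<le> e / (2 * (2 * u + 3)) * (2 * u + 3)"
    using u by (intro mult_right_mono) (auto simp: d_def)
  also have "\<dots> = e / 2" using u by (simp add: field_simps)
  finally have d3: "d * (2 * u + 3) \<le> e / 2" .
  obtain M where M: "0 \<le> M" "\<And>k. \<bar>G k - real k\<bar> \<le> d * real k + M"
    by (rule lln_bound[OF G d]) blast
  have "((\<lambda>n. (M + 1) / m n)) \<longlonglongrightarrow> 0"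
    by (rule tendsto_divide_0[OF tendsto_const filterlim_at_top_imp_at_infinity[OF m]])
  then have 1: "eventually (\<lambda>n. (M + 1) / m n < min 1 (e / 2)) sequentially"
    using e by (intro order_tendstoD) auto
  have 3: "eventually (\<lambda>n. 1 < m n) sequentially"
    using m by (auto simp: filterlim_at_top_dense)
  from 1 3 k show "eventually (\<lambda>n. dist (real (k n) / m n) u < e) sequentially"
  proof eventually_elim
    case (elim n)
    define y where "y = real (k n) / m n"
    define r where "r = 1 / m n"
    have r: "0 < r" "r < 1" "(M + 1) * r < 1" "(M + 1) * r < e / 2" using elim by (auto simp: r_def)
    have m0: "0 < m n" using elim by simp
    have mr: "m n * u * r = u" "real (k n) * r = y" using m0 by (simp_all add: r_def y_def)
    have "real (k n) - (d * real (k n) + M) \<le> m n * u"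
      using M(2)[of "k n"] elim(3) by linarith
    then have "(real (k n) - (d * real (k n) + M)) * r \<le> m n * u * r"
      using r by (intro mult_right_mono) auto
    also have "(real (k n) - (d * real (k n) + M)) * r = y - (d * y + M * r)"
      unfolding mr(2)[symmetric] by (simp add: algebra_simps)
    finally have up: "y - u \<le> d * y + M * r" using mr(1) by linarith
    have "m n * u \<le> real (Suc (k n)) + d * real (Suc (k n)) + M"
      using M(2)[of "Suc (k n)"] elim(3) by linarith
    then have "m n * u * r \<le> (real (Suc (k n)) + d * real (Suc (k n)) + M) * r"
      using r by (intro mult_right_mono) auto
    also have "(real (Suc (k n)) + d * real (Suc (k n)) + M) * r = y + d * (y + r) + (M + 1) * r"
      unfolding mr(2)[symmetric] by (simp add: algebra_simps)
    finally have lo: "u - y \<le> d * (y + r) + (M + 1) * r" using mr(1) by linarith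
    have y0: "0 \<le> y" using m0 by (simp add: y_def)
    have Mr: "M * r < 1" "M * r < e / 2" using r by (auto simp: algebra_simps)
    have "d * y \<le> 1 / 2 * y" using d2 y0 by (intro mult_right_mono) auto
    then have y: "y \<le> 2 * u + 2" using up Mr by linarith
    have "d * (y + r) \<le> d * (2 * u + 3)" using d y r by (intro mult_left_mono) auto
    moreover have "d * y \<le> d * (y + r)" using d r by (intro mult_left_mono) auto
    ultimately have "y - u < e" "u - y < e" using up lo d3 Mr r by linarith+
    then show ?case by (simp add: dist_real_def y_def abs_if)
  qed
qed

subsection \<open>Queues driven by sampled subordinators\<close>

text \<open>Pointwise convergence \<open>\<theta>\<^sub>n \<rightarrow> a\<inverse>\<close> does not control \<open>d \<circ> \<theta>\<^sub>n\<close> at the jumps of \<open>d\<close>. The regulator only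
  needs lower bounds for \<open>d (\<theta>\<^sub>n s\<^sub>n)\<close> with \<open>s\<^sub>n \<rightarrow> s\<close>, and these are the left limits of \<open>d\<close> at \<open>a\<inverse> s\<close>.
  They equal the left limit of \<open>d \<circ> a\<inverse>\<close> at \<open>s\<close> unless \<open>a\<inverse>\<close> is constant to the left of \<open>s\<close>, at a
  level where both \<open>a\<close> and \<open>d\<close> jump.\<close>

lemma busy_tendsto:
  fixes \<theta> :: "nat \<Rightarrow> real \<Rightarrow> real"
  assumes a: "subordinator_path a" and d: "subordinator_path d"
    and no_common_jump: "\<And>w. 0 < w \<Longrightarrow> (a \<longlongrightarrow> a w) (at_left w) \<or> (d \<longlongrightarrow> d w) (at_left w)"
    and mono: "eventually (\<lambda>n. mono_on {0..} (\<theta> n)) sequentially"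
    and \<theta>0: "\<And>n s. 0 \<le> s \<Longrightarrow> 0 \<le> \<theta> n s"
    and lim: "\<And>s. 0 \<le> s \<Longrightarrow> (\<lambda>n. \<theta> n s) \<longlonglongrightarrow> inverse_path a s"
    and t: "0 \<le> t"
  shows "(\<lambda>n. busy (\<lambda>s. d (\<theta> n s)) t) \<longlonglongrightarrow> busy (\<lambda>s. d (inverse_path a s)) t"
proof -
  let ?v = "inverse_path a"
  define R where "R n = skorokhod_regulator (\<lambda>s. d (\<theta> n s) - s) t" for n
  define r where "r = skorokhod_regulator (\<lambda>s. d (?v s) - s) t"
  have v0: "0 \<le> ?v s" for s by (rule inverse_path_nonneg[OF a])
  have d_v: "0 \<le> d (?v s)" and d_\<theta>: "0 \<le> s \<Longrightarrow> 0 \<le> d (\<theta> n s)" for n s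
    using subordinator_path_nonneg[OF d] v0 \<theta>0 by auto
  have r_ge: "s - d (?v s) \<le> r" if "0 \<le> s" "s \<le> t" for s
    unfolding r_def by (rule regulator_ge[where C = "\<lambda>s. d (?v s)"]) (use d_v that in auto)
  have r0: "0 \<le> r" unfolding r_def by (rule regulator_nonneg[where C = "\<lambda>s. d (?v s)"]) (use d_v t in auto)
  have R_ge: "s - d (\<theta> n s) \<le> R n" if "0 \<le> s" "s \<le> t" for s n
    unfolding R_def by (rule regulator_ge[where C = "\<lambda>s. d (\<theta> n s)"]) (use d_\<theta> that in auto)
  have R0: "0 \<le> R n" for n unfolding R_def
    by (rule regulator_nonneg[where C = "\<lambda>s. d (\<theta> n s)"]) (use d_\<theta> t in auto)
  have "R \<longlonglongrightarrow> r"
  proof (rule order_tendstoI)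
    fix y assume y: "y < r"
    show "eventually (\<lambda>n. y < R n) sequentially"
    proof (cases "y < 0")
      case True
      then show ?thesis using R0 by (auto intro!: always_eventually less_le_trans[OF True])
    next
      case False
      have "\<exists>s. 0 \<le> s \<and> s \<le> t \<and> y < s - d (?v s)"
      proof (rule ccontr)
        assume "\<not> ?thesis"
        then have "r \<le> y" unfolding r_def
          by (intro regulator_le[where C = "\<lambda>s. d (?v s)"]) (use d_v t False in \<open>auto simp: not_less\<close>)
        with y show False by simp
      qed
      then obtain s where s: "0 \<le> s" "s \<le> t" "y < s - d (?v s)" by blast
      have "(d \<longlongrightarrow> d (?v s)) (at_right (?v s))" using d v0 by (auto simp: subordinator_path_def)
      then have "eventually (\<lambda>u. d u < s - y) (at_right (?v s))"
        by (rule order_tendstoD) (use s in simp)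
      then obtain b where b: "?v s < b" "\<And>u. ?v s < u \<Longrightarrow> u < b \<Longrightarrow> d u < s - y"
        unfolding eventually_at_right_field by blast
      have "eventually (\<lambda>n. \<theta> n s < b) sequentially"
        by (rule order_tendstoD(2)[OF lim]) (use s b in auto)
      then show ?thesis
      proof eventually_elim
        case (elim n)
        have "d (\<theta> n s) < s - y"
        proof (cases "?v s < \<theta> n s")
          case False
          then have "d (\<theta> n s) \<le> d (?v s)" using \<theta>0 v0 s by (simp add: subordinator_path_le_iff[OF d])
          then show ?thesis using s by simp
        qed (use b elim in auto)
        then show ?case using R_ge[OF s(1,2), of n] by simp
      qed
    qed
  next
    fix y assume y: "r < y"
    define z where "z = (r + y) / 2"
    have z: "r < z" "z < y" using y by (auto simp: z_def)
    show "eventually (\<lambda>n. R n < y) sequentially"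
    proof (rule ccontr)
      assume "\<not> eventually (\<lambda>n. R n < y) sequentially"
      from not_eventually_sequentiallyD[OF this]
      obtain q :: "nat \<Rightarrow> nat" where q: "strict_mono q" "\<And>n. \<not> R (q n) < y" by blast
      have "\<exists>s\<in>{0..t}. z < s - d (\<theta> (q n) s)" for n
      proof (rule ccontr)
        assume "\<not> ?thesis"
        then have "R (q n) \<le> z" unfolding R_def
          by (intro regulator_le[where C = "\<lambda>s. d (\<theta> (q n) s)"])
             (use d_\<theta> t z r0 in \<open>auto simp: not_less\<close>)
        with q(2)[of n] z show False by simp
      qed
      then obtain p where p: "\<And>n. p n \<in> {0..t}" "\<And>n. z < p n - d (\<theta> (q n) (p n))" by metis
      have "\<exists>s\<in>{0..t}. \<exists>q' :: nat \<Rightarrow> nat. strict_mono q' \<and> (p \<circ> q') \<longlonglongrightarrow> s"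
        using compact_imp_seq_compact[OF compact_Icc[of 0 t]] p(1) by (auto simp: seq_compact_def)
      then obtain s and q' :: "nat \<Rightarrow> nat" where s: "s \<in> {0..t}" and q': "strict_mono q'" "(p \<circ> q') \<longlonglongrightarrow> s" by blast
      define i where "i n = q (q' n)" for n
      have i: "strict_mono i" unfolding i_def using q(1) q'(1) by (simp add: strict_mono_def)
      define x where "x = p \<circ> q'"
      have x: "x \<longlonglongrightarrow> s" "\<And>n. 0 \<le> x n" "\<And>n. x n \<le> t" "\<And>n. z < x n - d (\<theta> (i n) (x n))"
        using q'(2) p by (auto simp: x_def i_def comp_def)
      have monoi: "eventually (\<lambda>n. mono_on {0..} (\<theta> (i n))) sequentially"
        using mono eventually_subseq[OF i] by blast
      have s0: "0 \<le> s" "s \<le> t" using s by auto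
      have key: "z \<le> s - d w" if w: "0 \<le> w" "w < ?v s" for w
      proof (rule tendsto_lowerbound[where F = sequentially])
        show "(\<lambda>n. x n - d w) \<longlonglongrightarrow> s - d w" by (intro tendsto_intros x)
        have s_pos: "0 < s"
          using w inverse_path_0[OF a] s0 by (cases "s = 0") auto
        have "(?v \<longlongrightarrow> ?v s) (at_left s)"
          by (intro isCont_at_left isCont_inverse_path a)
        then have "eventually (\<lambda>s'. w < ?v s') (at_left s)" by (rule order_tendstoD) fact
        then obtain b where b: "b < s" "\<And>s'. b < s' \<Longrightarrow> s' < s \<Longrightarrow> w < ?v s'"
          unfolding eventually_at_left_field by blast
        define s' where "s' = (max 0 b + s) / 2"
        have s': "0 \<le> s'" "s' < s" "w < ?v s'" using b s_pos by (auto simp: s'_def)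
        have "(\<lambda>n. \<theta> (i n) s') \<longlonglongrightarrow> ?v s'"
          using LIMSEQ_subseq_LIMSEQ[OF lim[OF s'(1)] i] by (simp add: comp_def)
        then have "eventually (\<lambda>n. w < \<theta> (i n) s') sequentially" by (rule order_tendstoD) fact
        moreover have "eventually (\<lambda>n. s' < x n) sequentially" by (rule order_tendstoD(1)[OF x(1)]) fact
        ultimately show "eventually (\<lambda>n. z \<le> x n - d w) sequentially" using monoi
        proof eventually_elim
          case (elim n)
          have "\<theta> (i n) s' \<le> \<theta> (i n) (x n)" using elim s' x(2)[of n] by (intro mono_onD[OF elim(3)]) auto
          then have "d w \<le> d (\<theta> (i n) (x n))"
            using elim w \<theta>0 x(2) by (subst subordinator_path_le_iff[OF d]) auto
          then show ?case using x(4)[of n] by simp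
        qed
      qed simp
      show False
      proof (cases "?v s = 0")
        case True
        have "z \<le> s"
        proof (rule tendsto_lowerbound[OF x(1)])
          have "z \<le> x n" for n using x(4)[of n] d_\<theta>[OF x(2)[of n], of "i n"] by linarith
          then show "eventually (\<lambda>n. z \<le> x n) sequentially" by simp
        qed simp
        moreover have "d (?v s) = 0" using True d by (simp add: subordinator_path_def)
        ultimately show False using r_ge[OF s0] z by simp
      next
        case False
        then have w: "0 < ?v s" using v0[of s] by linarith
        have ev: "eventually (\<lambda>w. w \<in> {0<..<?v s}) (at_left (?v s))"
          using w by (rule eventually_at_left_real)
        from no_common_jump[OF w] show False
        proof
          assume lc: "(d \<longlongrightarrow> d (?v s)) (at_left (?v s))"
          have "z \<le> s - d (?v s)"
          proof (rule tendsto_lowerbound[where F = "at_left (?v s)"])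
            show "((\<lambda>w. s - d w) \<longlongrightarrow> s - d (?v s)) (at_left (?v s))" by (intro tendsto_intros lc)
            show "eventually (\<lambda>w. z \<le> s - d w) (at_left (?v s))"
              using ev by eventually_elim (auto intro: key)
          qed simp
          with r_ge[OF s0] z show False by simp
        next
          assume lc: "(a \<longlongrightarrow> a (?v s)) (at_left (?v s))"
          have spos: "0 < s" using w inverse_path_0[OF a] s0 by (cases "s = 0") auto
          define s' where "s' = max 0 (s - (z - r) / 2)"
          have s': "0 \<le> s'" "s' < s" "s - s' < z - r" using spos z by (auto simp: s'_def max_def field_simps)
          have "eventually (\<lambda>w. s' < a w) (at_left (?v s))"
            by (rule order_tendstoD(1)[OF lc]) (use s' le_inverse_path[OF a, of s] in linarith)
          with ev have "eventually (\<lambda>w. w \<in> {0<..<?v s} \<and> s' < a w) (at_left (?v s))"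
            by eventually_elim auto
          from eventually_happens[OF this] obtain w' where w': "0 < w'" "w' < ?v s" "s' < a w'"
            by auto
          then have "?v s' \<le> w'" by (intro inverse_path_least[OF a]) auto
          then have "z \<le> s - d (?v s')" using w' v0 by (intro key) auto
          moreover have "s' - d (?v s') \<le> r" using s' s0 by (intro r_ge) auto
          ultimately show False using s' by linarith
        qed
      qed
    qed
  qed
  then show ?thesis unfolding busy_def R_def r_def by (intro tendsto_intros)
qed

definition sampled :: "(real \<Rightarrow> real) \<Rightarrow> (nat \<Rightarrow> real) \<Rightarrow> real \<Rightarrow> nat \<Rightarrow> real" where
  "sampled a g m k = a (partial_sum g k / m) - a (partial_sum g (k - 1) / m)"

lemma partial_sum_sampled: "a 0 = 0 \<Longrightarrow> partial_sum (sampled a g m) k = a (partial_sum g k / m)"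
  by (induction k) (auto simp: sampled_def)

lemma arrival_seq_sampled:
  assumes a: "subordinator_path a" and g: "arrival_seq g" and m: "0 < m"
  shows "arrival_seq (sampled a g m)"
  unfolding arrival_seq_def
proof (intro conjI allI impI)
  fix k :: nat assume k: "1 \<le> k"
  have "partial_sum g (k - 1) < partial_sum g k"
    using k strict_mono_partial_sum[OF g] by (simp add: strict_mono_less)
  then show "0 < sampled a g m k"
    using m partial_sum_nonneg[OF g] by (simp add: sampled_def subordinator_path_less_iff[OF a] divide_strict_right_mono)
next
  fix K :: nat
  obtain t where t: "0 \<le> t" "real K < a t" using a by (auto simp: subordinator_path_def)
  obtain K' :: nat where K': "t * m \<le> real K'" using real_arch_simple by blast
  obtain k where "real K' < partial_sum g k" using g by (auto simp: arrival_seq_def)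
  then have "t < partial_sum g k / m" using K' m by (simp add: field_simps)
  then have "a t < a (partial_sum g k / m)"
    using t m partial_sum_nonneg[OF g] by (simp add: subordinator_path_less_iff[OF a])
  then have "real K < partial_sum (sampled a g m) k"
    using t a by (simp add: partial_sum_sampled subordinator_path_def)
  then show "\<exists>k. real K < partial_sum (sampled a g m) k" ..
qed

lemma counting_sampled:
  assumes a: "subordinator_path a" and g: "arrival_seq g" and m: "0 < m" and t: "0 \<le> t"
  defines "K \<equiv> counting (sampled a g m) t"
  shows "partial_sum g K \<le> m * inverse_path a t" "m * inverse_path a t \<le> partial_sum g (Suc K)"
proof -
  have a0: "a 0 = 0" using a by (simp add: subordinator_path_def)
  have p: "0 \<le> partial_sum g k / m" for k using m partial_sum_nonneg[OF g] by simp
  note s = arrival_seq_sampled[OF a g m]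
  have "a (partial_sum g K / m) \<le> t"
    using partial_sum_counting_le[OF s t] by (simp add: K_def partial_sum_sampled[of a, OF a0])
  also have "t \<le> a (inverse_path a t)" by (rule le_inverse_path[OF a])
  finally have "partial_sum g K / m \<le> inverse_path a t"
    using p inverse_path_nonneg[OF a] by (simp add: subordinator_path_le_iff[OF a])
  then show "partial_sum g K \<le> m * inverse_path a t" using m by (simp add: field_simps)
  have "t < partial_sum (sampled a g m) (Suc K)"
    unfolding K_def by (rule less_partial_sum_Suc_counting[OF s t])
  then have "t \<le> a (partial_sum g (Suc K) / m)"
    by (simp only: partial_sum_sampled[of a, OF a0] less_imp_le)
  then have "inverse_path a t \<le> partial_sum g (Suc K) / m"
    using p by (intro inverse_path_least[OF a])
  then show "m * inverse_path a t \<le> partial_sum g (Suc K)" using m by (simp add: field_simps)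
qed

lemma counting_sampled_tendsto:
  assumes a: "subordinator_path a" and g: "arrival_seq g" "(\<lambda>k. partial_sum g k / real k) \<longlonglongrightarrow> 1"
    and m: "filterlim m at_top sequentially" and t: "0 \<le> t"
  shows "(\<lambda>n. real (counting (sampled a g (m n)) t) / m n) \<longlonglongrightarrow> inverse_path a t"
proof (rule lln_renewal[OF g(2) m inverse_path_nonneg[OF a]])
  have "eventually (\<lambda>n. 0 < m n) sequentially" using m by (auto simp: filterlim_at_top_dense)
  then show "eventually (\<lambda>n. partial_sum g (counting (sampled a g (m n)) t) \<le> m n * inverse_path a t \<and>
      m n * inverse_path a t \<le> partial_sum g (Suc (counting (sampled a g (m n)) t))) sequentially"
    by eventually_elim (use counting_sampled[OF a g(1) _ t] in blast)
qed

lemma mono_on_real_counting: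
  "arrival_seq x \<Longrightarrow> 0 \<le> c \<Longrightarrow> mono_on {0..} (\<lambda>t. real (counting x t) / c)"
  using mono_on_counting[of x] by (auto simp: mono_on_def divide_right_mono)

lemma cumulative_input_nonneg: "arrival_seq y \<Longrightarrow> 0 \<le> cumulative_input x y t"
  by (simp add: cumulative_input_def partial_sum_nonneg)

lemma mono_on_cumulative_input:
  "arrival_seq x \<Longrightarrow> arrival_seq y \<Longrightarrow> mono_on {0..} (cumulative_input x y)"
  using mono_on_counting[of x] strict_mono_partial_sum[of y]
  by (auto simp: mono_on_def cumulative_input_def strict_mono_less_eq)

context
  fixes x y :: "nat \<Rightarrow> real"
  assumes x: "arrival_seq x" and y: "arrival_seq y"
begin

lemmas busy_time_nonneg = busy_nonneg[of "cumulative_input x y", OF cumulative_input_nonneg[OF y], folded busy_time_eq]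
lemmas busy_time_le = busy_le[of "cumulative_input x y", OF cumulative_input_nonneg[OF y], folded busy_time_eq]
lemmas busy_time_le_input = busy_le_input[of "cumulative_input x y", OF cumulative_input_nonneg[OF y], folded busy_time_eq]

lemma mono_on_busy_time: "mono_on {0..} (busy_time x y)"
  using mono_on_busy[of "cumulative_input x y", OF cumulative_input_nonneg[OF y] mono_on_cumulative_input[OF x y]]
  by (simp add: busy_time_eq[abs_def])

lemma continuous_on_busy_time: "continuous_on {0..} (busy_time x y)"
  using continuous_on_busy[of "cumulative_input x y", OF cumulative_input_nonneg[OF y] mono_on_cumulative_input[OF x y]]
  by (simp add: busy_time_eq[abs_def])

lemma step_path_queue_length: "step_path (\<lambda>t. queue_length x y t / c)"
proof -
  have "step_path (\<lambda>t. counting x t)"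
    using step_path_counting_comp[OF x, of "\<lambda>t. t"] by (simp add: mono_on_def)
  moreover have "step_path (\<lambda>t. counting y (busy_time x y t))"
    by (rule step_path_counting_comp[OF y continuous_on_busy_time mono_on_busy_time busy_time_nonneg])
  ultimately show ?thesis
    unfolding queue_length_def departures_def
    by (rule step_path_comp2[where h = "\<lambda>a b. (real a - real b) / c"])
qed

lemma departures_le_counting: "0 \<le> t \<Longrightarrow> departures x y t \<le> counting y t"
  unfolding departures_def using busy_time_nonneg busy_time_le
  by (intro mono_onD[OF mono_on_counting[OF y]]) auto

lemma departures_le_arrivals: "0 \<le> t \<Longrightarrow> departures x y t \<le> counting x t"
proof -
  assume t: "0 \<le> t"
  have "counting y (busy_time x y t) \<le> counting y (cumulative_input x y t)"
    using busy_time_nonneg[OF t] busy_time_le_input[OF t] cumulative_input_nonneg[OF y]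
    by (intro mono_onD[OF mono_on_counting[OF y]]) auto
  then show ?thesis by (simp add: departures_def cumulative_input_def counting_partial_sum[OF y])
qed

lemma mono_on_departures: "mono_on {0..} (departures x y)"
  unfolding departures_def using mono_on_busy_time busy_time_nonneg mono_on_counting[OF y]
  by (auto simp: mono_on_def)

end

locale coupled_queues =
  fixes a d :: "real \<Rightarrow> real" and g h :: "nat \<Rightarrow> real" and p q :: "nat \<Rightarrow> real"
  assumes a: "subordinator_path a" and d: "subordinator_path d"
    and g: "arrival_seq g" and h: "arrival_seq h"
    and lln_g: "(\<lambda>k. partial_sum g k / real k) \<longlonglongrightarrow> 1"
    and lln_h: "(\<lambda>k. partial_sum h k / real k) \<longlonglongrightarrow> 1"
    and p: "filterlim p at_top sequentially" and q: "filterlim q at_top sequentially"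
begin

abbreviation "arr n \<equiv> sampled a g (p n)"
abbreviation "srv n \<equiv> sampled d h (q n)"

lemma ev_pos: "eventually (\<lambda>n. 0 < p n \<and> 0 < q n \<and> 0 < n) sequentially"
proof -
  have "eventually (\<lambda>n. 0 < p n) sequentially" "eventually (\<lambda>n. 0 < q n) sequentially"
    using p q by (auto simp: filterlim_at_top_dense)
  with eventually_gt_at_top[of 0] show ?thesis by eventually_elim auto
qed

lemma ev_arrival: "eventually (\<lambda>n. arrival_seq (arr n) \<and> arrival_seq (srv n)) sequentially"
  using ev_pos by eventually_elim (auto intro: arrival_seq_sampled a d g h)

lemma counting_uniform:
  assumes T: "0 < T" and r: "(\<lambda>n. p n / real n) \<longlonglongrightarrow> r"
  shows "uniform_limit {0..T} (\<lambda>n t. real (counting (arr n) t) / real n) (\<lambda>t. r * inverse_path a t) sequentially"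
proof (rule mono_tendsto_uniform_limit[OF T])
  show "eventually (\<lambda>n. mono_on {0..} (\<lambda>t. real (counting (arr n) t) / real n)) sequentially"
    using ev_arrival by eventually_elim (auto intro: mono_on_real_counting)
  show "continuous_on {0..} (\<lambda>t. r * inverse_path a t)"
    by (intro continuous_intros continuous_on_inverse_path a)
  fix t :: real assume t: "0 \<le> t"
  have "(\<lambda>n. p n / real n * (real (counting (arr n) t) / p n)) \<longlonglongrightarrow> r * inverse_path a t"
    by (intro tendsto_mult r counting_sampled_tendsto a g lln_g p t)
  moreover have "eventually (\<lambda>n. p n / real n * (real (counting (arr n) t) / p n) = real (counting (arr n) t) / real n) sequentially"
    using ev_pos by eventually_elim simp
  ultimately show "(\<lambda>n. real (counting (arr n) t) / real n) \<longlonglongrightarrow> r * inverse_path a t"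
    by (rule Lim_transform_eventually)
qed

end

sublocale coupled_queues \<subseteq> swap: coupled_queues d a h g q p
  by unfold_locales (fact d a h g lln_h lln_g q p)+

context coupled_queues
begin

lemma queue_fast_service:
  assumes r: "(\<lambda>n. p n / real n) \<longlonglongrightarrow> 1" and s: "(\<lambda>n. q n / real n) \<longlonglongrightarrow> 0"
  shows "U_conv (\<lambda>n t. queue_length (arr n) (srv n) t / real n) (inverse_path a)"
  unfolding U_conv_def
proof (intro allI impI)
  fix T :: real assume T: "0 < T"
  note N = counting_uniform[OF T r]
  note D = swap.counting_uniform[OF T s]
  have "uniform_limit {0..T} (\<lambda>n t. real (departures (arr n) (srv n) t) / real n) (\<lambda>_. 0) sequentially"
  proof (rule uniform_limitI)
    fix e :: real assume "0 < e"
    from uniform_limitD[OF D this] ev_arrival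
    show "eventually (\<lambda>n. \<forall>t\<in>{0..T}. dist (real (departures (arr n) (srv n) t) / real n) 0 < e) sequentially"
    proof eventually_elim
      case (elim n)
      show ?case
      proof
        fix t assume t: "t \<in> {0..T}"
        then have "real (departures (arr n) (srv n) t) / real n \<le> real (counting (srv n) t) / real n"
          using departures_le_counting[of "arr n" "srv n" t] elim by (intro divide_right_mono) auto
        with bspec[OF elim(1) t] show "dist (real (departures (arr n) (srv n) t) / real n) 0 < e"
          by simp
      qed
    qed
  qed
  from uniform_limit_minus[OF N this]
  show "uniform_limit {0..T} (\<lambda>n t. queue_length (arr n) (srv n) t / real n) (inverse_path a) sequentially"
    by (simp add: queue_length_def diff_divide_distrib)
qed

lemma queue_slow_arrivals:
  assumes r: "(\<lambda>n. p n / real n) \<longlonglongrightarrow> 0"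
  shows "U_conv (\<lambda>n t. queue_length (arr n) (srv n) t / real n) (\<lambda>_. 0)"
  unfolding U_conv_def
proof (intro allI impI uniform_limitI)
  fix T e :: real assume T: "0 < T" and "0 < e"
  from uniform_limitD[OF counting_uniform[OF T r] this(2)] ev_arrival
  show "eventually (\<lambda>n. \<forall>t\<in>{0..T}. dist (queue_length (arr n) (srv n) t / real n) 0 < e) sequentially"
  proof eventually_elim
    case (elim n)
    show ?case
    proof
      fix t assume t: "t \<in> {0..T}"
      then have "0 \<le> queue_length (arr n) (srv n) t" "queue_length (arr n) (srv n) t \<le> real (counting (arr n) t)"
        using departures_le_arrivals[of "arr n" "srv n" t] elim by (auto simp: queue_length_def)
      then have "0 \<le> queue_length (arr n) (srv n) t / real n"
          "queue_length (arr n) (srv n) t / real n \<le> real (counting (arr n) t) / real n"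
        by (auto intro: divide_right_mono)
      with bspec[OF elim(1) t] show "dist (queue_length (arr n) (srv n) t / real n) 0 < e"
        by (simp add: dist_real_def)
    qed
  qed
qed

lemma queue_balanced:
  assumes r: "(\<lambda>n. p n / real n) \<longlonglongrightarrow> 1" and s: "(\<lambda>n. q n / real n) \<longlonglongrightarrow> 1"
    and no_common_jump: "\<And>w. 0 < w \<Longrightarrow> (a \<longlongrightarrow> a w) (at_left w) \<or> (d \<longlongrightarrow> d w) (at_left w)"
  shows "U_conv (\<lambda>n t. queue_length (arr n) (srv n) t / real n)
    (\<lambda>t. inverse_path a t - inverse_path d (busy (\<lambda>s. d (inverse_path a s)) t))"
  unfolding U_conv_def
proof (intro allI impI)
  fix T :: real assume T: "0 < T"
  note N = counting_uniform[OF T r]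
  define C where "C = (\<lambda>s. d (inverse_path a s))"
  define \<theta> where "\<theta> n t = \<bar>partial_sum h (counting (arr n) t) / q n\<bar>" for n t
  have C0: "0 \<le> C s" for s unfolding C_def
    by (intro subordinator_path_nonneg[OF d] inverse_path_nonneg[OF a])
  have Cm: "mono_on {0..} C"
    unfolding C_def using monoD[OF mono_inverse_path[OF a]] inverse_path_nonneg[OF a]
    by (auto simp: mono_on_def subordinator_path_le_iff[OF d])
  have d0: "d 0 = 0" using d by (simp add: subordinator_path_def)
  have lim\<theta>: "(\<lambda>n. \<theta> n t) \<longlonglongrightarrow> inverse_path a t" if t: "0 \<le> t" for t
  proof -
    have "(\<lambda>n. (real (counting (arr n) t) / real n) / (q n / real n)) \<longlonglongrightarrow> inverse_path a t / 1"
      using tendsto_uniform_limitI[OF counting_uniform[OF _ r], of "t + 1" t] t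
      by (intro tendsto_divide s) auto
    moreover have "eventually (\<lambda>n. (real (counting (arr n) t) / real n) / (q n / real n) = real (counting (arr n) t) / q n) sequentially"
      using ev_pos by eventually_elim simp
    ultimately have "(\<lambda>n. real (counting (arr n) t) / q n) \<longlonglongrightarrow> inverse_path a t"
      using Lim_transform_eventually by fastforce
    from tendsto_rabs[OF lln_subsequence[OF lln_h q this]]
    show ?thesis using inverse_path_nonneg[OF a, of t] by (simp add: \<theta>_def)
  qed
  have mono\<theta>: "eventually (\<lambda>n. mono_on {0..} (\<theta> n)) sequentially"
    using ev_arrival ev_pos
  proof eventually_elim
    case (elim n)
    show ?case
    proof (rule mono_onI)
      fix r s :: real assume rs: "r \<in> {0..}" "s \<in> {0..}" "r \<le> s"
      have "counting (arr n) r \<le> counting (arr n) s" using mono_on_counting rs elim by (auto simp: mono_on_def)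
      then have "partial_sum h (counting (arr n) r) \<le> partial_sum h (counting (arr n) s)"
        using strict_mono_partial_sum[OF h] by (simp add: strict_mono_less_eq)
      then show "\<theta> n r \<le> \<theta> n s"
        using elim partial_sum_nonneg[OF h] by (simp add: \<theta>_def divide_right_mono)
    qed
  qed
  have eqC: "eventually (\<lambda>n. cumulative_input (arr n) (srv n) = (\<lambda>s. d (\<theta> n s))) sequentially"
    using ev_pos
    by eventually_elim
      (auto simp: fun_eq_iff cumulative_input_def partial_sum_sampled[of d, OF d0] \<theta>_def partial_sum_nonneg[OF h])
  have B: "(\<lambda>n. busy_time (arr n) (srv n) t) \<longlonglongrightarrow> busy C t" if t: "0 \<le> t" for t
  proof -
    have "(\<lambda>n. busy (\<lambda>s. d (\<theta> n s)) t) \<longlonglongrightarrow> busy C t"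
      unfolding C_def
      by (rule busy_tendsto[OF a d no_common_jump mono\<theta> _ lim\<theta> t]) (auto simp: \<theta>_def)
    moreover have "eventually (\<lambda>n. busy (\<lambda>s. d (\<theta> n s)) t = busy_time (arr n) (srv n) t) sequentially"
      using eqC by eventually_elim (simp add: busy_time_eq)
    ultimately show ?thesis by (rule Lim_transform_eventually)
  qed
  have "uniform_limit {0..T} (\<lambda>n t. real (departures (arr n) (srv n) t) / real n) (\<lambda>t. inverse_path d (busy C t)) sequentially"
  proof (rule mono_tendsto_uniform_limit[OF T])
    show "eventually (\<lambda>n. mono_on {0..} (\<lambda>t. real (departures (arr n) (srv n) t) / real n)) sequentially"
      using ev_arrival
      by eventually_elim (use mono_on_departures in \<open>auto simp: mono_on_def divide_right_mono\<close>)
    show "continuous_on {0..} (\<lambda>t. inverse_path d (busy C t))"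
      by (rule continuous_on_compose2[OF continuous_on_inverse_path[OF d, of UNIV] continuous_on_busy[OF C0 Cm]]) auto
    fix t :: real assume t: "0 \<le> t"
    have u: "uniform_limit {0..t + 1} (\<lambda>n t. real (counting (srv n) t) / real n) (\<lambda>t. inverse_path d t) sequentially"
      using swap.counting_uniform[OF _ s, of "t + 1"] t by simp
    have diff: "(\<lambda>n. real (departures (arr n) (srv n) t) / real n - inverse_path d (busy_time (arr n) (srv n) t)) \<longlonglongrightarrow> 0"
    proof (rule tendstoI)
      fix e :: real assume "0 < e"
      from uniform_limitD[OF u this] ev_arrival
      show "eventually (\<lambda>n. dist (real (departures (arr n) (srv n) t) / real n - inverse_path d (busy_time (arr n) (srv n) t)) 0 < e) sequentially"
      proof eventually_elim
        case (elim n)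
        have "busy_time (arr n) (srv n) t \<in> {0..t + 1}"
          using busy_time_nonneg[of "arr n" "srv n" t] busy_time_le[of "arr n" "srv n" t] elim t by auto
        from bspec[OF elim(1) this] show ?case by (simp add: departures_def dist_real_def)
      qed
    qed
    have "(\<lambda>n. inverse_path d (busy_time (arr n) (srv n) t)) \<longlonglongrightarrow> inverse_path d (busy C t)"
      by (rule isCont_tendsto_compose[OF isCont_inverse_path[OF d] B[OF t]])
    from tendsto_add[OF diff this]
    show "(\<lambda>n. real (departures (arr n) (srv n) t) / real n) \<longlonglongrightarrow> inverse_path d (busy C t)" by simp
  qed
  from uniform_limit_minus[OF N this]
  show "uniform_limit {0..T} (\<lambda>n t. queue_length (arr n) (srv n) t / real n)
    (\<lambda>t. inverse_path a t - inverse_path d (busy (\<lambda>s. d (inverse_path a s)) t)) sequentially"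
    by (simp add: queue_length_def diff_divide_distrib C_def)
qed

end

subsection \<open>Uniform convergence implies M1 convergence\<close>

lemma left_value_eq:
  assumes "0 < t" "eventually (\<lambda>s. f s = c) (at_left t)"
  shows "left_value f t = (c :: real)"
proof -
  have "(f \<longlongrightarrow> c) (at_left t)"
    using assms(2) by (rule tendsto_eventually)
  then show ?thesis using assms(1) by (simp add: left_value_def tendsto_Lim)
qed

definition parametrizable :: "(real \<Rightarrow> real) \<Rightarrow> real \<Rightarrow> bool" where
  "parametrizable f T \<longleftrightarrow> (\<exists>p\<in>parametrizations f T. p 1 = (f T, T))"

lemma parametrizable_0: "parametrizable f 0"
  unfolding parametrizable_def
proof (rule bexI[of _ "\<lambda>_. (f 0, 0)"])
  show "(\<lambda>_. (f 0, 0)) \<in> parametrizations f 0"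
    by (auto simp: parametrizations_def completed_graph_def left_value_def image_constant_conv)
qed simp

lemma graph_le_trans: "graph_le f x y \<Longrightarrow> graph_le f y z \<Longrightarrow> graph_le f x z"
  by (cases x; cases y; cases z) auto

lemma monotone_joinpaths:
  assumes trans: "\<And>x y z. R x y \<Longrightarrow> R y z \<Longrightarrow> R x z"
    and p: "\<And>s t. 0 \<le> s \<Longrightarrow> s \<le> t \<Longrightarrow> t \<le> 1 \<Longrightarrow> R (p s) (p t)"
    and q: "\<And>s t. 0 \<le> s \<Longrightarrow> s \<le> t \<Longrightarrow> t \<le> 1 \<Longrightarrow> R (q s) (q t)"
    and eq: "pathfinish p = pathstart q" and st: "0 \<le> s" "s \<le> t" "t \<le> (1::real)"
  shows "R ((p +++ q) s) ((p +++ q) t)"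
proof -
  consider "t \<le> 1 / 2" | "s \<le> 1 / 2" "1 / 2 < t" | "1 / 2 < s" using st by linarith
  then show ?thesis
  proof cases
    case 2
    have "R (p (2 * s)) (p 1)" using 2 st by (intro p) auto
    moreover have "R (q 0) (q (2 * t - 1))" using 2 st by (intro q) auto
    ultimately have "R (p (2 * s)) (q (2 * t - 1))"
      using eq trans by (metis pathfinish_def pathstart_def)
    then show ?thesis using 2 by (simp add: joinpaths_def)
  qed (use st in \<open>auto simp: joinpaths_def intro!: p q\<close>)
qed

lemma parametrizable_extend:
  assumes t: "parametrizable f t" and "0 \<le> t" "t < u" and const: "\<And>s. s \<in> {t..<u} \<Longrightarrow> f s = f t"
  shows "parametrizable f u"
proof -
  obtain p where "p \<in> parametrizations f t" "p 1 = (f t, t)"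
    using t by (auto simp: parametrizable_def)
  then have p: "continuous_on {0..1} p" "p ` {0..1} = completed_graph f t" "p 1 = (f t, t)"
    and pm: "\<And>s s'. 0 \<le> s \<Longrightarrow> s \<le> s' \<Longrightarrow> s' \<le> 1 \<Longrightarrow> graph_le f (p s) (p s')"
    by (simp_all add: parametrizations_def)
  define q1 where "q1 = linepath (f t, t) (f t, u)"
  define q2 where "q2 = linepath (f t, u) (f u, u)"
  have lv: "left_value f s = f t" if s: "t < s" "s \<le> u" for s
  proof (rule left_value_eq)
    show "0 < s" using s assms by simp
    have "eventually (\<lambda>r. r \<in> {t<..<s}) (at_left s)" by (rule eventually_at_left_real) (use s in simp)
    then show "eventually (\<lambda>r. f r = f t) (at_left s)"
    proof eventually_elim
      case (elim r)
      then show ?case using s by (intro const) auto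
    qed
  qed
  have q1: "q1 s = (f t, (1 - s) * t + s * u)" and q2: "q2 s = ((1 - s) * f t + s * f u, u)" for s
    by (simp_all add: q1_def q2_def linepath_def algebra_simps)
  have m1: "graph_le f (q1 s) (q1 s')" if "0 \<le> s" "s \<le> s'" "s' \<le> 1" for s s'
  proof -
    have "(1 - s') * t + s' * u - ((1 - s) * t + s * u) = (s' - s) * (u - t)" by (simp add: algebra_simps)
    moreover have "s = s' \<or> 0 < (s' - s) * (u - t)"
      using that assms(3) by (cases "s = s'") auto
    ultimately have "(1 - s) * t + s * u < (1 - s') * t + s' * u \<or> s = s'" by linarith
    then show ?thesis by (auto simp: q1)
  qed
  have m2: "graph_le f (q2 s) (q2 s')" if "0 \<le> s" "s \<le> s'" "s' \<le> 1" for s s'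
  proof -
    have "\<bar>f t - ((1 - s) * f t + s * f u)\<bar> = s * \<bar>f t - f u\<bar>" if "0 \<le> s" for s
    proof -
      have "f t - ((1 - s) * f t + s * f u) = s * (f t - f u)" by (simp add: algebra_simps)
      then show ?thesis using that by (simp add: abs_mult)
    qed
    moreover have "left_value f u = f t" using lv[of u] assms(3) by simp
    ultimately show ?thesis using that by (simp add: q2 mult_right_mono)
  qed
  have i1: "q1 ` {0..1} = {(f t, s) | s. t \<le> s \<and> s \<le> u}"
  proof -
    have "path_image q1 = {f t} \<times> {t..u}"
      using assms(3) by (auto simp: q1_def closed_segment_PairD closed_segment_eq_real_ivl closed_segment_same_fst)
    then show ?thesis by (auto simp: path_image_def)
  qed
  have i2: "q2 ` {0..1} = {(z, u) | z. z \<in> closed_segment (f t) (f u)}"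
  proof -
    have "path_image q2 = closed_segment (f t) (f u) \<times> {u}"
      by (auto simp: q2_def closed_segment_same_snd)
    then show ?thesis by (auto simp: path_image_def)
  qed
  define P where "P = p +++ (q1 +++ q2)"
  have j1: "pathfinish q1 = pathstart q2" by (simp add: q1_def q2_def)
  have j0: "pathfinish p = pathstart (q1 +++ q2)" using p(3) by (simp add: q1_def pathfinish_def)
  have "path q1" "path q2" by (simp_all add: q1_def q2_def)
  moreover have "path p" using p(1) by (simp add: path_def)
  ultimately have "path P" unfolding P_def using j0 j1 by (intro path_join_imp)
  then have "continuous_on {0..1} P" by (simp add: path_def)
  moreover have "P ` {0..1} = completed_graph f u"
  proof -
    have "P ` {0..1} = p ` {0..1} \<union> (q1 ` {0..1} \<union> q2 ` {0..1})"
      using path_image_join[OF j0] path_image_join[OF j1] by (simp add: P_def path_image_def)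
    also have "\<dots> = completed_graph f u"
      unfolding p(2) i1 i2 completed_graph_def
    proof (intro equalityI subsetI)
      fix w assume "w \<in> {(z, s). s \<in> {0..t} \<and> z \<in> closed_segment (left_value f s) (f s)} \<union>
        ({(f t, s) |s. t \<le> s \<and> s \<le> u} \<union> {(z, u) |z. z \<in> closed_segment (f t) (f u)})"
      then consider "w \<in> {(z, s). s \<in> {0..t} \<and> z \<in> closed_segment (left_value f s) (f s)}"
        | s where "w = (f t, s)" "t \<le> s" "s \<le> u" | z where "w = (z, u)" "z \<in> closed_segment (f t) (f u)"
        by blast
      then show "w \<in> {(z, s). s \<in> {0..u} \<and> z \<in> closed_segment (left_value f s) (f s)}"
      proof cases
        case 1 then show ?thesis using assms(2,3) by auto
      next
        case 2
        have "f t \<in> closed_segment (left_value f s) (f s)"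
        proof (cases "s = t")
          case False
          then have "left_value f s = f t" using 2 by (intro lv) auto
          then show ?thesis by simp
        qed simp
        then show ?thesis using 2 assms(2) by simp
      next
        case 3
        then show ?thesis using assms(2,3) lv[of u] by auto
      qed
    next
      fix w assume "w \<in> {(z, s). s \<in> {0..u} \<and> z \<in> closed_segment (left_value f s) (f s)}"
      then obtain z s where w: "w = (z, s)" "0 \<le> s" "s \<le> u" "z \<in> closed_segment (left_value f s) (f s)" by auto
      consider "s \<le> t" | "t < s" "s < u" | "s = u" using w by linarith
      then show "w \<in> {(z, s). s \<in> {0..t} \<and> z \<in> closed_segment (left_value f s) (f s)} \<union>
        ({(f t, s) |s. t \<le> s \<and> s \<le> u} \<union> {(z, u) |z. z \<in> closed_segment (f t) (f u)})"
      proof cases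
        case 2
        then have "left_value f s = f t" "f s = f t" using lv[of s] const[of s] by auto
        then have "z = f t" using w(4) by simp
        then show ?thesis using w(1) 2 by simp
      next
        case 3 then show ?thesis using w lv[of u] assms(2,3) by auto
      qed (use w in auto)
    qed
    finally show ?thesis .
  qed
  moreover have m12: "graph_le f ((q1 +++ q2) s) ((q1 +++ q2) s')" if "0 \<le> s" "s \<le> s'" "s' \<le> 1" for s s'
    by (rule monotone_joinpaths[where R = "graph_le f", OF graph_le_trans m1 m2 j1 that])
  have "graph_le f (P s) (P s')" if "0 \<le> s" "s \<le> s'" "s' \<le> 1" for s s'
    unfolding P_def
    by (rule monotone_joinpaths[where R = "graph_le f", OF graph_le_trans pm m12 j0 that])
  moreover have "P 1 = (f u, u)" using pathfinish_join[of p "q1 +++ q2"]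
    by (simp add: P_def pathfinish_def q2_def linepath_def joinpaths_def)
  ultimately show ?thesis unfolding parametrizable_def parametrizations_def by (intro bexI[of _ P]) auto
qed

lemma step_path_parametrizable:
  assumes f: "step_path f" and T: "0 \<le> T"
  shows "parametrizable f T"
proof (rule ccontr)
  assume neg: "\<not> parametrizable f T"
  define S where "S = {t. 0 \<le> t \<and> t \<le> T \<and> parametrizable f t}"
  define u where "u = Sup S"
  have S0: "0 \<in> S" using T by (simp add: S_def parametrizable_0)
  have bdd: "bdd_above S" by (auto simp: S_def intro!: bdd_aboveI[of _ T])
  have u: "0 \<le> u" "u \<le> T"
    using S0 bdd by (auto simp: u_def intro!: cSup_upper cSup_least) (auto simp: S_def)
  have pu: "parametrizable f u"
  proof (cases "u \<in> S")
    case True then show ?thesis by (simp add: S_def)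
  next
    case False
    then have "0 < u" using u S0 by (cases "u = 0") auto
    with f obtain v where v: "v \<in> {0..<u}" "\<forall>s\<in>{v..<u}. f s = f v"
      unfolding step_path_def by blast
    then obtain t where t: "t \<in> S" "v < t"
      using less_cSup_iff[OF _ bdd, of v] S0 v(1) by (auto simp: u_def)
    then have "t \<le> u" using bdd by (auto simp: u_def intro: cSup_upper)
    then have tu: "t < u" using False t by (cases "t = u") auto
    show ?thesis
    proof (rule parametrizable_extend[OF _ _ tu])
      show "parametrizable f t" "0 \<le> t" using t by (auto simp: S_def)
      fix s assume "s \<in> {t..<u}"
      then have "s \<in> {v..<u}" "t \<in> {v..<u}" using t tu by auto
      then have "f s = f v" "f t = f v" using v(2) by blast+
      then show "f s = f t" by simp
    qed
  qed
  then have "u \<noteq> T" using neg by auto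
  with u have uT: "u < T" by simp
  obtain v where v: "u < v" "\<forall>s\<in>{u..<v}. f s = f u"
    using f u unfolding step_path_def by blast
  define w where "w = min T ((u + v) / 2)"
  have w: "u < w" "w < v" "w \<le> T" using uT v(1) by (auto simp: w_def min_less_iff_disj)
  have "parametrizable f w"
  proof (rule parametrizable_extend[OF pu u(1) w(1)])
    fix s assume "s \<in> {u..<w}"
    then have "s \<in> {u..<v}" using w by simp
    with v(2) show "f s = f u" by blast
  qed
  then have "w \<in> S" using w u by (simp add: S_def)
  then have "w \<le> u" using bdd by (auto simp: u_def intro: cSup_upper)
  with w show False by simp
qed

lemma M1_conv_of_U_conv:
  assumes conv: "U_conv x f" and x: "eventually (\<lambda>n. step_path (x n)) sequentially"
    and f: "continuous_on {0..} f"
  shows "M1_conv x f"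
  unfolding M1_conv_def
proof (intro allI impI tendstoI)
  fix T e :: real assume T: "0 < T" and e: "0 < e"
  have lvf: "left_value f t = f t" if t: "0 \<le> t" for t
  proof (cases "t = 0")
    case False
    then have "(f \<longlongrightarrow> f t) (at_left t)" using t by (intro isCont_at_left continuous_on_isCont[OF f]) auto
    then show ?thesis using t False by (simp add: left_value_def tendsto_Lim)
  qed (simp add: left_value_def)
  have gf: "completed_graph f T = (\<lambda>t. (f t, t)) ` {0..T}"
    by (auto simp: completed_graph_def lvf)
  have "uniform_limit {0..T} x f sequentially" using conv T by (simp add: U_conv_def)
  then have "eventually (\<lambda>n. \<forall>t\<in>{0..T}. dist (x n t) (f t) < e / 2) sequentially"
    using e by (intro uniform_limitD) auto
  with x show "eventually (\<lambda>n. dist (M1_dist T (x n) f) 0 < e) sequentially"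
  proof eventually_elim
    case (elim n)
    let ?g = "x n"
    have close: "\<bar>?g t - f t\<bar> \<le> e / 2" if "0 \<le> t" "t \<le> T" for t
      using elim(2) that by (auto simp: dist_real_def intro: less_imp_le)
    have lvclose: "\<bar>left_value ?g t - f t\<bar> \<le> e / 2" if t: "0 \<le> t" "t \<le> T" for t
    proof (cases "t = 0")
      case True then show ?thesis using close[of 0] t by (simp add: left_value_def)
    next
      case False
      then have t0: "0 < t" using t by simp
      have "?g \<in> cadlag" by (rule step_path_cadlag) fact
      then obtain l where l: "(?g \<longlongrightarrow> l) (at_left t)" using t0 by (auto simp: cadlag_def)
      have "(f \<longlongrightarrow> f t) (at_left t)" by (intro isCont_at_left continuous_on_isCont[OF f t0])
      then have "((\<lambda>s. \<bar>?g s - f s\<bar>) \<longlongrightarrow> \<bar>l - f t\<bar>) (at_left t)" using l by (intro tendsto_intros)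
      moreover have "eventually (\<lambda>s. s \<in> {0<..<t}) (at_left t)" by (rule eventually_at_left_real) fact
      then have "eventually (\<lambda>s. \<bar>?g s - f s\<bar> \<le> e / 2) (at_left t)"
        by eventually_elim (use t close in auto)
      ultimately have "\<bar>l - f t\<bar> \<le> e / 2" by (rule tendsto_upperbound) simp
      then show ?thesis using l t0 by (simp add: left_value_def tendsto_Lim)
    qed
    obtain p where p: "p \<in> parametrizations ?g T"
      using step_path_parametrizable[OF elim(1), of T] T by (auto simp: parametrizable_def)
    define q where "q s = (f (snd (p s)), snd (p s))" for s
    have pc: "continuous_on {0..1} p" and pi: "p ` {0..1} = completed_graph ?g T"
      and pm: "\<forall>s\<in>{0..1}. \<forall>s'\<in>{0..1}. s \<le> s' \<longrightarrow> graph_le ?g (p s) (p s')"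
      using p by (auto simp: parametrizations_def)
    have pin: "p s \<in> completed_graph ?g T" if "s \<in> {0..1}" for s using pi that by blast
    have sp: "snd ` p ` {0..1} = {0..T}"
      unfolding pi completed_graph_def by (force simp: image_iff)
    have q: "q \<in> parametrizations f T"
      unfolding parametrizations_def
    proof (intro CollectI conjI ballI impI)
      show "continuous_on {0..1} q" unfolding q_def
        by (intro continuous_intros continuous_on_compose2[OF f] pc) (use sp in \<open>auto simp: image_image\<close>)
      have "q ` {0..1} = (\<lambda>t. (f t, t)) ` snd ` p ` {0..1}" by (simp add: q_def image_image)
      then show "q ` {0..1} = completed_graph f T" by (simp add: sp gf)
      fix s s' :: real assume s: "s \<in> {0..1}" "s' \<in> {0..1}" "s \<le> s'"
      then have "graph_le ?g (p s) (p s')" using pm by blast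
      then have "snd (p s) \<le> snd (p s')" by (cases "p s"; cases "p s'") auto
      then show "graph_le f (q s) (q s')" by (auto simp: q_def)
    qed
    define D where "D = (\<lambda>(p :: real \<Rightarrow> real \<times> real, q :: real \<Rightarrow> real \<times> real).
      SUP s\<in>{0..1}. max \<bar>fst (p s) - fst (q s)\<bar> \<bar>snd (p s) - snd (q s)\<bar>)"
    have M1: "M1_dist T ?g f = (INF pq\<in>parametrizations ?g T \<times> parametrizations f T. D pq)"
      by (simp add: M1_dist_def D_def)
    have D0: "0 \<le> D pq" if "pq \<in> parametrizations ?g T \<times> parametrizations f T" for pq
    proof -
      obtain p' q' where pq: "pq = (p', q')" by fastforce
      have "compact ((\<lambda>s. max \<bar>fst (p' s) - fst (q' s)\<bar> \<bar>snd (p' s) - snd (q' s)\<bar>) ` {0..1})"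
        using that pq by (intro compact_continuous_image continuous_intros) (auto simp: parametrizations_def)
      then have "bdd_above ((\<lambda>s. max \<bar>fst (p' s) - fst (q' s)\<bar> \<bar>snd (p' s) - snd (q' s)\<bar>) ` {0..1})"
        by (simp add: compact_imp_bounded bounded_imp_bdd_above)
      from cSUP_upper[OF _ this, of 0] show ?thesis unfolding pq D_def prod.case
        by (auto intro: order_trans[OF abs_ge_zero])
    qed
    have "D (p, q) \<le> e / 2"
      unfolding D_def prod.case
    proof (rule cSUP_least)
      fix s :: real assume s: "s \<in> {0..1}"
      obtain z t where zt: "p s = (z, t)" by fastforce
      then have z: "0 \<le> t" "t \<le> T" "z \<in> closed_segment (left_value ?g t) (?g t)"
        using pin[OF s] by (auto simp: completed_graph_def)
      have "\<bar>z - f t\<bar> \<le> e / 2"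
      proof -
        have "left_value ?g t \<le> z \<and> z \<le> ?g t \<or> ?g t \<le> z \<and> z \<le> left_value ?g t"
          using z(3) by (auto simp: closed_segment_eq_real_ivl split: if_splits)
        then show ?thesis using close[OF z(1,2)] lvclose[OF z(1,2)] by linarith
      qed
      then show "max \<bar>fst (p s) - fst (q s)\<bar> \<bar>snd (p s) - snd (q s)\<bar> \<le> e / 2"
        using e by (simp add: q_def zt)
    qed simp
    moreover have "M1_dist T ?g f \<le> D (p, q)" unfolding M1
      by (rule cINF_lower[OF bdd_belowI2[of _ 0]]) (use D0 p q in auto)
    moreover have "0 \<le> M1_dist T ?g f" unfolding M1 using p q by (intro cINF_greatest D0) auto
    ultimately show ?case using e by simp
  qed
qed

subsection \<open>Laplace transforms of Mittag-Leffler variables\<close>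

text \<open>The variable \<open>e\<^sup>-\<^sup>x\<close> takes values in \<open>[0, 1]\<close> and its moments are values of the Laplace transform.
  Only large arguments are used, because the Mittag-Leffler series can be integrated termwise only
  for these.\<close>

lemma laplace_unique:
  fixes \<mu> \<nu> :: "real measure"
  assumes \<mu>: "real_distribution \<mu>" and \<nu>: "real_distribution \<nu>"
    and \<mu>0: "AE x in \<mu>. 0 \<le> x" and \<nu>0: "AE x in \<nu>. 0 \<le> x"
    and eq: "\<And>k. m \<le> k \<Longrightarrow> (\<integral>x. exp (- real k * x) \<partial>\<mu>) = (\<integral>x. exp (- real k * x) \<partial>\<nu>)"
  shows "\<mu> = \<nu>"
proof (rule cdf_unique[OF \<mu> \<nu>])
  interpret \<mu>: real_distribution \<mu> by fact
  interpret \<nu>: real_distribution \<nu> by fact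
  define y :: "real \<Rightarrow> real" where "y x = exp (- max 0 x)" for x
  have y: "0 < y x" "y x \<le> 1" "0 \<le> y x" for x by (auto simp: y_def)
  have ym: "y \<in> borel_measurable borel" unfolding y_def by measurable
  have int_bd: "integrable \<mu> f" "integrable \<nu> f"
    if "f \<in> borel_measurable borel" "\<And>x. \<bar>f x\<bar> \<le> B" for f :: "real \<Rightarrow> real" and B
    using that by (auto intro!: \<mu>.integrable_const_bound[of _ B] \<nu>.integrable_const_bound[of _ B])
  have pow: "(\<integral>x. y x ^ k \<partial>\<mu>) = (\<integral>x. y x ^ k \<partial>\<nu>)" if k: "m \<le> k" for k
  proof -
    have yk: "y x ^ k = exp (- real k * x)" if "0 \<le> x" for x
      using that by (simp add: y_def exp_of_nat_mult[symmetric])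
    have "(\<integral>x. y x ^ k \<partial>\<mu>) = (\<integral>x. exp (- real k * x) \<partial>\<mu>)"
      using \<mu>0 ym by (intro integral_cong_AE) (auto simp: yk intro!: borel_measurable_power)
    moreover have "(\<integral>x. y x ^ k \<partial>\<nu>) = (\<integral>x. exp (- real k * x) \<partial>\<nu>)"
      using \<nu>0 ym by (intro integral_cong_AE) (auto simp: yk intro!: borel_measurable_power)
    ultimately show ?thesis using eq[OF k] by simp
  qed
  have yint: "integrable \<mu> (\<lambda>x. y x ^ k)" "integrable \<nu> (\<lambda>x. y x ^ k)" for k
    using y ym by (auto intro!: int_bd[of _ 1] borel_measurable_power simp: power_le_one abs_of_pos zero_less_power)
  have cont: "(\<integral>x. g (y x) * y x ^ m \<partial>\<mu>) = (\<integral>x. g (y x) * y x ^ m \<partial>\<nu>)"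
    if g: "continuous_on UNIV g" for g :: "real \<Rightarrow> real"
  proof -
    have gm: "(\<lambda>x. g (y x) * y x ^ m) \<in> borel_measurable borel"
      using borel_measurable_continuous_onI[OF g] ym by measurable
    have "bounded (g ` {0..1})"
      by (intro compact_imp_bounded compact_continuous_image continuous_on_subset[OF g]) auto
    then have "\<exists>B. \<forall>u\<in>{0..1}. \<bar>g u\<bar> \<le> B" by (auto simp: bounded_iff)
    then obtain B where "\<forall>u\<in>{0..1}. \<bar>g u\<bar> \<le> B" by blast
    then have gB: "\<bar>g (y x)\<bar> \<le> B" for x using y[of x] by (simp add: less_imp_le)
    have gbd: "\<bar>g (y x) * y x ^ m\<bar> \<le> B" for x
      using mult_mono[OF gB[of x] power_le_one[of "y x" m]] y[of x] order_trans[OF abs_ge_zero gB[of x]]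
      by (simp add: abs_mult less_imp_le)
    note gint = int_bd[OF gm gbd]
    have "\<bar>(\<integral>x. g (y x) * y x ^ m \<partial>\<mu>) - (\<integral>x. g (y x) * y x ^ m \<partial>\<nu>)\<bar> \<le> 2 * e" if e: "0 < e" for e
    proof -
      obtain q where "real_polynomial_function q" and q: "\<And>u. u \<in> {0..1} \<Longrightarrow> \<bar>g u - q u\<bar> < e"
        by (rule Stone_Weierstrass_real_polynomial_function[of "{0..1}" g e])
           (use e continuous_on_subset[OF g] in auto)
      then obtain c n where qc: "q = (\<lambda>u. \<Sum>i\<le>n. c i * u ^ i)" by (auto simp: real_polynomial_function_iff_sum)
      have qy: "q (y x) * y x ^ m = (\<Sum>i\<le>n. c i * y x ^ (i + m))" for x
        by (simp add: qc sum_distrib_right power_add mult.assoc)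
      have qint: "integrable \<mu> (\<lambda>x. q (y x) * y x ^ m)" "integrable \<nu> (\<lambda>x. q (y x) * y x ^ m)"
        unfolding qy by (auto intro!: yint)
      have qeq: "(\<integral>x. q (y x) * y x ^ m \<partial>\<mu>) = (\<integral>x. q (y x) * y x ^ m \<partial>\<nu>)"
        unfolding qy using yint by (simp add: pow)
      have diff: "\<bar>g (y x) * y x ^ m - q (y x) * y x ^ m\<bar> \<le> e" for x
      proof -
        have "\<bar>g (y x) * y x ^ m - q (y x) * y x ^ m\<bar> = \<bar>g (y x) - q (y x)\<bar> * y x ^ m"
          using y[of x] by (simp add: abs_mult left_diff_distrib[symmetric])
        also have "\<dots> \<le> e * 1"
          using q[of "y x"] y[of x] e by (intro mult_mono power_le_one) auto
        finally show ?thesis by simp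
      qed
      have "\<bar>(\<integral>x. g (y x) * y x ^ m \<partial>\<mu>) - (\<integral>x. q (y x) * y x ^ m \<partial>\<mu>)\<bar> \<le> e"
      proof -
        have "\<bar>(\<integral>x. g (y x) * y x ^ m - q (y x) * y x ^ m \<partial>\<mu>)\<bar> \<le> (\<integral>x. e \<partial>\<mu>)"
          by (rule order_trans[OF integral_abs_bound])
             (intro integral_mono integrable_abs Bochner_Integration.integrable_diff gint qint diff, simp)
        then show ?thesis using gint qint \<mu>.prob_space by simp
      qed
      moreover have "\<bar>(\<integral>x. g (y x) * y x ^ m \<partial>\<nu>) - (\<integral>x. q (y x) * y x ^ m \<partial>\<nu>)\<bar> \<le> e"
      proof -
        have "\<bar>(\<integral>x. g (y x) * y x ^ m - q (y x) * y x ^ m \<partial>\<nu>)\<bar> \<le> (\<integral>x. e \<partial>\<nu>)"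
          by (rule order_trans[OF integral_abs_bound])
             (intro integral_mono integrable_abs Bochner_Integration.integrable_diff gint qint diff, simp)
        then show ?thesis using gint qint \<nu>.prob_space by simp
      qed
      ultimately show ?thesis unfolding qeq by linarith
    qed
    from this[of "\<bar>(\<integral>x. g (y x) * y x ^ m \<partial>\<mu>) - (\<integral>x. g (y x) * y x ^ m \<partial>\<nu>)\<bar> / 4"]
    show ?thesis by (cases "(\<integral>x. g (y x) * y x ^ m \<partial>\<mu>) = (\<integral>x. g (y x) * y x ^ m \<partial>\<nu>)") auto
  qed
  show "cdf \<mu> = cdf \<nu>"
  proof
    fix t :: real
    show "cdf \<mu> t = cdf \<nu> t"
    proof (cases "t < 0")
      case True
      have "cdf \<mu> t = 0" unfolding cdf_def
        using \<mu>0 True by (subst \<mu>.prob_eq_0) (auto elim!: eventually_mono)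
      moreover have "cdf \<nu> t = 0" unfolding cdf_def
        using \<nu>0 True by (subst \<nu>.prob_eq_0) (auto elim!: eventually_mono)
      ultimately show ?thesis by simp
    next
      case False
      define y0 where "y0 = exp (- t)"
      have y0: "0 < y0" by (simp add: y0_def)
      define r where "r j u = min 1 (max 0 (real j * (u - y0) + 1))" for j u
      have r: "0 \<le> r j u" "r j u \<le> 1" for j u by (auto simp: r_def)
      obtain j0 :: nat where j0: "2 / y0 \<le> real j0" using real_arch_simple by blast
      have req: "(\<integral>x. r j (y x) \<partial>\<mu>) = (\<integral>x. r j (y x) \<partial>\<nu>)" if j: "j0 \<le> j" for j
      proof -
        have rz: "r j u = 0" if "u < y0 / 2" for u
        proof -
          have jy: "2 / y0 \<le> real j" using j0 j by linarith
          have "real j * (u - y0) \<le> real j * (- (y0 / 2))" using that by (intro mult_left_mono) auto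
          also have "\<dots> \<le> - 1" using jy y0 by (simp add: field_simps)
          finally show ?thesis by (simp add: r_def)
        qed
        have ry: "r j (y x) / (max (y x) (y0 / 2)) ^ m * y x ^ m = r j (y x)" for x
          using rz[of "y x"] y[of x] by (cases "y x < y0 / 2") (auto simp: max_def)
        have "continuous_on UNIV (\<lambda>u. r j u / (max u (y0 / 2)) ^ m)"
          unfolding r_def using y0 by (intro continuous_intros) (auto simp: max_def)
        from cont[OF this] show ?thesis unfolding ry .
      qed
      have lim: "(\<lambda>j. r j (y x)) \<longlonglongrightarrow> indicator {y0..} (y x)" for x
      proof (cases "y0 \<le> y x")
        case True
        then have "r j (y x) = 1" for j by (simp add: r_def)
        then show ?thesis using True by simp
      next
        case F: False
        obtain j1 :: nat where j1: "1 / (y0 - y x) \<le> real j1" using real_arch_simple by blast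
        have "r j (y x) = 0" if "j1 \<le> j" for j
        proof -
          have "1 / (y0 - y x) \<le> real j" using j1 that by linarith
          then have "1 \<le> real j * (y0 - y x)" using F by (simp add: field_simps)
          then have "real j * (y x - y0) + 1 \<le> 0" by (simp add: algebra_simps)
          then show ?thesis by (simp add: r_def)
        qed
        then have "eventually (\<lambda>j. r j (y x) = 0) sequentially" by (auto simp: eventually_sequentially)
        then show ?thesis using F by (simp add: tendsto_eventually)
      qed
      have rm: "(\<lambda>x. r j (y x)) \<in> borel_measurable borel" for j
        unfolding r_def using ym by measurable
      have im: "(\<lambda>x. indicator {y0..} (y x) :: real) \<in> borel_measurable borel"
        using ym by measurable
      have l\<mu>: "(\<lambda>j. \<integral>x. r j (y x) \<partial>\<mu>) \<longlonglongrightarrow> (\<integral>x. indicator {y0..} (y x) \<partial>\<mu>)"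
        by (rule integral_dominated_convergence[where w = "\<lambda>_. 1"]) (use rm im lim r in \<open>auto\<close>)
      have l\<nu>: "(\<lambda>j. \<integral>x. r j (y x) \<partial>\<nu>) \<longlonglongrightarrow> (\<integral>x. indicator {y0..} (y x) \<partial>\<nu>)"
        by (rule integral_dominated_convergence[where w = "\<lambda>_. 1"]) (use rm im lim r in \<open>auto\<close>)
      have "(\<lambda>j. \<integral>x. r j (y x) \<partial>\<mu>) \<longlonglongrightarrow> (\<integral>x. indicator {y0..} (y x) \<partial>\<nu>)"
        using l\<nu> by (rule Lim_transform_eventually)
           (use req in \<open>auto intro!: eventually_sequentiallyI[of j0]\<close>)
      with l\<mu> have ieq: "(\<integral>x. indicator {y0..} (y x) \<partial>\<mu>) = (\<integral>x. indicator {y0..} (y x) \<partial>\<nu> :: real)"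
        by (rule LIMSEQ_unique)
      have yi: "(indicator {y0..} (y x) :: real) = indicator {..t} x" for x
        using False by (auto simp: y0_def y_def indicator_def)
      show ?thesis using ieq unfolding yi by (simp add: cdf_def)
    qed
  qed
qed

lemma nn_integral_exponential_powr:
  assumes z: "0 < z" and b: "0 \<le> (b::real)"
  shows "(\<integral>\<^sup>+t. ennreal (exponential_density z t * t powr b) \<partial>lborel) = ennreal (Gamma (b + 1) * z powr (- b))"
proof -
  have "ennreal (Gamma (b + 1)) = (\<integral>\<^sup>+t. ennreal (indicator {0..} t * t powr b / exp t) \<partial>lborel)"
    using Gamma_conv_nn_integral_real[of "b + 1"] b by simp
  also have "\<dots> = ennreal z * (\<integral>\<^sup>+t. ennreal (indicator {0..} (z * t) * (z * t) powr b / exp (z * t)) \<partial>lborel)"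
    using z by (subst nn_integral_real_affine[where c = z and t = 0]) auto
  also have "\<dots> = (\<integral>\<^sup>+t. ennreal z * ennreal (indicator {0..} (z * t) * (z * t) powr b / exp (z * t)) \<partial>lborel)"
    by (rule nn_integral_cmult[symmetric]) auto
  also have "\<dots> = (\<integral>\<^sup>+t. ennreal (z powr b) * ennreal (exponential_density z t * t powr b) \<partial>lborel)"
  proof (rule nn_integral_cong)
    fix t
    show "ennreal z * ennreal (indicator {0..} (z * t) * (z * t) powr b / exp (z * t)) =
        ennreal (z powr b) * ennreal (exponential_density z t * t powr b)"
    proof (cases "t < 0")
      case True
      then have "z * t < 0" using z by (simp add: mult_pos_neg)
      then show ?thesis using True by (simp add: exponential_density_def)
    next
      case False
      then show ?thesis using z
        by (simp add: exponential_density_def ennreal_mult[symmetric] powr_mult exp_minus field_simps)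
    qed
  qed
  also have "\<dots> = ennreal (z powr b) * (\<integral>\<^sup>+t. ennreal (exponential_density z t * t powr b) \<partial>lborel)"
    by (rule nn_integral_cmult) auto
  finally have eq: "ennreal (Gamma (b + 1)) = ennreal (z powr b) * (\<integral>\<^sup>+t. ennreal (exponential_density z t * t powr b) \<partial>lborel)" .
  have "ennreal (z powr (- b)) * ennreal (z powr b) = 1"
    using z by (simp add: ennreal_mult[symmetric] powr_add[symmetric])
  then have "(\<integral>\<^sup>+t. ennreal (exponential_density z t * t powr b) \<partial>lborel) = ennreal (z powr (- b)) * ennreal (Gamma (b + 1))"
    unfolding eq by (simp add: mult.assoc[symmetric])
  also have "\<dots> = ennreal (Gamma (b + 1) * z powr (- b))"
    using b by (simp add: ennreal_mult[symmetric] mult.commute)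
  finally show ?thesis .
qed

lemma integral_exponential_mittag_leffler:
  assumes a: "0 < a" and l: "0 < l" and z: "0 < z" and lz: "l < z powr a"
  shows "(\<integral>t. exponential_density z t * mittag_leffler a (- l * t powr a) \<partial>lborel) = z powr a / (z powr a + l)"
proof -
  define r where "r = l / z powr a"
  have r: "0 < r" "r < 1" using l z lz by (auto simp: r_def)
  define f where "f k t = exponential_density z t * ((- l * t powr a) ^ k / Gamma (a * real k + 1))" for k :: nat and t
  have G: "0 < Gamma (a * real k + 1)" for k using a by (intro Gamma_real_pos) (simp add: add_nonneg_pos)
  have ed: "0 \<le> exponential_density z t" for t using z by (simp add: exponential_density_nonneg)
  have pw: "(t powr a) ^ k = t powr (a * real k)" if "0 < t" for t :: real and k
    using that by (simp add: powr_powr[symmetric] powr_realpow)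
  have ne0: "AE t in lborel. t \<noteq> (0::real)" by (rule AE_lborel_singleton)
  have fabs: "AE t in lborel. \<bar>f k t\<bar> = l ^ k / Gamma (a * real k + 1) * (exponential_density z t * t powr (a * real k))" for k
    using ne0
  proof eventually_elim
    case (elim t)
    show ?case
    proof (cases "t < 0")
      case False
      with elim have "0 < t" by simp
      then show ?thesis using G[of k] l ed[of t]
        by (simp add: f_def abs_mult power_mult_distrib power_abs pw)
    qed (simp add: f_def exponential_density_def)
  qed
  have fm: "f k \<in> borel_measurable lborel" for k unfolding f_def by measurable
  have nnf: "(\<integral>\<^sup>+t. ennreal \<bar>f k t\<bar> \<partial>lborel) = ennreal (r ^ k)" for k
  proof -
    have "(\<integral>\<^sup>+t. ennreal \<bar>f k t\<bar> \<partial>lborel) =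
      (\<integral>\<^sup>+t. ennreal (l ^ k / Gamma (a * real k + 1)) * ennreal (exponential_density z t * t powr (a * real k)) \<partial>lborel)"
      using fabs[of k] by (intro nn_integral_cong_AE)
        (auto elim!: eventually_mono simp: ennreal_mult[symmetric] l G ed less_imp_le)
    also have "\<dots> = ennreal (l ^ k / Gamma (a * real k + 1)) * ennreal (Gamma (a * real k + 1) * z powr (- (a * real k)))"
      using nn_integral_exponential_powr[OF z, of "a * real k"] a by (subst nn_integral_cmult) auto
    also have "\<dots> = ennreal (r ^ k)"
      using G[of k] l z a
      by (simp add: ennreal_mult[symmetric] less_imp_le r_def power_divide powr_minus powr_powr[symmetric] powr_realpow field_simps)
    finally show ?thesis .
  qed
  have fint: "integrable lborel (f k)" for k
    using fm nnf[of k] by (intro integrableI_bounded) auto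
  have fnorm: "(\<integral>t. norm (f k t) \<partial>lborel) = r ^ k" for k
    using nnf[of k] fm r by (intro integral_eq_nn_integral[THEN trans]) (auto simp: less_imp_le)
  have "(\<integral>\<^sup>+t. (\<Sum>k. ennreal \<bar>f k t\<bar>) \<partial>lborel) = (\<Sum>k. ennreal (r ^ k))"
    using fm nnf by (subst nn_integral_suminf) auto
  also have "\<dots> < top" using r by (simp add: suminf_ennreal2 less_imp_le summable_geometric)
  finally have "AE t in lborel. (\<Sum>k. ennreal \<bar>f k t\<bar>) \<noteq> \<infinity>"
    using fm by (intro nn_integral_PInf_AE) auto
  then have sm: "AE t in lborel. summable (\<lambda>k. norm (f k t))"
    by eventually_elim (auto intro!: summable_suminf_not_top)
  have sumf: "AE t in lborel. (\<Sum>k. f k t) = exponential_density z t * mittag_leffler a (- l * t powr a)"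
    using sm
  proof eventually_elim
    case (elim t)
    show ?case
    proof (cases "exponential_density z t = 0")
      case False
      have "summable (\<lambda>k. (- l * t powr a) ^ k / Gamma (a * real k + 1))"
        by (rule summable_mult_D[OF summable_norm_cancel[OF elim, unfolded f_def] False])
      then show ?thesis unfolding f_def mittag_leffler_def by (rule suminf_mult)
    qed (simp add: f_def)
  qed
  have fk: "(\<integral>t. f k t \<partial>lborel) = (- r) ^ k" for k
  proof -
    have "f k t = (- 1) ^ k * norm (f k t)" for t
      using ed[of t] G[of k] l by (simp add: f_def abs_mult power_abs power_mult_distrib[symmetric] mult_ac)
    then have "(\<integral>t. f k t \<partial>lborel) = (\<integral>t. (- 1) ^ k * norm (f k t) \<partial>lborel)" by metis
    also have "\<dots> = (- r) ^ k" using fnorm[of k] by (simp add: power_mult_distrib[symmetric])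
    finally show ?thesis .
  qed
  have sr: "summable (\<lambda>k. (\<integral>t. norm (f k t) \<partial>lborel))" unfolding fnorm using r by (simp add: summable_geometric)
  have "(\<integral>t. (\<Sum>k. f k t) \<partial>lborel) = (\<Sum>k. (- r) ^ k)"
    using integral_suminf[OF fint sm sr] by (simp add: fk)
  moreover have "(\<integral>t. (\<Sum>k. f k t) \<partial>lborel) = (\<integral>t. exponential_density z t * mittag_leffler a (- l * t powr a) \<partial>lborel)"
  proof -
    have "(\<lambda>t. \<Sum>k. f k t) \<in> borel_measurable lborel" using fm by measurable
    moreover have "(\<lambda>t. exponential_density z t * mittag_leffler a (- l * t powr a)) \<in> borel_measurable lborel"
      unfolding mittag_leffler_def by measurable
    ultimately show ?thesis using sumf by (intro integral_cong_AE)
  qed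
  moreover have "(\<Sum>k. (- r) ^ k) = 1 / (1 + r)" using r suminf_geometric[of "- r"] by simp
  ultimately show ?thesis using z l by (simp add: r_def field_simps add_pos_pos)
qed

lemma (in prob_space) mittag_leffler_laplace:
  assumes X: "mittag_leffler_distributed M a l X"
    and a: "0 < a" and l: "0 < l" and z: "0 < z" and lz: "l < z powr a"
  shows "(\<integral>\<omega>. exp (- z * X \<omega>) \<partial>M) = l / (l + z powr a)"
proof -
  have Xm[measurable]: "X \<in> borel_measurable M" and X0: "AE \<omega> in M. 0 \<le> X \<omega>"
    and tail: "\<And>t. 0 \<le> t \<Longrightarrow> prob {\<omega> \<in> space M. t < X \<omega>} = mittag_leffler a (- l * t powr a)"
    using X by (auto simp: mittag_leffler_distributed_def)
  interpret L: pair_sigma_finite lborel M ..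
  have "(\<integral>\<^sup>+\<omega>. ennreal (1 - exp (- z * X \<omega>)) \<partial>M) =
      (\<integral>\<^sup>+\<omega>. (\<integral>\<^sup>+t. ennreal (exponential_density z t) * indicator {..<X \<omega>} t \<partial>lborel) \<partial>M)"
    using X0
  proof (intro nn_integral_cong_AE, eventually_elim)
    case (elim \<omega>)
    have "(\<integral>\<^sup>+t. ennreal (exponential_density z t) * indicator {..<X \<omega>} t \<partial>lborel) =
        (\<integral>\<^sup>+t. ennreal (exponential_density z t) * indicator {..X \<omega>} t \<partial>lborel)"
      using AE_lborel_singleton[of "X \<omega>"]
      by (intro nn_integral_cong_AE) (auto elim!: eventually_mono split: split_indicator)
    also have "\<dots> = ennreal (1 - exp (- z * X \<omega>))"
      using nn_integral_erlang_density[OF z, of 0 "X \<omega>"] elim by (simp add: erlang_CDF_0)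
    finally show ?case by simp
  qed
  also have "\<dots> = (\<integral>\<^sup>+t. (\<integral>\<^sup>+\<omega>. ennreal (exponential_density z t) * indicator {..<X \<omega>} t \<partial>M) \<partial>lborel)"
    by (rule L.Fubini') (simp add: lessThan_def indicator_def)
  also have "\<dots> = (\<integral>\<^sup>+t. ennreal (exponential_density z t * mittag_leffler a (- l * t powr a)) \<partial>lborel)"
  proof (rule nn_integral_cong)
    fix t :: real
    have "(\<integral>\<^sup>+\<omega>. ennreal (exponential_density z t) * indicator {..<X \<omega>} t \<partial>M) =
      ennreal (exponential_density z t) * (\<integral>\<^sup>+\<omega>. indicator {\<omega> \<in> space M. t < X \<omega>} \<omega> \<partial>M)"
      by (subst nn_integral_cmult[symmetric]) (auto intro!: nn_integral_cong split: split_indicator)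
    also have "\<dots> = ennreal (exponential_density z t * prob {\<omega> \<in> space M. t < X \<omega>})"
      using z by (simp add: emeasure_eq_measure ennreal_mult[symmetric] exponential_density_nonneg)
    also have "\<dots> = ennreal (exponential_density z t * mittag_leffler a (- l * t powr a))"
      using tail[of t] by (cases "t < 0") (auto simp: exponential_density_def)
    finally show "(\<integral>\<^sup>+\<omega>. ennreal (exponential_density z t) * indicator {..<X \<omega>} t \<partial>M) =
        ennreal (exponential_density z t * mittag_leffler a (- l * t powr a))" .
  qed
  finally have eq: "(\<integral>\<^sup>+\<omega>. ennreal (1 - exp (- z * X \<omega>)) \<partial>M) =
      (\<integral>\<^sup>+t. ennreal (exponential_density z t * mittag_leffler a (- l * t powr a)) \<partial>lborel)" .
  have nonneg: "0 \<le> exponential_density z t * mittag_leffler a (- l * t powr a)" for t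
  proof (cases "t < 0")
    case False
    then show ?thesis using tail[of t, symmetric] z by (simp add: exponential_density_nonneg)
  qed (simp add: exponential_density_def)
  have e1: "AE \<omega> in M. \<bar>exp (- z * X \<omega>)\<bar> \<le> 1" using X0 by eventually_elim (use z in simp)
  have int: "integrable M (\<lambda>\<omega>. exp (- z * X \<omega>))" using e1 by (intro integrable_const_bound[of _ 1]) auto
  have "1 - (\<integral>\<omega>. exp (- z * X \<omega>) \<partial>M) = (\<integral>\<omega>. 1 - exp (- z * X \<omega>) \<partial>M)"
    using int by (simp add: prob_space)
  also have "\<dots> = enn2real (\<integral>\<^sup>+\<omega>. ennreal (1 - exp (- z * X \<omega>)) \<partial>M)"
    using e1 by (intro integral_eq_nn_integral) (auto elim!: eventually_mono)
  also have "\<dots> = (\<integral>t. exponential_density z t * mittag_leffler a (- l * t powr a) \<partial>lborel)"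
    unfolding eq using nonneg
    by (intro integral_eq_nn_integral[symmetric]) (auto simp: mittag_leffler_def)
  also have "\<dots> = z powr a / (z powr a + l)"
    by (rule integral_exponential_mittag_leffler[OF a l z lz])
  finally have "(\<integral>\<omega>. exp (- z * X \<omega>) \<partial>M) = 1 - z powr a / (z powr a + l)" by simp
  moreover have "0 < z powr a + l" using l by (simp add: add_nonneg_pos)
  ultimately have "(\<integral>\<omega>. exp (- z * X \<omega>) \<partial>M) = l / (l + z powr a)"
    by (simp add: field_simps)
  then show ?thesis .
qed

subsection \<open>Sequences of exponential variables\<close>

lemma (in product_prob_space) indep_vars_components:
  assumes "I \<noteq> {}"
  shows "P.indep_vars M (\<lambda>i x. x i) I"
proof (subst P.indep_vars_iff_distr_eq_PiM'[OF assms])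
  have "distr (PiM I M) (PiM I M) (\<lambda>x. \<lambda>i\<in>I. x i) = distr (PiM I M) (PiM I M) (\<lambda>x. x)"
    by (intro distr_cong) (auto simp: space_PiM PiE_restrict)
  also have "\<dots> = (\<Pi>\<^sub>M i\<in>I. distr (PiM I M) (M i) (\<lambda>x. x i))"
    by (simp add: PiM_component distr_id2 cong: PiM_cong)
  finally show "distr (PiM I M) (PiM I M) (\<lambda>x. \<lambda>i\<in>I. x i) = (\<Pi>\<^sub>M i\<in>I. distr (PiM I M) (M i) (\<lambda>x. x i))" .
qed simp

lemma (in prob_space) erlang_fourth_central_moment:
  assumes D: "distributed M lborel X (erlang_density k 1)"
  defines "c \<equiv> real (Suc k)"
  shows "integrable M (\<lambda>\<omega>. (X \<omega> - c) ^ 4)" "expectation (\<lambda>\<omega>. (X \<omega> - c) ^ 4) \<le> 9 * c ^ 2"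
proof -
  have m: "has_bochner_integral M (\<lambda>\<omega>. X \<omega> ^ i) (fact (k + i) / fact k)" for i
    using has_bochner_integral_erlang_ith_moment[OF _ D, of i] by simp
  have expand: "(x - c) ^ 4 = x ^ 4 - 4 * c * x ^ 3 + 6 * c ^ 2 * x ^ 2 - 4 * c ^ 3 * x ^ 1 + c ^ 4 * x ^ 0" for x
    by (simp add: power4_eq_xxxx power3_eq_cube power2_eq_square algebra_simps)
  have f1: "fact (k + 1) / fact k = c" by (simp add: c_def)
  have "fact (k + 2) = c * (c + 1) * (fact k :: real)"
    "fact (k + 3) = c * (c + 1) * (c + 2) * (fact k :: real)"
    "fact (k + 4) = c * (c + 1) * (c + 2) * (c + 3) * (fact k :: real)"
    by (simp_all add: c_def eval_nat_numeral algebra_simps)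
  then have f2: "fact (k + 2) / fact k = c * (c + 1)"
    and f3: "fact (k + 3) / fact k = c * (c + 1) * (c + 2)"
    and f4: "fact (k + 4) / fact k = c * (c + 1) * (c + 2) * (c + 3)"
    by simp_all
  have "has_bochner_integral M (\<lambda>\<omega>. (X \<omega> - c) ^ 4)
      (fact (k + 4) / fact k - 4 * c * (fact (k + 3) / fact k) + 6 * c ^ 2 * (fact (k + 2) / fact k)
       - 4 * c ^ 3 * (fact (k + 1) / fact k) + c ^ 4 * (fact (k + 0) / fact k))"
    unfolding expand
    by (intro has_bochner_integral_add has_bochner_integral_diff has_bochner_integral_mult_right m)
  also have "fact (k + 4) / fact k - 4 * c * (fact (k + 3) / fact k) + 6 * c ^ 2 * (fact (k + 2) / fact k)
       - 4 * c ^ 3 * (fact (k + 1) / fact k) + c ^ 4 * (fact (k + 0) / fact k) = 3 * c ^ 2 + 6 * c"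
    unfolding f1 f2 f3 f4 by (simp add: power4_eq_xxxx power3_eq_cube power2_eq_square algebra_simps)
  finally have h: "has_bochner_integral M (\<lambda>\<omega>. (X \<omega> - c) ^ 4) (3 * c ^ 2 + 6 * c)" .
  then show "integrable M (\<lambda>\<omega>. (X \<omega> - c) ^ 4)" by (rule integrable.intros)
  have "1 \<le> c" by (simp add: c_def)
  then have "c * 1 \<le> c * c" by (intro mult_left_mono) auto
  then show "expectation (\<lambda>\<omega>. (X \<omega> - c) ^ 4) \<le> 9 * c ^ 2"
    using has_bochner_integral_integral_eq[OF h] by (simp add: power2_eq_square)
qed

lemma (in prob_space) exponential_slln:
  assumes ind: "indep_vars (\<lambda>_. borel) X {1..}"
    and X: "\<And>k. 1 \<le> k \<Longrightarrow> distributed M lborel (X k) (exponential_density 1)"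
  shows "AE \<omega> in M. (\<lambda>k. partial_sum (\<lambda>i. X i \<omega>) k / real k) \<longlonglongrightarrow> 1"
proof -
  define S where "S k \<omega> = partial_sum (\<lambda>i. X i \<omega>) (Suc k)" for k \<omega>
  have D: "distributed M lborel (S k) (erlang_density k 1)" for k
  proof -
    have "distributed M lborel (\<lambda>\<omega>. \<Sum>i\<in>{1..Suc k}. X i \<omega>) (erlang_density (card {1..Suc k} - 1) 1)"
      by (rule exponential_distributed_sum) (auto intro!: X indep_vars_subset[OF ind])
    then show ?thesis by (simp add: S_def[abs_def] partial_sum_def)
  qed
  have Sm[measurable]: "S k \<in> borel_measurable M" for k
    using distributed_measurable[OF D[of k]] by simp
  have ev: "AE \<omega> in M. eventually (\<lambda>k. \<bar>S k \<omega> / real (Suc k) - 1\<bar> < e) sequentially" if e: "0 < e" for e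
  proof -
    define A where "A k = {\<omega> \<in> space M. (e * real (Suc k)) ^ 4 \<le> (S k \<omega> - real (Suc k)) ^ 4}" for k
    have Am: "A k \<in> sets M" for k unfolding A_def by measurable
    have bound: "measure M (A k) \<le> 9 / e ^ 4 * inverse (real (Suc k) ^ 2)" for k
    proof -
      define c where "c = real (Suc k)"
      have c: "0 < c" by (simp add: c_def)
      note mom = erlang_fourth_central_moment[OF D[of k], folded c_def]
      have "measure M (A k) \<le> expectation (\<lambda>\<omega>. (S k \<omega> - c) ^ 4) / (e * c) ^ 4"
        unfolding A_def c_def[symmetric]
        by (rule integral_Markov_inequality_measure[where A = "space M"]) (use mom c e in auto)
      also have "\<dots> \<le> 9 * c ^ 2 / (e * c) ^ 4" using mom c e by (intro divide_right_mono) auto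
      also have "\<dots> = 9 / e ^ 4 * inverse (c ^ 2)"
        using c e by (simp add: field_simps power4_eq_xxxx power2_eq_square)
      finally show ?thesis by (simp add: c_def)
    qed
    have "summable (\<lambda>k. 9 / e ^ 4 * inverse (real (Suc k) ^ 2))"
      by (intro summable_mult summable_Suc_iff[THEN iffD2] inverse_power_summable) simp
    then have sm: "summable (\<lambda>k. measure M (A k))"
      by (rule summable_comparison_test') (use bound in auto)
    have "AE \<omega> in M. eventually (\<lambda>k. \<omega> \<in> space M - A k) sequentially"
      by (rule borel_cantelli_AE1[OF Am _ sm]) (simp add: emeasure_eq_measure)
    then show ?thesis
    proof eventually_elim
      case (elim \<omega>)
      then show ?case
      proof eventually_elim
        case (elim k)
        define c where "c = real (Suc k)"
        have c: "0 < c" by (simp add: c_def)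
        have "\<bar>S k \<omega> - c\<bar> ^ 4 < (e * c) ^ 4"
          using elim by (auto simp: A_def c_def not_le)
        then have "\<bar>S k \<omega> - c\<bar> < e * c"
          by (rule power_less_imp_less_base) (use c e in auto)
        moreover have "S k \<omega> / c - 1 = (S k \<omega> - c) / c" using c by (simp add: field_simps)
        ultimately have "\<bar>S k \<omega> / c - 1\<bar> < e" using c by (simp add: field_simps)
        then show ?case by (simp add: c_def)
      qed
    qed
  qed
  have "AE \<omega> in M. \<forall>j. eventually (\<lambda>k. \<bar>S k \<omega> / real (Suc k) - 1\<bar> < inverse (real (Suc j))) sequentially"
    by (intro AE_all_countable[THEN iffD2] allI ev) simp
  then show ?thesis
  proof eventually_elim
    case (elim \<omega>)
    have "(\<lambda>k. S k \<omega> / real (Suc k)) \<longlonglongrightarrow> 1"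
    proof (rule tendstoI)
      fix e :: real assume "0 < e"
      then obtain j where "inverse (real (Suc j)) < e" using reals_Archimedean by blast
      with spec[OF elim, of j] show "eventually (\<lambda>k. dist (S k \<omega> / real (Suc k)) 1 < e) sequentially"
        by (auto elim!: eventually_mono simp: dist_real_def)
    qed
    then show ?case by (subst filterlim_sequentially_Suc[symmetric]) (simp add: S_def)
  qed
qed

definition exp_seq :: "(nat \<Rightarrow> real) measure" where
  "exp_seq = PiM {1..} (\<lambda>_. density lborel (exponential_density 1))"

lemma product_prob_space_exponential: "product_prob_space (\<lambda>_::nat. density lborel (exponential_density 1))"
  by (intro product_prob_spaceI prob_space_exponential_density) simp

lemma prob_space_exp_seq: "prob_space exp_seq"
  unfolding exp_seq_def by (intro prob_space_PiM prob_space_exponential_density) simp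

lemma sets_exp_seq[measurable_cong]: "sets exp_seq = sets (PiM {1..} (\<lambda>_. borel))"
  unfolding exp_seq_def by (intro sets_PiM_cong) auto

lemma
  shows exp_seq_indep: "prob_space.indep_vars exp_seq (\<lambda>_. borel) (\<lambda>k g. g k) {1..}"
    and exp_seq_distr: "1 \<le> k \<Longrightarrow> distr exp_seq borel (\<lambda>g. g k) = density lborel (exponential_density 1)"
proof -
  interpret product_prob_space "\<lambda>_::nat. density lborel (exponential_density 1)" "{1..}"
    by (rule product_prob_space_exponential)
  have "P.indep_vars (\<lambda>_. density lborel (exponential_density 1)) (\<lambda>k g. g k) {1..}"
    by (rule indep_vars_components) simp
  from P.indep_vars_compose2[OF this, where N = "\<lambda>_. borel" and Y = "\<lambda>_ x. x"]
  show "prob_space.indep_vars exp_seq (\<lambda>_. borel) (\<lambda>k g. g k) {1..}" by (simp add: exp_seq_def)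
  assume k: "1 \<le> k"
  have "distr exp_seq borel (\<lambda>g. g k) = distr exp_seq (density lborel (exponential_density 1)) (\<lambda>g. g k)"
    by (rule distr_cong) auto
  also have "\<dots> = density lborel (exponential_density 1)"
    using PiM_component[of k] k by (simp add: exp_seq_def)
  finally show "distr exp_seq borel (\<lambda>g. g k) = density lborel (exponential_density 1)" .
qed

lemma exp_seq_component: "1 \<le> k \<Longrightarrow> (\<lambda>g. g k) \<in> borel_measurable exp_seq"
  by (simp add: measurable_cong_sets[OF sets_exp_seq refl])

lemma AE_exp_seq:
  "AE g in exp_seq. arrival_seq g \<and> (\<lambda>k. partial_sum g k / real k) \<longlonglongrightarrow> 1"
proof -
  interpret prob_space exp_seq by (rule prob_space_exp_seq)
  have D: "distributed exp_seq lborel (\<lambda>g. g k) (exponential_density 1)" if k: "1 \<le> k" for k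
    unfolding distributed_def using exp_seq_distr[OF k] exp_seq_component[OF k]
    by (simp add: distr_cong[OF refl sets_lborel, of exp_seq "\<lambda>g. g k" "\<lambda>g. g k"])
  have pos: "AE g in exp_seq. 0 < g k" if k: "1 \<le> k" for k
  proof -
    have "prob {g \<in> space exp_seq. 0 < g k} = 1"
      using exponential_distributedD_gt[OF D[OF k], of 0] by simp
    moreover have "{g \<in> space exp_seq. 0 < g k} \<in> events"
      using exp_seq_component[OF k] by measurable
    ultimately show ?thesis using prob_eq_1 by (auto elim!: eventually_mono)
  qed
  have "AE g in exp_seq. \<forall>k\<in>{1..}. 0 < g k"
    by (intro AE_ball_countable[THEN iffD2] ballI pos) auto
  moreover have "AE g in exp_seq. (\<lambda>k. partial_sum (\<lambda>i. g i) k / real k) \<longlonglongrightarrow> 1"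
    by (rule exponential_slln[OF exp_seq_indep D])
  ultimately show ?thesis
  proof eventually_elim
    case (elim g)
    have lln: "(\<lambda>k. partial_sum g k / real k) \<longlonglongrightarrow> 1" using elim(2) by simp
    have "\<exists>k. real K < partial_sum g k" for K :: nat
    proof -
      have "eventually (\<lambda>k. 1 / 2 < partial_sum g k / real k) sequentially"
        by (rule order_tendstoD(1)[OF lln]) simp
      then have "eventually (\<lambda>k. 1 / 2 < partial_sum g k / real k \<and> 2 * K + 1 \<le> k) sequentially"
        by (intro eventually_conj eventually_ge_at_top)
      then obtain k where k: "1 / 2 < partial_sum g k / real k" "2 * K + 1 \<le> k"
        using eventually_happens by fastforce
      have "0 < k" using k(2) by simp
      then have "real k / 2 < partial_sum g k" using k(1) by (simp add: field_simps)
      moreover have "real K < real k / 2" using k(2) by linarith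
      ultimately show ?thesis by (intro exI[of _ k]) linarith
    qed
    with elim(1) lln show ?case by (simp add: arrival_seq_def)
  qed
qed

subsection \<open>Stable subordinators\<close>

lemma (in prob_space) indep_vars_AE_cong:
  assumes X: "indep_vars M' X I" and I: "countable I"
    and Y: "\<And>i. i \<in> I \<Longrightarrow> random_variable (M' i) (Y i)"
    and eq: "\<And>i. i \<in> I \<Longrightarrow> AE \<omega> in M. X i \<omega> = Y i \<omega>"
  shows "indep_vars M' Y I"
proof (cases "I = {}")
  case False
  have Xm: "random_variable (M' i) (X i)" if "i \<in> I" for i using X that by (auto simp: indep_vars_def)
  have "AE \<omega> in M. \<forall>i\<in>I. X i \<omega> = Y i \<omega>" by (intro AE_ball_countable[THEN iffD2, OF I] ballI eq)
  then have "AE \<omega> in M. (\<lambda>i\<in>I. X i \<omega>) = (\<lambda>i\<in>I. Y i \<omega>)" by eventually_elim auto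
  then have "distr M (PiM I M') (\<lambda>\<omega>. \<lambda>i\<in>I. Y i \<omega>) = distr M (PiM I M') (\<lambda>\<omega>. \<lambda>i\<in>I. X i \<omega>)"
    by (intro distr_cong_AE measurable_restrict Xm Y) auto
  also have "\<dots> = PiM I (\<lambda>i. distr M (M' i) (X i))"
    using X indep_vars_iff_distr_eq_PiM'[OF False Xm] by simp
  also have "\<dots> = PiM I (\<lambda>i. distr M (M' i) (Y i))"
    by (intro PiM_cong refl distr_cong_AE Xm Y eq)
  finally show ?thesis using indep_vars_iff_distr_eq_PiM'[OF False Y] by simp
qed (simp add: indep_vars_def2 indep_sets_def)

lemma (in prob_space) indep_vars_const:
  assumes "\<And>i. i \<in> I \<Longrightarrow> c i \<in> space (M' i)"
  shows "indep_vars M' (\<lambda>i _. c i) I"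
  unfolding indep_vars_def2
proof (intro conjI ballI indep_setsI)
  fix i assume "i \<in> I"
  then show "random_variable (M' i) (\<lambda>_. c i)" using assms by simp
  show "{(\<lambda>_. c i) -` A \<inter> space M |A. A \<in> sets (M' i)} \<subseteq> events"
    by (auto simp: vimage_const)
next
  fix A and J assume J: "J \<noteq> {}" "J \<subseteq> I" "finite J"
    and A: "\<forall>j\<in>J. A j \<in> {(\<lambda>_. c j) -` A \<inter> space M |A. A \<in> sets (M' j)}"
  have A': "A j = {} \<or> A j = space M" if "j \<in> J" for j
  proof -
    from bspec[OF A that] obtain B where "A j = (\<lambda>_. c j) -` B \<inter> space M" by blast
    then show ?thesis by (cases "c j \<in> B") auto
  qed
  show "prob (\<Inter>j\<in>J. A j) = (\<Prod>j\<in>J. prob (A j))"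
  proof (cases "\<forall>j\<in>J. A j = space M")
    case True
    then have "(\<Inter>j\<in>J. A j) = space M" using J by auto
    then show ?thesis using True by (simp add: prob_space)
  next
    case False
    then obtain j where j: "j \<in> J" "A j = {}" using A' by blast
    then have "(\<Inter>j\<in>J. A j) = {}" by auto
    moreover have "(\<Prod>j\<in>J. prob (A j)) = 0" using j by (intro prod_zero J(3) bexI[of _ j]) simp_all
    ultimately show ?thesis by simp
  qed
qed

lemma (in prob_space) prob_le_laplace:
  fixes X :: "'a \<Rightarrow> real"
  assumes X[measurable]: "X \<in> borel_measurable M" and z: "0 \<le> z"
    and L: "(\<integral>\<omega>. exp (- z * X \<omega>) \<partial>M) = exp L"
  shows "prob {\<omega> \<in> space M. X \<omega> \<le> K} \<le> exp (z * K + L)"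
proof -
  have int: "integrable M (\<lambda>\<omega>. exp (- z * X \<omega>))"
    using L not_integrable_integral_eq by fastforce
  have iA: "integrable M (indicat_real {\<omega> \<in> space M. X \<omega> \<le> K})"
    by (intro integrable_real_indicator) (auto simp: emeasure_eq_measure)
  have "prob {\<omega> \<in> space M. X \<omega> \<le> K} = (\<integral>\<omega>. indicator {\<omega> \<in> space M. X \<omega> \<le> K} \<omega> \<partial>M)"
    by simp
  also have "\<dots> \<le> (\<integral>\<omega>. exp (z * K) * exp (- z * X \<omega>) \<partial>M)"
  proof (rule integral_mono)
    fix \<omega> assume "\<omega> \<in> space M"
    have "X \<omega> \<le> K \<Longrightarrow> 0 \<le> z * K + - z * X \<omega>"
      using z mult_left_mono[of "X \<omega>" K z] by simp
    then show "indicator {\<omega> \<in> space M. X \<omega> \<le> K} \<omega> \<le> exp (z * K) * exp (- z * X \<omega>)"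
      by (auto simp: indicator_def exp_add[symmetric])
  qed (use int iA in auto)
  also have "\<dots> = exp (z * K + L)" using L by (simp add: exp_add)
  finally show ?thesis .
qed

lemma (in prob_space) AE_pos_of_laplace:
  fixes X :: "'a \<Rightarrow> real"
  assumes X[measurable]: "X \<in> borel_measurable M" and h: "0 < h" and a: "0 < a"
    and L: "\<And>z. 0 \<le> z \<Longrightarrow> (\<integral>\<omega>. exp (- z * X \<omega>) \<partial>M) = exp (- h * z powr a)"
  shows "AE \<omega> in M. 0 < X \<omega>"
proof -
  have "(\<lambda>n. exp (- h * real n powr a)) \<longlonglongrightarrow> 0"
    using h a by real_asymp
  moreover have "prob {\<omega> \<in> space M. X \<omega> \<le> 0} \<le> exp (- h * real n powr a)" for n
    using prob_le_laplace[OF X _ L, of "real n" 0] by simp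
  ultimately have "prob {\<omega> \<in> space M. X \<omega> \<le> 0} \<le> 0"
    by (intro tendsto_lowerbound[of "\<lambda>n. exp (- h * real n powr a)" 0 sequentially]) auto
  then have "prob {\<omega> \<in> space M. X \<omega> \<le> 0} = 0" by (simp add: measure_le_0_iff)
  then show ?thesis by (subst (asm) prob_eq_0) (auto elim!: eventually_mono)
qed

lemma (in prob_space) AE_unbounded_of_laplace:
  fixes X :: "nat \<Rightarrow> 'a \<Rightarrow> real"
  assumes X[measurable]: "\<And>n. X n \<in> borel_measurable M"
    and L: "\<And>n. (\<integral>\<omega>. exp (- 1 * X n \<omega>) \<partial>M) = exp (- real n)"
  shows "AE \<omega> in M. \<exists>n. K < X n \<omega>"
proof -
  have "(\<lambda>n. exp (1 * K + - real n)) \<longlonglongrightarrow> 0" by real_asymp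
  moreover have "prob {\<omega> \<in> space M. \<forall>n. X n \<omega> \<le> K} \<le> exp (1 * K + - real n)" for n
    by (rule order_trans[OF finite_measure_mono prob_le_laplace[OF X _ L[of n]]]) auto
  ultimately have "prob {\<omega> \<in> space M. \<forall>n. X n \<omega> \<le> K} \<le> 0"
    by (intro tendsto_lowerbound[of "\<lambda>n. exp (1 * K + - real n)" 0 sequentially]) auto
  then have "prob {\<omega> \<in> space M. \<forall>n. X n \<omega> \<le> K} = 0" by (simp add: measure_le_0_iff)
  then show ?thesis by (subst (asm) prob_eq_0) (auto elim!: eventually_mono simp: not_le)
qed

lemma (in prob_space) stable_subordinator_levy:
  assumes \<sigma>: "stable_subordinator M a \<sigma>" and m: "\<And>t. 0 \<le> t \<Longrightarrow> (\<lambda>\<omega>. \<sigma> \<omega> t) \<in> borel_measurable M"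
  shows "levy_process M \<sigma>" "AE \<omega> in M. mono_on {0..} (\<sigma> \<omega>)"
    "\<And>t z. 0 \<le> t \<Longrightarrow> 0 \<le> z \<Longrightarrow> (\<integral>\<omega>. exp (- z * \<sigma> \<omega> t) \<partial>M) = exp (- t * z powr a)"
proof -
  have "levy_process M \<sigma> \<and> (AE \<omega> in M. mono_on {0..} (\<sigma> \<omega>)) \<and>
    (\<forall>t\<ge>0. \<forall>z\<ge>0. (\<integral>\<omega>. exp (- z * \<sigma> \<omega> t) \<partial>M) = exp (- t * z powr a))"
  proof (cases "a = 1")
    case False
    then show ?thesis using \<sigma> by (simp add: stable_subordinator_def)
  next
    case True
    then have id: "AE \<omega> in M. \<forall>t\<ge>0. \<sigma> \<omega> t = t" using \<sigma> by (simp add: stable_subordinator_def)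
    show ?thesis unfolding levy_process_def
    proof (intro conjI allI impI m)
      show "AE \<omega> in M. \<sigma> \<omega> 0 = 0" using id by eventually_elim simp
      show "AE \<omega> in M. mono_on {0..} (\<sigma> \<omega>)" using id by eventually_elim (auto simp: mono_on_def)
      show "AE \<omega> in M. \<sigma> \<omega> \<in> cadlag"
        using id
      proof eventually_elim
        case (elim \<omega>)
        then show ?case
          using cadlag_cong[of "\<sigma> \<omega>" "\<lambda>t. t"] continuous_cadlag[OF continuous_on_id] by simp
      qed
    next
      fix s :: "nat \<Rightarrow> real" and k :: nat assume s: "0 \<le> s 0 \<and> (\<forall>i<k. s i \<le> s (Suc i))"
      have s0: "0 \<le> s i" if "i \<le> k" for i
        using that by (induction i) (use s in \<open>auto intro: order_trans\<close>)
      show "indep_vars (\<lambda>_. borel) (\<lambda>i \<omega>. \<sigma> \<omega> (s (Suc i)) - \<sigma> \<omega> (s i)) {..<k}"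
      proof (rule indep_vars_AE_cong[OF indep_vars_const[of _ "\<lambda>i. s (Suc i) - s i"]])
        fix i assume i: "i \<in> {..<k}"
        show "random_variable borel (\<lambda>\<omega>. \<sigma> \<omega> (s (Suc i)) - \<sigma> \<omega> (s i))"
          using i by (intro borel_measurable_diff m s0) auto
        show "AE \<omega> in M. s (Suc i) - s i = \<sigma> \<omega> (s (Suc i)) - \<sigma> \<omega> (s i)"
          using id by eventually_elim (use i s0[of i] s0[of "Suc i"] in auto)
      qed auto
    next
      fix t h :: real assume "0 \<le> t" "0 \<le> h"
      then show "distr M borel (\<lambda>\<omega>. \<sigma> \<omega> (t + h) - \<sigma> \<omega> t) = distr M borel (\<lambda>\<omega>. \<sigma> \<omega> h)"
        using id by (intro distr_cong_AE borel_measurable_diff m) (auto elim!: eventually_mono)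
    next
      fix t z :: real assume tz: "0 \<le> t" "0 \<le> z"
      have "AE \<omega> in M. \<sigma> \<omega> t = t" using id by eventually_elim (use tz in simp)
      then have "(\<integral>\<omega>. exp (- z * \<sigma> \<omega> t) \<partial>M) = (\<integral>\<omega>. exp (- z * t) \<partial>M)"
        using m[of t] tz by (intro integral_cong_AE) auto
      then show "(\<integral>\<omega>. exp (- z * \<sigma> \<omega> t) \<partial>M) = exp (- t * z powr a)"
        using tz True by (simp add: prob_space mult.commute)
    qed
  qed
  then show "levy_process M \<sigma>" "AE \<omega> in M. mono_on {0..} (\<sigma> \<omega>)"
    "\<And>t z. 0 \<le> t \<Longrightarrow> 0 \<le> z \<Longrightarrow> (\<integral>\<omega>. exp (- z * \<sigma> \<omega> t) \<partial>M) = exp (- t * z powr a)"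
    by blast+
qed

locale subordinator = prob_space N for N :: "'b measure" +
  fixes a :: real and s :: "'b \<Rightarrow> real \<Rightarrow> real"
  assumes path: "\<And>\<omega>. subordinator_path (s \<omega>)"
    and meas: "\<And>t. 0 \<le> t \<Longrightarrow> (\<lambda>\<omega>. s \<omega> t) \<in> borel_measurable N"
    and increments: "\<And>u. 0 \<le> u 0 \<Longrightarrow> mono u \<Longrightarrow>
      indep_vars (\<lambda>_. borel) (\<lambda>k \<omega>. s \<omega> (u k) - s \<omega> (u (k - 1))) (UNIV :: nat set)"
    and stationary: "\<And>t h. 0 \<le> t \<Longrightarrow> 0 \<le> h \<Longrightarrow>
      distr N borel (\<lambda>\<omega>. s \<omega> (t + h) - s \<omega> t) = distr N borel (\<lambda>\<omega>. s \<omega> h)"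
    and laplace: "\<And>t z. 0 \<le> t \<Longrightarrow> 0 \<le> z \<Longrightarrow> (\<integral>\<omega>. exp (- z * s \<omega> t) \<partial>N) = exp (- t * z powr a)"

text \<open>With truncated subtraction the increment of index \<open>0\<close> vanishes, so that the increments of
  index \<open>k \<ge> 1\<close> line up with \<open>T\<^sub>k\<close> and \<open>S\<^sub>k\<close>.\<close>

lemma (in prob_space) levy_process_increments:
  assumes \<sigma>: "levy_process M \<sigma>" and u: "0 \<le> u 0" "mono u"
  shows "indep_vars (\<lambda>_. borel) (\<lambda>k \<omega>. \<sigma> \<omega> (u k) - \<sigma> \<omega> (u (k - 1))) (UNIV :: nat set)"
proof -
  have levy: "indep_vars (\<lambda>_. borel) (\<lambda>i \<omega>. \<sigma> \<omega> (s (Suc i)) - \<sigma> \<omega> (s i)) {..<k}"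
    if "0 \<le> s 0" "\<And>i. i < k \<Longrightarrow> s i \<le> s (Suc i)" for s and k :: nat
    using \<sigma> that unfolding levy_process_def by blast
  have fin: "indep_vars (\<lambda>_. borel) (\<lambda>k \<omega>. \<sigma> \<omega> (u k) - \<sigma> \<omega> (u (k - 1))) {..<k}" for k
    using levy[of "\<lambda>i. u (i - 1)" k] u by (simp add: monoD)
  show ?thesis unfolding indep_vars_def2
  proof (intro conjI ballI)
    fix k :: nat
    show "random_variable borel (\<lambda>\<omega>. \<sigma> \<omega> (u k) - \<sigma> \<omega> (u (k - 1)))"
      using fin[of "Suc k"] unfolding indep_vars_def2 by blast
  next
    show "indep_sets (\<lambda>k. {(\<lambda>\<omega>. \<sigma> \<omega> (u k) - \<sigma> \<omega> (u (k - 1))) -` A \<inter> space M |A. A \<in> sets borel}) UNIV"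
    proof (subst indep_sets_finite_index_sets, intro allI impI)
      fix J :: "nat set" assume "finite J"
      then obtain k where "J \<subseteq> {..<k}" using finite_nat_iff_bounded by auto
      then show "indep_sets (\<lambda>k. {(\<lambda>\<omega>. \<sigma> \<omega> (u k) - \<sigma> \<omega> (u (k - 1))) -` A \<inter> space M |A. A \<in> sets borel}) J"
        using fin[of k] indep_sets_mono_index unfolding indep_vars_def2 by blast
    qed
  qed
qed

lemma (in prob_space) AE_subordinator_path:
  assumes \<sigma>: "levy_process M \<sigma>" and mono: "AE \<omega> in M. mono_on {0..} (\<sigma> \<omega>)" and a: "0 < a"
    and L: "\<And>t z. 0 \<le> t \<Longrightarrow> 0 \<le> z \<Longrightarrow> (\<integral>\<omega>. exp (- z * \<sigma> \<omega> t) \<partial>M) = exp (- t * z powr a)"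
  shows "AE \<omega> in M. subordinator_path (\<sigma> \<omega>)"
proof -
  have m: "(\<lambda>\<omega>. \<sigma> \<omega> t) \<in> borel_measurable M" if "0 \<le> t" for t
    using \<sigma> that by (simp add: levy_process_def)
  have incr: "AE \<omega> in M. \<sigma> \<omega> p < \<sigma> \<omega> q" if pq: "0 \<le> p" "p < q" for p q
  proof -
    have "AE \<omega> in M. 0 < \<sigma> \<omega> (q - p)"
      by (rule AE_pos_of_laplace[OF m _ a L]) (use pq in auto)
    then have "AE x in distr M borel (\<lambda>\<omega>. \<sigma> \<omega> (q - p)). 0 < x"
      using m[of "q - p"] pq by (subst AE_distr_iff) auto
    also have "distr M borel (\<lambda>\<omega>. \<sigma> \<omega> (q - p)) = distr M borel (\<lambda>\<omega>. \<sigma> \<omega> (p + (q - p)) - \<sigma> \<omega> p)"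
    proof -
      have "\<forall>t\<ge>0. \<forall>h\<ge>0. distr M borel (\<lambda>\<omega>. \<sigma> \<omega> (t + h) - \<sigma> \<omega> t) = distr M borel (\<lambda>\<omega>. \<sigma> \<omega> h)"
        using \<sigma> by (simp add: levy_process_def)
      from this[rule_format, of p "q - p"] pq show ?thesis by simp
    qed
    finally show ?thesis
      using m[of p] m[of q] pq by (subst (asm) AE_distr_iff) auto
  qed
  have rat: "AE \<omega> in M. \<forall>p\<in>\<rat> \<inter> {0..}. \<forall>q\<in>\<rat>. p < q \<longrightarrow> \<sigma> \<omega> p < \<sigma> \<omega> q"
    by (intro AE_ball_countable[THEN iffD2] countable_Int1 countable_rat ballI)
       (auto intro!: incr simp: AE_all_countable)
  have "AE \<omega> in M. \<exists>n::nat. real K < \<sigma> \<omega> (real n)" for K :: nat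
    by (rule AE_unbounded_of_laplace[OF m]) (use L[of "real n" 1 for n] in auto)
  then have "AE \<omega> in M. \<forall>K::nat. \<exists>n::nat. real K < \<sigma> \<omega> (real n)"
    by (simp add: AE_all_countable)
  moreover have "AE \<omega> in M. \<sigma> \<omega> 0 = 0" "AE \<omega> in M. \<sigma> \<omega> \<in> cadlag"
    using \<sigma> by (auto simp: levy_process_def)
  ultimately show ?thesis using rat mono
  proof eventually_elim
    case (elim \<omega>)
    have "\<sigma> \<omega> x < \<sigma> \<omega> y" if xy: "0 \<le> x" "x < y" for x y
    proof -
      obtain p where p: "p \<in> \<rat>" "x < p" "p < y" using Rats_dense_in_real[OF xy(2)] by blast
      obtain q where q: "q \<in> \<rat>" "p < q" "q < y" using Rats_dense_in_real[OF p(3)] by blast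
      have "\<sigma> \<omega> x \<le> \<sigma> \<omega> p" "\<sigma> \<omega> q \<le> \<sigma> \<omega> y"
        using xy p q by (auto intro!: mono_onD[OF elim(5)])
      moreover have "\<sigma> \<omega> p < \<sigma> \<omega> q" using elim(4) p q xy by auto
      ultimately show ?thesis by linarith
    qed
    then show ?case using elim(1-3) unfolding subordinator_path_def cadlag_def
      by (auto simp: strict_mono_on_def intro: of_nat_0_le_iff) (metis of_nat_0_le_iff)
  qed
qed

lemma subordinator_path_id: "subordinator_path (\<lambda>t. t)"
  unfolding subordinator_path_def
  by (auto simp: strict_mono_on_def intro!: tendsto_ident_at) (metis gt_ex of_nat_0_le_iff order.strict_trans1 order_less_imp_le)

lemma (in prob_space) stable_subordinator_version:
  assumes \<sigma>: "stable_subordinator M a \<sigma>" and m: "\<And>t. 0 \<le> t \<Longrightarrow> (\<lambda>\<omega>. \<sigma> \<omega> t) \<in> borel_measurable M"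
    and a: "0 < a"
  obtains s where "subordinator M a s" "AE \<omega> in M. s \<omega> = \<sigma> \<omega>"
proof -
  have L: "levy_process M \<sigma>" "AE \<omega> in M. mono_on {0..} (\<sigma> \<omega>)"
    and L3: "\<And>t z. 0 \<le> t \<Longrightarrow> 0 \<le> z \<Longrightarrow> (\<integral>\<omega>. exp (- z * \<sigma> \<omega> t) \<partial>M) = exp (- t * z powr a)"
    using stable_subordinator_levy[OF \<sigma> m] by blast+
  have "AE \<omega> in M. subordinator_path (\<sigma> \<omega>)"
    by (rule AE_subordinator_path[OF L a L3])
  then obtain N0 where N0: "{\<omega> \<in> space M. \<not> subordinator_path (\<sigma> \<omega>)} \<subseteq> N0" "emeasure M N0 = 0" "N0 \<in> sets M"
    by (rule AE_E)
  define s where "s \<omega> = (if \<omega> \<in> space M - N0 then \<sigma> \<omega> else (\<lambda>t. t))" for \<omega>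
  have eq: "AE \<omega> in M. s \<omega> = \<sigma> \<omega>"
    using N0 by (intro AE_I[of _ _ N0]) (auto simp: s_def)
  have eqt: "AE \<omega> in M. s \<omega> t = \<sigma> \<omega> t" for t using eq by eventually_elim simp
  have sm: "(\<lambda>\<omega>. s \<omega> t) \<in> borel_measurable M" if "0 \<le> t" for t
  proof -
    have "(\<lambda>\<omega>. if \<omega> \<in> space M - N0 then \<sigma> \<omega> t else t) \<in> borel_measurable M"
      using N0(3) m[OF that] by (intro measurable_If_set) auto
    then show ?thesis by (simp add: s_def if_distribR cong: if_cong)
  qed
  have "subordinator M a s"
  proof
    show "subordinator_path (s \<omega>)" for \<omega> using N0(1) by (auto simp: s_def subordinator_path_id)
    show "(\<lambda>\<omega>. s \<omega> t) \<in> borel_measurable M" if "0 \<le> t" for t by (rule sm[OF that])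
    show "indep_vars (\<lambda>_. borel) (\<lambda>k \<omega>. s \<omega> (u k) - s \<omega> (u (k - 1))) (UNIV :: nat set)"
      if u: "0 \<le> u 0" "mono u" for u
    proof (rule indep_vars_AE_cong[OF levy_process_increments[OF L(1) u]])
      have u0: "0 \<le> u k" for k using u monoD[OF u(2), of 0 k] by simp
      fix k :: nat
      show "random_variable borel (\<lambda>\<omega>. s \<omega> (u k) - s \<omega> (u (k - 1)))"
        by (intro borel_measurable_diff sm u0)
      show "AE \<omega> in M. \<sigma> \<omega> (u k) - \<sigma> \<omega> (u (k - 1)) = s \<omega> (u k) - s \<omega> (u (k - 1))"
        using eq by eventually_elim simp
    qed (auto intro: countableI_type)
    show "distr M borel (\<lambda>\<omega>. s \<omega> (t + h) - s \<omega> t) = distr M borel (\<lambda>\<omega>. s \<omega> h)"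
      if th: "0 \<le> t" "0 \<le> h" for t h
    proof -
      have "distr M borel (\<lambda>\<omega>. s \<omega> (t + h) - s \<omega> t) = distr M borel (\<lambda>\<omega>. \<sigma> \<omega> (t + h) - \<sigma> \<omega> t)"
        using th eq by (intro distr_cong_AE borel_measurable_diff sm m) (auto elim!: eventually_mono)
      also have "\<dots> = distr M borel (\<lambda>\<omega>. \<sigma> \<omega> h)" using L(1) th by (simp add: levy_process_def)
      also have "\<dots> = distr M borel (\<lambda>\<omega>. s \<omega> h)"
        using th eq by (intro distr_cong_AE sm m) (auto elim!: eventually_mono)
      finally show ?thesis .
    qed
    show "(\<integral>\<omega>. exp (- z * s \<omega> t) \<partial>M) = exp (- t * z powr a)" if tz: "0 \<le> t" "0 \<le> z" for t z
    proof -
      have "(\<integral>\<omega>. exp (- z * s \<omega> t) \<partial>M) = (\<integral>\<omega>. exp (- z * \<sigma> \<omega> t) \<partial>M)"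
        using eqt[of t] sm[OF tz(1)] m[OF tz(1)] by (intro integral_cong_AE) auto
      then show ?thesis using L3[OF tz] by simp
    qed
  qed
  with eq show ?thesis by (rule that[rotated])
qed

context subordinator
begin

lemma measurable_path:
  assumes f: "f \<in> measurable K N" and u: "u \<in> borel_measurable K" and u0: "\<And>x. x \<in> space K \<Longrightarrow> 0 \<le> u x"
  shows "(\<lambda>x. s (f x) (u x)) \<in> borel_measurable K"
proof (rule borel_measurable_LIMSEQ_real)
  define v where "v n x = (real (nat \<lfloor>real (Suc n) * u x\<rfloor>) + 1) / real (Suc n)" for n x
  show "(\<lambda>x. s (f x) (v n x)) \<in> borel_measurable K" for n
  proof -
    have g: "(\<lambda>x. nat \<lfloor>real (Suc n) * u x\<rfloor>) \<in> measurable K (count_space UNIV)"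
      using u by measurable
    have "(\<lambda>x. s (f x) ((real k + 1) / real (Suc n))) \<in> borel_measurable K" for k :: nat
      by (rule measurable_compose[OF f meas]) simp
    from measurable_compose_countable'[OF this g] show ?thesis by (simp add: v_def)
  qed
  fix x assume x: "x \<in> space K"
  have v: "u x < v n x" "v n x \<le> u x + 1 / real (Suc n)" for n
  proof -
    have "real (nat \<lfloor>real (Suc n) * u x\<rfloor>) = real_of_int \<lfloor>real (Suc n) * u x\<rfloor>" using u0[OF x] by simp
    then have "real (Suc n) * u x < real (nat \<lfloor>real (Suc n) * u x\<rfloor>) + 1"
      "real (nat \<lfloor>real (Suc n) * u x\<rfloor>) \<le> real (Suc n) * u x" by linarith+
    then show "u x < v n x" "v n x \<le> u x + 1 / real (Suc n)"
      unfolding v_def by (simp_all add: field_simps del: of_nat_Suc)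
  qed
  have "(\<lambda>n. u x + 1 / real (Suc n)) \<longlonglongrightarrow> u x" by real_asymp
  then have "(\<lambda>n. v n x) \<longlonglongrightarrow> u x"
    by (rule tendsto_sandwich[rotated 2, OF tendsto_const]) (use v in \<open>auto intro!: always_eventually less_imp_le\<close>)
  then have "filterlim (\<lambda>n. v n x) (at_right (u x)) sequentially"
    by (rule tendsto_imp_filterlim_at_right) (use v in simp)
  moreover have "(s (f x) \<longlongrightarrow> s (f x) (u x)) (at_right (u x))"
    using path u0[OF x] by (simp add: subordinator_path_def)
  ultimately show "(\<lambda>n. s (f x) (v n x)) \<longlonglongrightarrow> s (f x) (u x)"
    by (rule filterlim_compose[rotated])
qed

lemma measurable_inverse_path:
  assumes U: "U \<in> borel_measurable N"
  shows "(\<lambda>\<omega>. inverse_path (s \<omega>) (U \<omega>)) \<in> borel_measurable N"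
proof (rule borel_measurableI_le)
  fix y
  show "{\<omega> \<in> space N. inverse_path (s \<omega>) (U \<omega>) \<le> y} \<in> events"
  proof (cases "0 \<le> y")
    case True
    then have "{\<omega> \<in> space N. inverse_path (s \<omega>) (U \<omega>) \<le> y} = {\<omega> \<in> space N. U \<omega> \<le> s \<omega> y}"
      by (simp add: inverse_path_le_iff[OF path])
    then show ?thesis using meas[OF True] U by simp
  next
    case False
    then have "\<not> inverse_path (s \<omega>) (U \<omega>) \<le> y" for \<omega>
      using inverse_path_nonneg[OF path[of \<omega>], of "U \<omega>"] by linarith
    then show ?thesis by simp
  qed
qed

lemma path_nonneg: "0 \<le> t \<Longrightarrow> 0 \<le> s \<omega> t"
  by (rule subordinator_path_nonneg[OF path])

lemma prob_gt_le:
  assumes e: "0 < e" and h: "0 \<le> h"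
  shows "prob {\<omega> \<in> space N. e < s \<omega> h} \<le> h / (1 - exp (- e))"
proof -
  have m[measurable]: "(\<lambda>\<omega>. s \<omega> h) \<in> borel_measurable N" by (rule meas[OF h])
  have e1: "0 < 1 - exp (- e)" using e by simp
  have int: "integrable N (\<lambda>\<omega>. exp (- 1 * s \<omega> h))"
    using path_nonneg[OF h] by (intro integrable_const_bound[of _ 1]) auto
  have "(1 - exp (- e)) * prob {\<omega> \<in> space N. e < s \<omega> h} = (\<integral>\<omega>. (1 - exp (- e)) * indicator {\<omega> \<in> space N. e < s \<omega> h} \<omega> \<partial>N)"
    by simp
  also have "\<dots> \<le> (\<integral>\<omega>. 1 - exp (- 1 * s \<omega> h) \<partial>N)"
  proof (rule integral_mono)
    show "integrable N (\<lambda>\<omega>. (1 - exp (- e)) * indicator {\<omega> \<in> space N. e < s \<omega> h} \<omega>)"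
      by (intro integrable_mult_right integrable_real_indicator) (auto simp: emeasure_eq_measure)
    show "integrable N (\<lambda>\<omega>. 1 - exp (- 1 * s \<omega> h))" using int by simp
    show "(1 - exp (- e)) * indicator {\<omega> \<in> space N. e < s \<omega> h} \<omega> \<le> 1 - exp (- 1 * s \<omega> h)" for \<omega>
      using path_nonneg[OF h, of \<omega>] by (auto simp: indicator_def)
  qed
  also have "\<dots> = 1 - exp (- h)" using int laplace[OF h, of 1] by (simp add: prob_space)
  also have "\<dots> \<le> h" using exp_ge_add_one_self[of "- h"] by simp
  finally show ?thesis using e1 by (simp add: field_simps)
qed

lemma prob_increment:
  assumes th: "0 \<le> t" "0 \<le> h"
  shows "prob {\<omega> \<in> space N. e < s \<omega> (t + h) - s \<omega> t} = prob {\<omega> \<in> space N. e < s \<omega> h}"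
proof -
  have m: "(\<lambda>\<omega>. s \<omega> (t + h) - s \<omega> t) \<in> borel_measurable N" "(\<lambda>\<omega>. s \<omega> h) \<in> borel_measurable N"
    using th by (auto intro!: borel_measurable_diff meas)
  have "measure (distr N borel (\<lambda>\<omega>. s \<omega> (t + h) - s \<omega> t)) {e<..} = measure (distr N borel (\<lambda>\<omega>. s \<omega> h)) {e<..}"
    by (simp add: stationary[OF th])
  then show ?thesis using m
    by (simp add: measure_distr vimage_def Int_def conj_commute)
qed

end

subsection \<open>The law of a sampled subordinator\<close>

abbreviation seq_space :: "(nat \<Rightarrow> real) measure" where
  "seq_space \<equiv> PiM {1..} (\<lambda>_. borel)"

abbreviation unit_exponential :: "real measure" where
  "unit_exponential \<equiv> density lborel (exponential_density 1)"

definition scaled_path :: "real \<Rightarrow> (real \<Rightarrow> real) \<Rightarrow> real \<Rightarrow> real" where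
  "scaled_path c f t = c * f (max 0 t)"

lemma subordinator_path_scaled:
  assumes c: "0 < c" and f: "subordinator_path f"
  shows "subordinator_path (scaled_path c f)"
  unfolding subordinator_path_def
proof (intro conjI allI impI)
  show "scaled_path c f 0 = 0" using f by (simp add: scaled_path_def subordinator_path_def)
  show "strict_mono_on {0..} (scaled_path c f)"
    using c by (auto simp: strict_mono_on_def scaled_path_def subordinator_path_less_iff[OF f])
  show "(scaled_path c f \<longlongrightarrow> scaled_path c f t) (at_right t)" if t: "0 \<le> t" for t
  proof -
    have "((\<lambda>u. c * f u) \<longlongrightarrow> c * f t) (at_right t)"
      using f t by (intro tendsto_intros) (simp add: subordinator_path_def)
    moreover have "eventually (\<lambda>u. c * f u = scaled_path c f u) (at_right t)"
      using t by (auto simp: eventually_at_right_field scaled_path_def intro!: exI[of _ "t + 1"])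
    ultimately have "(scaled_path c f \<longlongrightarrow> c * f t) (at_right t)" by (rule Lim_transform_eventually)
    then show ?thesis using t by (simp add: scaled_path_def)
  qed
  fix K :: nat
  obtain K' :: nat where "real K / c \<le> real K'" using real_arch_simple by blast
  moreover obtain t where "0 \<le> t" "real K' < f t" using f by (auto simp: subordinator_path_def)
  ultimately have "real K / c < f t" by linarith
  then have "real K < scaled_path c f t" using c \<open>0 \<le> t\<close> by (simp add: scaled_path_def field_simps)
  with \<open>0 \<le> t\<close> show "\<exists>t\<ge>0. real K < scaled_path c f t" by blast
qed

lemma inverse_path_scaled: "0 < c \<Longrightarrow> inverse_path (scaled_path c f) t = inverse_path f (t / c)"
  unfolding inverse_path_def scaled_path_def
  by (rule arg_cong[where f = Least]) (auto simp: fun_eq_iff field_simps max_def)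

lemma nn_integral_exponential_exp:
  assumes q: "0 \<le> q"
  shows "(\<integral>\<^sup>+h. ennreal (exp (- q * h)) \<partial>unit_exponential) = ennreal (1 / (1 + q))"
proof -
  have q1: "1 + q \<noteq> 0" using q by simp
  have "exp (- h) * exp (- q * h) = exp (- h * (1 + q))" for h
    by (simp add: exp_add[symmetric] algebra_simps)
  then have eq: "exponential_density 1 h * exp (- q * h) = 1 / (1 + q) * exponential_density (1 + q) h" for h
    using q1 by (simp add: exponential_density_def)
  have "(\<integral>\<^sup>+h. ennreal (exp (- q * h)) \<partial>unit_exponential)
      = (\<integral>\<^sup>+h. ennreal (exponential_density 1 h) * ennreal (exp (- q * h)) \<partial>lborel)"
    by (subst nn_integral_density) auto
  also have "\<dots> = (\<integral>\<^sup>+h. ennreal (1 / (1 + q)) * ennreal (exponential_density (1 + q) h) \<partial>lborel)"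
  proof (rule nn_integral_cong)
    fix h
    have "ennreal (exponential_density 1 h) * ennreal (exp (- q * h)) = ennreal (exponential_density 1 h * exp (- q * h))"
      by (rule ennreal_mult'[symmetric]) (simp add: exponential_density_nonneg)
    also have "\<dots> = ennreal (1 / (1 + q)) * ennreal (exponential_density (1 + q) h)"
      unfolding eq by (rule ennreal_mult') (use q in simp)
    finally show "ennreal (exponential_density 1 h) * ennreal (exp (- q * h)) =
      ennreal (1 / (1 + q)) * ennreal (exponential_density (1 + q) h)" .
  qed
  also have "\<dots> = ennreal (1 / (1 + q)) * (\<integral>\<^sup>+h. ennreal (exponential_density (1 + q) h) \<partial>lborel)"
    by (rule nn_integral_cmult) simp
  also have "(\<integral>\<^sup>+h. ennreal (exponential_density (1 + q) h) \<partial>lborel) = 1"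
    using nn_integral_erlang_ith_moment[of "1 + q" 0 0] q by simp
  finally show ?thesis by simp
qed

context subordinator
begin

definition coupled_seq :: "real \<Rightarrow> real \<Rightarrow> 'b \<times> (nat \<Rightarrow> real) \<Rightarrow> nat \<Rightarrow> real" where
  "coupled_seq c m = (\<lambda>(\<omega>, g). \<lambda>k\<in>{1..}. sampled (scaled_path c (s \<omega>)) g m k)"

definition increment_law :: "real \<Rightarrow> real \<Rightarrow> real \<Rightarrow> real measure" where
  "increment_law c m h = distr N borel (\<lambda>\<omega>. scaled_path c (s \<omega>) (h / m))"

definition coupled_law :: "real \<Rightarrow> real \<Rightarrow> real measure" where
  "coupled_law c m = distr (N \<Otimes>\<^sub>M unit_exponential) borel (\<lambda>(\<omega>, h). scaled_path c (s \<omega>) (h / m))"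

lemma measurable_scaled_path [measurable]: "(\<lambda>\<omega>. scaled_path c (s \<omega>) t) \<in> borel_measurable N"
  unfolding scaled_path_def by (intro borel_measurable_times meas) auto

lemma measurable_scaled_path_pair:
  assumes "f \<in> measurable K N" "u \<in> borel_measurable K"
  shows "(\<lambda>x. scaled_path c (s (f x)) (u x)) \<in> borel_measurable K"
  unfolding scaled_path_def using assms by (intro borel_measurable_times measurable_path) auto

lemma measurable_partial_sum_snd:
  "(\<lambda>x. partial_sum (snd x) k) \<in> borel_measurable (N \<Otimes>\<^sub>M exp_seq)"
  unfolding partial_sum_def
  by (intro borel_measurable_sum measurable_compose[OF measurable_snd exp_seq_component]) auto

lemma measurable_coupled_seq: "coupled_seq c m \<in> measurable (N \<Otimes>\<^sub>M exp_seq) seq_space"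
  unfolding coupled_seq_def case_prod_beta sampled_def
  by (intro measurable_restrict borel_measurable_diff measurable_scaled_path_pair measurable_fst
      borel_measurable_divide measurable_partial_sum_snd) auto

lemma measurable_coupled_seq_fixed: "(\<lambda>\<omega>. coupled_seq c m (\<omega>, g)) \<in> measurable N seq_space"
  unfolding coupled_seq_def case_prod_beta sampled_def
  by (intro measurable_restrict borel_measurable_diff) auto

lemma coupled_seq_fixed_law:
  assumes m: "0 < m" and g: "arrival_seq g"
  shows "distr N seq_space (\<lambda>\<omega>. coupled_seq c m (\<omega>, g)) = PiM {1..} (\<lambda>k. increment_law c m (g k))"
proof -
  define u where "u k = partial_sum g k / m" for k
  have u0: "0 \<le> u k" for k using m partial_sum_nonneg[OF g] by (simp add: u_def)
  have mono: "mono u"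
    using m strict_mono_partial_sum[OF g] by (auto simp: mono_def u_def strict_mono_less_eq divide_right_mono)
  have sm: "sampled (scaled_path c (s \<omega>)) g m k = c * (s \<omega> (u k) - s \<omega> (u (k - 1)))" for k \<omega>
    using u0[of k] u0[of "k - 1"] by (simp add: sampled_def scaled_path_def u_def right_diff_distrib)
  have "indep_vars (\<lambda>_. borel) (\<lambda>k \<omega>. s \<omega> (u k) - s \<omega> (u (k - 1))) {1..}"
    by (rule indep_vars_subset[OF increments[OF u0[of 0] mono]]) auto
  from indep_vars_compose2[OF this, where N = "\<lambda>_. borel" and Y = "\<lambda>_ x. c * x"]
  have ind: "indep_vars (\<lambda>_. borel) (\<lambda>k \<omega>. c * (s \<omega> (u k) - s \<omega> (u (k - 1)))) {1..}" by simp
  have mm: "(\<lambda>\<omega>. c * (s \<omega> (u k) - s \<omega> (u (k - 1)))) \<in> borel_measurable N" for k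
    by (intro borel_measurable_times borel_measurable_diff meas u0) auto
  have "distr N seq_space (\<lambda>\<omega>. coupled_seq c m (\<omega>, g)) =
      distr N seq_space (\<lambda>\<omega>. \<lambda>k\<in>{1..}. c * (s \<omega> (u k) - s \<omega> (u (k - 1))))"
    by (simp add: coupled_seq_def sm cong: restrict_cong)
  also have "\<dots> = PiM {1..} (\<lambda>k. distr N borel (\<lambda>\<omega>. c * (s \<omega> (u k) - s \<omega> (u (k - 1)))))"
    by (rule indep_vars_iff_distr_eq_PiM'[THEN iffD1, OF _ _ ind]) (simp, rule mm)
  also have "\<dots> = PiM {1..} (\<lambda>k. increment_law c m (g k))"
  proof (intro PiM_cong refl)
    fix k :: nat assume k: "k \<in> {1..}"
    have h: "u k = u (k - 1) + g k / m" using k by (cases k) (auto simp: u_def add_divide_distrib)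
    have gk: "0 \<le> g k / m" using m g k by (auto simp: arrival_seq_def less_imp_le)
    have "distr N borel (\<lambda>\<omega>. c * (s \<omega> (u k) - s \<omega> (u (k - 1)))) =
        distr (distr N borel (\<lambda>\<omega>. s \<omega> (u (k - 1) + g k / m) - s \<omega> (u (k - 1)))) borel (\<lambda>x. c * x)"
      unfolding h by (subst distr_distr) (auto simp: comp_def intro!: borel_measurable_diff meas u0 gk add_nonneg_nonneg)
    also have "\<dots> = distr N borel (\<lambda>\<omega>. c * s \<omega> (g k / m))"
      unfolding stationary[OF u0 gk] by (subst distr_distr) (auto simp: comp_def intro!: meas gk)
    finally show "distr N borel (\<lambda>\<omega>. c * (s \<omega> (u k) - s \<omega> (u (k - 1)))) = increment_law c m (g k)"
      using gk by (simp add: increment_law_def scaled_path_def)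
  qed
  finally show ?thesis .
qed

lemma measurable_scaled_path_joint:
  "(\<lambda>(\<omega>, h). scaled_path c (s \<omega>) (h / m)) \<in> borel_measurable (N \<Otimes>\<^sub>M unit_exponential)"
  unfolding case_prod_beta by (intro measurable_scaled_path_pair) auto

lemma emeasure_increment_law:
  "A \<in> sets borel \<Longrightarrow> emeasure (increment_law c m h) A = emeasure N ((\<lambda>\<omega>. scaled_path c (s \<omega>) (h / m)) -` A \<inter> space N)"
  unfolding increment_law_def by (intro emeasure_distr) auto

lemma
  assumes A: "A \<in> sets borel"
  shows measurable_increment_law: "(\<lambda>h. emeasure (increment_law c m h) A) \<in> borel_measurable borel"
    and emeasure_coupled_law:
      "emeasure (coupled_law c m) A = (\<integral>\<^sup>+h. emeasure (increment_law c m h) A \<partial>unit_exponential)"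
proof -
  interpret E: prob_space unit_exponential by (rule prob_space_exponential_density) simp
  interpret P: pair_sigma_finite N unit_exponential ..
  let ?Q = "(\<lambda>(\<omega>, h). scaled_path c (s \<omega>) (h / m)) -` A \<inter> space (N \<Otimes>\<^sub>M unit_exponential)"
  have Q: "?Q \<in> sets (N \<Otimes>\<^sub>M unit_exponential)"
    by (rule measurable_sets[OF measurable_scaled_path_joint A])
  have sl: "(\<lambda>\<omega>. (\<omega>, h)) -` ?Q = (\<lambda>\<omega>. scaled_path c (s \<omega>) (h / m)) -` A \<inter> space N" for h
    by (auto simp: space_pair_measure)
  have "(\<lambda>h. emeasure N ((\<lambda>\<omega>. (\<omega>, h)) -` ?Q)) \<in> borel_measurable unit_exponential"
    by (rule P.measurable_emeasure_Pair2[OF Q])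
  then have "(\<lambda>h. emeasure (increment_law c m h) A) \<in> borel_measurable unit_exponential"
    by (simp only: sl emeasure_increment_law[OF A])
  then show "(\<lambda>h. emeasure (increment_law c m h) A) \<in> borel_measurable borel" by simp
  have "emeasure (coupled_law c m) A = emeasure (N \<Otimes>\<^sub>M unit_exponential) ?Q"
    unfolding coupled_law_def by (rule emeasure_distr[OF measurable_scaled_path_joint A])
  also have "\<dots> = (\<integral>\<^sup>+h. emeasure N ((\<lambda>\<omega>. (\<omega>, h)) -` ?Q) \<partial>unit_exponential)"
    by (rule P.emeasure_pair_measure_alt2[OF Q])
  finally show "emeasure (coupled_law c m) A = (\<integral>\<^sup>+h. emeasure (increment_law c m h) A \<partial>unit_exponential)"
    by (simp only: sl emeasure_increment_law[OF A])
qed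

lemma prob_space_coupled_law: "prob_space (coupled_law c m)"
proof -
  interpret E: prob_space unit_exponential by (rule prob_space_exponential_density) simp
  interpret P: pair_prob_space N unit_exponential ..
  show ?thesis unfolding coupled_law_def by (rule P.prob_space_distr[OF measurable_scaled_path_joint])
qed

lemma real_distribution_coupled_law: "real_distribution (coupled_law c m)"
  unfolding real_distribution_def real_distribution_axioms_def
  using prob_space_coupled_law by (simp add: coupled_law_def)

lemma coupled_seq_law:
  assumes m: "0 < m"
  shows "distr (N \<Otimes>\<^sub>M exp_seq) seq_space (coupled_seq c m) = PiM {1..} (\<lambda>_. coupled_law c m)"
proof -
  interpret E: prob_space exp_seq by (rule prob_space_exp_seq)
  interpret P: pair_prob_space N exp_seq ..
  interpret L: product_prob_space "\<lambda>_::nat. coupled_law c m" "{1..}"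
    by (intro product_prob_spaceI prob_space_coupled_law)
  have sL: "sets (PiM {1..} (\<lambda>_::nat. coupled_law c m)) = sets seq_space"
    by (intro sets_PiM_cong) (auto simp: coupled_law_def)
  show ?thesis
  proof (rule L.PiM_eq)
    show "sets (distr (N \<Otimes>\<^sub>M exp_seq) seq_space (coupled_seq c m)) = sets (PiM {1..} (\<lambda>_. coupled_law c m))"
      by (simp only: sets_distr sL)
  next
    fix J :: "nat set" and F :: "nat \<Rightarrow> real set"
    assume J: "finite J" "J \<subseteq> {1..}" and "\<And>j. j \<in> J \<Longrightarrow> F j \<in> sets (coupled_law c m)"
    then have F: "\<And>j. j \<in> J \<Longrightarrow> F j \<in> sets borel" by (simp add: coupled_law_def)
    let ?emb = "prod_emb {1..} (\<lambda>_. coupled_law c m) J (Pi\<^sub>E J F)"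
    have emb: "?emb = prod_emb {1..} (\<lambda>_. borel) J (Pi\<^sub>E J F)"
      by (simp add: prod_emb_def coupled_law_def)
    have embs: "?emb \<in> sets seq_space" unfolding emb using J F by (intro sets_PiM_I) auto
    have "emeasure (distr (N \<Otimes>\<^sub>M exp_seq) seq_space (coupled_seq c m)) ?emb =
        emeasure (N \<Otimes>\<^sub>M exp_seq) (coupled_seq c m -` ?emb \<inter> space (N \<Otimes>\<^sub>M exp_seq))"
      by (rule emeasure_distr[OF measurable_coupled_seq embs])
    also have "\<dots> = (\<integral>\<^sup>+g. emeasure N ((\<lambda>\<omega>. (\<omega>, g)) -` (coupled_seq c m -` ?emb \<inter> space (N \<Otimes>\<^sub>M exp_seq))) \<partial>exp_seq)"
      by (rule P.emeasure_pair_measure_alt2[OF measurable_sets[OF measurable_coupled_seq embs]])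
    also have "\<dots> = (\<integral>\<^sup>+g. (\<Prod>j\<in>J. emeasure (increment_law c m (g j)) (F j)) \<partial>exp_seq)"
    proof (rule nn_integral_cong_AE)
      show "AE g in exp_seq. emeasure N ((\<lambda>\<omega>. (\<omega>, g)) -` (coupled_seq c m -` ?emb \<inter> space (N \<Otimes>\<^sub>M exp_seq))) =
          (\<Prod>j\<in>J. emeasure (increment_law c m (g j)) (F j))"
        using AE_exp_seq AE_space
      proof eventually_elim
        case (elim g)
        have "emeasure N ((\<lambda>\<omega>. (\<omega>, g)) -` (coupled_seq c m -` ?emb \<inter> space (N \<Otimes>\<^sub>M exp_seq))) =
            emeasure N ((\<lambda>\<omega>. coupled_seq c m (\<omega>, g)) -` ?emb \<inter> space N)"
          using elim by (intro arg_cong[where f = "emeasure N"]) (auto simp: space_pair_measure)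
        also have "\<dots> = emeasure (distr N seq_space (\<lambda>\<omega>. coupled_seq c m (\<omega>, g))) ?emb"
          by (rule emeasure_distr[symmetric, OF measurable_coupled_seq_fixed embs])
        also have "\<dots> = emeasure (PiM {1..} (\<lambda>k. increment_law c m (g k))) ?emb"
          using elim by (subst coupled_seq_fixed_law[OF m]) auto
        also have "\<dots> = emeasure (PiM {1..} (\<lambda>k. increment_law c m (g k)))
            (prod_emb {1..} (\<lambda>k. increment_law c m (g k)) J (Pi\<^sub>E J F))"
          by (simp add: prod_emb_def coupled_law_def increment_law_def)
        also have "\<dots> = (\<Prod>j\<in>J. emeasure (increment_law c m (g j)) (F j))"
          using J F by (intro emeasure_PiM_emb)
            (auto simp: increment_law_def intro!: prob_space_distr)
        finally show ?case .
      qed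
    qed
    also have "\<dots> = (\<Prod>j\<in>J. \<integral>\<^sup>+g. emeasure (increment_law c m (g j)) (F j) \<partial>exp_seq)"
    proof (rule E.indep_vars_nn_integral[OF J(1)])
      have "E.indep_vars (\<lambda>_. borel) (\<lambda>k g. g k) J" by (rule E.indep_vars_subset[OF exp_seq_indep J(2)])
      from E.indep_vars_compose2[OF this, where N = "\<lambda>_. borel" and Y = "\<lambda>j h. emeasure (increment_law c m h) (F j)"]
      show "E.indep_vars (\<lambda>_. borel) (\<lambda>j g. emeasure (increment_law c m (g j)) (F j)) J"
        using F measurable_increment_law by auto
    qed simp
    also have "\<dots> = (\<Prod>j\<in>J. emeasure (coupled_law c m) (F j))"
    proof (rule prod.cong[OF refl])
      fix j assume j: "j \<in> J"
      have "(\<integral>\<^sup>+g. emeasure (increment_law c m (g j)) (F j) \<partial>exp_seq) =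
          (\<integral>\<^sup>+h. emeasure (increment_law c m h) (F j) \<partial>distr exp_seq borel (\<lambda>g. g j))"
        using j J measurable_increment_law[OF F[OF j]]
        by (intro nn_integral_distr[symmetric] exp_seq_component) auto
      also have "distr exp_seq borel (\<lambda>g. g j) = unit_exponential" using j J by (intro exp_seq_distr) auto
      finally show "(\<integral>\<^sup>+g. emeasure (increment_law c m (g j)) (F j) \<partial>exp_seq) = emeasure (coupled_law c m) (F j)"
        by (simp only: emeasure_coupled_law[OF F[OF j]])
    qed
    finally show "emeasure (distr (N \<Otimes>\<^sub>M exp_seq) seq_space (coupled_seq c m)) ?emb =
      (\<Prod>j\<in>J. emeasure (coupled_law c m) (F j))" .
  qed
qed

lemma AE_coupled_law: "0 < c \<Longrightarrow> AE x in coupled_law c m. 0 \<le> x"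
  unfolding coupled_law_def
  by (subst AE_distr_iff[OF measurable_scaled_path_joint])
     (auto simp: scaled_path_def path_nonneg)

lemma coupled_law_laplace:
  assumes c: "0 < c" and m: "0 < m" and z: "0 \<le> z"
  shows "(\<integral>x. exp (- z * x) \<partial>coupled_law c m) = 1 / (1 + (z * c) powr a / m)"
proof -
  interpret E: prob_space unit_exponential by (rule prob_space_exponential_density) simp
  interpret P: pair_prob_space N unit_exponential ..
  define q where "q = (z * c) powr a / m"
  have q: "0 \<le> q" using m by (simp add: q_def)
  have inner: "(\<integral>\<^sup>+\<omega>. ennreal (exp (- z * scaled_path c (s \<omega>) (h / m))) \<partial>N) = ennreal (exp (- q * h))"
    if h: "0 \<le> h" for h
  proof -
    have "(\<integral>\<omega>. exp (- z * scaled_path c (s \<omega>) (h / m)) \<partial>N) = (\<integral>\<omega>. exp (- (z * c) * s \<omega> (h / m)) \<partial>N)"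
      using h m by (simp add: scaled_path_def mult.assoc)
    also have "\<dots> = exp (- q * h)"
      using h m z c by (subst laplace) (auto simp: q_def)
    finally have e: "(\<integral>\<omega>. exp (- z * scaled_path c (s \<omega>) (h / m)) \<partial>N) = exp (- q * h)" .
    then have "integrable N (\<lambda>\<omega>. exp (- z * scaled_path c (s \<omega>) (h / m)))"
      using not_integrable_integral_eq by fastforce
    then show ?thesis using e by (subst nn_integral_eq_integral) auto
  qed
  have "(\<integral>x. exp (- z * x) \<partial>coupled_law c m) = enn2real (\<integral>\<^sup>+x. ennreal (exp (- z * x)) \<partial>coupled_law c m)"
    by (rule integral_eq_nn_integral) (auto simp: coupled_law_def)
  also have "(\<integral>\<^sup>+x. ennreal (exp (- z * x)) \<partial>coupled_law c m) =
      (\<integral>\<^sup>+(\<omega>, h). ennreal (exp (- z * scaled_path c (s \<omega>) (h / m))) \<partial>(N \<Otimes>\<^sub>M unit_exponential))"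
    unfolding coupled_law_def
    by (subst nn_integral_distr[OF measurable_scaled_path_joint]) (auto simp: case_prod_beta')
  also have "\<dots> = (\<integral>\<^sup>+h. (\<integral>\<^sup>+\<omega>. ennreal (exp (- z * scaled_path c (s \<omega>) (h / m))) \<partial>N) \<partial>unit_exponential)"
    using measurable_scaled_path_joint[of c m] by (subst P.nn_integral_snd[symmetric]) (auto simp: case_prod_beta)
  also have "\<dots> = (\<integral>\<^sup>+h. ennreal (exp (- q * h)) \<partial>unit_exponential)"
  proof (rule nn_integral_cong_AE)
    have "AE h in unit_exponential. 0 \<le> h"
      by (subst AE_density) (auto simp: exponential_density_def)
    then show "AE h in unit_exponential. (\<integral>\<^sup>+\<omega>. ennreal (exp (- z * scaled_path c (s \<omega>) (h / m))) \<partial>N) = ennreal (exp (- q * h))"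
      by eventually_elim (rule inner)
  qed
  also have "\<dots> = ennreal (1 / (1 + q))" by (rule nn_integral_exponential_exp[OF q])
  finally show ?thesis using q by (simp add: q_def)
qed

text \<open>This is where the Mittag-Leffler law appears as a geometric-stable law: a stable
  subordinator evaluated at an independent exponential time.\<close>

lemma mittag_leffler_law:
  assumes M: "prob_space M" and X: "mittag_leffler_distributed M a l X" and a: "0 < a" and l: "0 < l"
    and C: "0 < C"
  shows "distr M borel (\<lambda>\<omega>. X \<omega> / C) = coupled_law (l powr (- 1 / a)) (C powr a)"
proof -
  interpret M: prob_space M by fact
  have Xm[measurable]: "X \<in> borel_measurable M" and X0: "AE \<omega> in M. 0 \<le> X \<omega>"
    using X by (auto simp: mittag_leffler_distributed_def)
  obtain k0 :: nat where "C * l powr (1 / a) + 1 \<le> real k0" using real_arch_simple by blast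
  then have k0: "C * l powr (1 / a) < real k0" by linarith
  show ?thesis
  proof (rule laplace_unique[where m = k0])
    show "real_distribution (distr M borel (\<lambda>\<omega>. X \<omega> / C))"
      unfolding real_distribution_def real_distribution_axioms_def
      by (auto intro!: M.prob_space_distr)
    show "real_distribution (coupled_law (l powr (- 1 / a)) (C powr a))"
      by (rule real_distribution_coupled_law)
    show "AE x in distr M borel (\<lambda>\<omega>. X \<omega> / C). 0 \<le> x"
      using X0 C by (subst AE_distr_iff) (auto elim!: eventually_mono)
    show "AE x in coupled_law (l powr (- 1 / a)) (C powr a). 0 \<le> x"
      using l by (intro AE_coupled_law) auto
    fix k assume k: "k0 \<le> k"
    have k': "C * l powr (1 / a) < real k" using k k0 by linarith
    then have "l powr (1 / a) < real k / C" using C by (simp add: field_simps)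
    then have "(l powr (1 / a)) powr a < (real k / C) powr a" using a by (intro powr_less_mono2) auto
    then have lz: "l < (real k / C) powr a" using a l by (simp add: powr_powr)
    have k1: "0 < real k" using k' C by (smt (verit) mult_nonneg_nonneg powr_ge_zero)
    have "(\<integral>x. exp (- real k * x) \<partial>distr M borel (\<lambda>\<omega>. X \<omega> / C)) = (\<integral>\<omega>. exp (- (real k / C) * X \<omega>) \<partial>M)"
      by (subst integral_distr) auto
    also have "\<dots> = l / (l + (real k / C) powr a)"
      using k1 C by (intro M.mittag_leffler_laplace[OF X a l _ lz]) auto
    also have "\<dots> = 1 / (1 + (real k * l powr (- 1 / a)) powr a / C powr a)"
    proof -
      have "(l powr (- 1 / a)) powr a = l powr (- 1 / a * a)" by (rule powr_powr)
      also have "\<dots> = 1 / l" using a l by (simp add: powr_minus_divide)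
      finally have e1: "(real k * l powr (- 1 / a)) powr a = real k powr a / l"
        by (simp add: powr_mult)
      have e2: "(real k / C) powr a = real k powr a / C powr a" using C by (simp add: powr_divide)
      have "l / (l + A / D) = 1 / (1 + A / l / D)" if "0 \<le> A" "0 < D" for A D :: real
        using that l by (simp add: field_simps add_pos_nonneg)
      then show ?thesis unfolding e1 e2 using C by simp
    qed
    also have "\<dots> = (\<integral>x. exp (- real k * x) \<partial>coupled_law (l powr (- 1 / a)) (C powr a))"
      using l C k1 by (intro coupled_law_laplace[symmetric]) auto
    finally show "(\<integral>x. exp (- real k * x) \<partial>distr M borel (\<lambda>\<omega>. X \<omega> / C)) =
      (\<integral>x. exp (- real k * x) \<partial>coupled_law (l powr (- 1 / a)) (C powr a))" .
  qed
qed

lemma mittag_leffler_seq_law: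
  assumes M: "prob_space M" and X: "\<And>k. 1 \<le> k \<Longrightarrow> mittag_leffler_distributed M a l (X k)"
    and ind: "prob_space.indep_vars M (\<lambda>_. borel) X {1..}" and a: "0 < a" and l: "0 < l" and C: "0 < C"
  shows "distr M seq_space (\<lambda>\<omega>. \<lambda>k\<in>{1..}. X k \<omega> / C) = PiM {1..} (\<lambda>_. coupled_law (l powr (- 1 / a)) (C powr a))"
proof -
  interpret M: prob_space M by fact
  from M.indep_vars_compose2[OF ind, where N = "\<lambda>_. borel" and Y = "\<lambda>_ x. x / C"]
  have "M.indep_vars (\<lambda>_. borel) (\<lambda>k \<omega>. X k \<omega> / C) {1..}" by simp
  then have "distr M seq_space (\<lambda>\<omega>. \<lambda>k\<in>{1..}. X k \<omega> / C) = PiM {1..} (\<lambda>k. distr M borel (\<lambda>\<omega>. X k \<omega> / C))"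
    by (rule M.indep_vars_iff_distr_eq_PiM'[THEN iffD1, rotated 2])
       (use X in \<open>auto simp: mittag_leffler_distributed_def intro!: borel_measurable_divide\<close>)
  also have "\<dots> = PiM {1..} (\<lambda>_. coupled_law (l powr (- 1 / a)) (C powr a))"
    by (intro PiM_cong refl mittag_leffler_law[OF M X a l C]) auto
  finally show ?thesis .
qed

end

subsection \<open>Two independent subordinators\<close>

lemma (in prob_space) indep_var_AE_cong:
  assumes ind: "indep_var S X T Y" and X': "random_variable S X'" and Y': "random_variable T Y'"
    and eq: "AE \<omega> in M. X \<omega> = X' \<omega>" "AE \<omega> in M. Y \<omega> = Y' \<omega>"
  shows "indep_var S X' T Y'"
proof -
  have XY: "random_variable S X" "random_variable T Y" using ind by (auto simp: indep_var_distribution_eq)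
  have "distr M S X' = distr M S X"
    using eq(1) X' XY(1) by (intro distr_cong_AE) (auto elim!: eventually_mono)
  moreover have "distr M T Y' = distr M T Y"
    using eq(2) Y' XY(2) by (intro distr_cong_AE) (auto elim!: eventually_mono)
  moreover have "AE \<omega> in M. (X \<omega>, Y \<omega>) = (X' \<omega>, Y' \<omega>)" using eq by eventually_elim simp
  then have "distr M (S \<Otimes>\<^sub>M T) (\<lambda>\<omega>. (X \<omega>, Y \<omega>)) = distr M (S \<Otimes>\<^sub>M T) (\<lambda>\<omega>. (X' \<omega>, Y' \<omega>))"
    using X' Y' XY by (intro distr_cong_AE) auto
  ultimately show ?thesis using ind X' Y' by (simp add: indep_var_distribution_eq)
qed

lemma (in sigma_finite_measure) AE_pair_fst_snd:
  shows AE_pair_fst: "(AE x in N. P x) \<Longrightarrow> AE z in N \<Otimes>\<^sub>M M. P (fst z)"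
    and AE_pair_snd: "(AE y in M. R y) \<Longrightarrow> AE z in N \<Otimes>\<^sub>M M. R (snd z)"
proof -
  assume "AE x in N. P x"
  then obtain Z where Z: "{x \<in> space N. \<not> P x} \<subseteq> Z" "emeasure N Z = 0" "Z \<in> sets N" by (rule AE_E)
  have "emeasure (N \<Otimes>\<^sub>M M) (Z \<times> space M) = 0" using Z by (simp add: emeasure_pair_measure_Times)
  then show "AE z in N \<Otimes>\<^sub>M M. P (fst z)"
    using Z by (intro AE_I[of _ _ "Z \<times> space M"]) (auto simp: space_pair_measure)
next
  assume "AE y in M. R y"
  then obtain Z where Z: "{y \<in> space M. \<not> R y} \<subseteq> Z" "emeasure M Z = 0" "Z \<in> sets M" by (rule AE_E)
  have "emeasure (N \<Otimes>\<^sub>M M) (space N \<times> Z) = 0" using Z by (simp add: emeasure_pair_measure_Times)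
  then show "AE z in N \<Otimes>\<^sub>M M. R (snd z)"
    using Z by (intro AE_I[of _ _ "space N \<times> Z"]) (auto simp: space_pair_measure)
qed

locale subordinator_pair = A: subordinator N a s + D: subordinator N b r
  for N :: "'b measure" and a b :: real and s r :: "'b \<Rightarrow> real \<Rightarrow> real" +
  assumes indep: "\<And>u v :: nat \<Rightarrow> real. (\<And>k. 0 \<le> u k) \<Longrightarrow> (\<And>k. 0 \<le> v k) \<Longrightarrow>
    A.indep_var (PiM UNIV (\<lambda>_. borel)) (\<lambda>\<omega> k. s \<omega> (u k)) (PiM UNIV (\<lambda>_. borel)) (\<lambda>\<omega> k. r \<omega> (v k))"
begin

definition coupling_space :: "('b \<times> (nat \<Rightarrow> real) \<times> (nat \<Rightarrow> real)) measure" where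
  "coupling_space = N \<Otimes>\<^sub>M (exp_seq \<Otimes>\<^sub>M exp_seq)"

definition coupled_pair :: "real \<Rightarrow> real \<Rightarrow> real \<Rightarrow> real \<Rightarrow> 'b \<times> (nat \<Rightarrow> real) \<times> (nat \<Rightarrow> real) \<Rightarrow> (nat \<Rightarrow> real) \<times> (nat \<Rightarrow> real)" where
  "coupled_pair c m c' m' = (\<lambda>(\<omega>, g, h). (A.coupled_seq c m (\<omega>, g), D.coupled_seq c' m' (\<omega>, h)))"

lemma prob_space_coupling_space: "prob_space coupling_space"
proof -
  interpret E: prob_space exp_seq by (rule prob_space_exp_seq)
  interpret EE: pair_prob_space exp_seq exp_seq ..
  interpret P: pair_prob_space N "exp_seq \<Otimes>\<^sub>M exp_seq" ..
  show ?thesis unfolding coupling_space_def by (rule P.prob_space_axioms)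
qed

lemma measurable_coupled_pair: "coupled_pair c m c' m' \<in> measurable coupling_space (seq_space \<Otimes>\<^sub>M seq_space)"
  unfolding coupled_pair_def coupling_space_def case_prod_beta
  by (intro measurable_Pair measurable_compose[OF _ A.measurable_coupled_seq] measurable_compose[OF _ D.measurable_coupled_seq]
      measurable_fst measurable_compose[OF measurable_snd measurable_fst] measurable_compose[OF measurable_snd measurable_snd])

lemma sigma_finite_exp_seq_pair: "sigma_finite_measure (exp_seq \<Otimes>\<^sub>M exp_seq)"
proof -
  interpret E: prob_space exp_seq by (rule prob_space_exp_seq)
  interpret EE: pair_prob_space exp_seq exp_seq ..
  show ?thesis by (rule EE.sigma_finite_measure_axioms)
qed

lemma AE_coupling_space_fst: "(AE \<omega> in N. P \<omega>) \<Longrightarrow> AE x in coupling_space. P (fst x)"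
  unfolding coupling_space_def
  by (rule sigma_finite_measure.AE_pair_fst[OF sigma_finite_exp_seq_pair])

lemma AE_exp_seq_pair:
  assumes P: "AE g in exp_seq. P g"
  shows "AE y in exp_seq \<Otimes>\<^sub>M exp_seq. P (fst y) \<and> P (snd y)"
proof -
  interpret E: prob_space exp_seq by (rule prob_space_exp_seq)
  show ?thesis using E.AE_pair_fst[OF P] E.AE_pair_snd[OF P] by eventually_elim simp
qed

lemma AE_coupling_space_snd:
  "(AE g in exp_seq. P g) \<Longrightarrow> AE x in coupling_space. P (fst (snd x)) \<and> P (snd (snd x))"
  unfolding coupling_space_def
  by (rule sigma_finite_measure.AE_pair_snd[OF sigma_finite_exp_seq_pair AE_exp_seq_pair])

lemma indep_coupled_seq:
  assumes m: "0 < m" "0 < m'" and g: "arrival_seq g" and h: "arrival_seq h"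
  shows "A.indep_var seq_space (\<lambda>\<omega>. A.coupled_seq c m (\<omega>, g)) seq_space (\<lambda>\<omega>. D.coupled_seq c' m' (\<omega>, h))"
proof -
  define u where "u k = partial_sum g k / m" for k
  define v where "v k = partial_sum h k / m'" for k
  have u0: "0 \<le> u k" and v0: "0 \<le> v k" for k
    using m partial_sum_nonneg[OF g] partial_sum_nonneg[OF h] by (auto simp: u_def v_def)
  define F where "F c x = (\<lambda>k\<in>{1..}. c * (x k - x (k - 1)))" for c and x :: "nat \<Rightarrow> real"
  have F: "F c \<in> measurable (PiM UNIV (\<lambda>_. borel)) seq_space" for c
    unfolding F_def by measurable
  have "A.coupled_seq c m (\<omega>, g) = F c (\<lambda>k. s \<omega> (u k))" for \<omega>
    using u0 by (auto simp: A.coupled_seq_def F_def sampled_def scaled_path_def u_def fun_eq_iff right_diff_distrib restrict_def)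
  moreover have "D.coupled_seq c' m' (\<omega>, h) = F c' (\<lambda>k. r \<omega> (v k))" for \<omega>
    using v0 by (auto simp: D.coupled_seq_def F_def sampled_def scaled_path_def v_def fun_eq_iff right_diff_distrib restrict_def)
  ultimately show ?thesis
    using A.indep_var_compose[OF indep[of u v, OF u0 v0] F F] by (simp add: comp_def)
qed

lemma coupled_pair_law:
  assumes m: "0 < m" "0 < m'"
  shows "distr coupling_space (seq_space \<Otimes>\<^sub>M seq_space) (coupled_pair c m c' m') =
    PiM {1..} (\<lambda>_. A.coupled_law c m) \<Otimes>\<^sub>M PiM {1..} (\<lambda>_. D.coupled_law c' m')"
proof (rule pair_measure_eqI[symmetric])
  interpret E: prob_space exp_seq by (rule prob_space_exp_seq)
  interpret EE: pair_prob_space exp_seq exp_seq ..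
  interpret P: pair_prob_space N "exp_seq \<Otimes>\<^sub>M exp_seq" ..
  interpret NE: pair_prob_space N exp_seq ..
  let ?LA = "PiM {1..} (\<lambda>_::nat. A.coupled_law c m)" and ?LD = "PiM {1..} (\<lambda>_::nat. D.coupled_law c' m')"
  show "sigma_finite_measure ?LA" "sigma_finite_measure ?LD"
    by (intro prob_space_imp_sigma_finite prob_space_PiM A.prob_space_coupled_law D.prob_space_coupled_law)+
  have sLA: "sets ?LA = sets seq_space" and sLD: "sets ?LD = sets seq_space"
    by (auto intro!: sets_PiM_cong simp: A.coupled_law_def D.coupled_law_def)
  show "sets (?LA \<Otimes>\<^sub>M ?LD) = sets (distr coupling_space (seq_space \<Otimes>\<^sub>M seq_space) (coupled_pair c m c' m'))"
    by (simp only: sets_distr) (intro sets_pair_measure_cong sLA sLD)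
  fix A B assume "A \<in> sets ?LA" "B \<in> sets ?LD"
  then have A: "A \<in> sets seq_space" and B: "B \<in> sets seq_space" by (simp_all only: sLA sLD)
  let ?WA = "A.coupled_seq c m" and ?WD = "D.coupled_seq c' m'"
  have QA: "?WA -` A \<inter> space (N \<Otimes>\<^sub>M exp_seq) \<in> sets (N \<Otimes>\<^sub>M exp_seq)"
    by (rule measurable_sets[OF A.measurable_coupled_seq A])
  have QD: "?WD -` B \<inter> space (N \<Otimes>\<^sub>M exp_seq) \<in> sets (N \<Otimes>\<^sub>M exp_seq)"
    by (rule measurable_sets[OF D.measurable_coupled_seq B])
  define pA where "pA g = emeasure N ((\<lambda>\<omega>. (\<omega>, g)) -` (?WA -` A \<inter> space (N \<Otimes>\<^sub>M exp_seq)))" for g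
  define pD where "pD h = emeasure N ((\<lambda>\<omega>. (\<omega>, h)) -` (?WD -` B \<inter> space (N \<Otimes>\<^sub>M exp_seq)))" for h
  have pAm: "pA \<in> borel_measurable exp_seq" unfolding pA_def by (rule NE.measurable_emeasure_Pair2[OF QA])
  have pDm: "pD \<in> borel_measurable exp_seq" unfolding pD_def by (rule NE.measurable_emeasure_Pair2[OF QD])
  have LA: "emeasure ?LA A = (\<integral>\<^sup>+g. pA g \<partial>exp_seq)"
    unfolding A.coupled_seq_law[OF m(1), symmetric] pA_def
    by (subst emeasure_distr[OF A.measurable_coupled_seq A]) (rule NE.emeasure_pair_measure_alt2[OF QA])
  have LD: "emeasure ?LD B = (\<integral>\<^sup>+h. pD h \<partial>exp_seq)"
    unfolding D.coupled_seq_law[OF m(2), symmetric] pD_def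
    by (subst emeasure_distr[OF D.measurable_coupled_seq B]) (rule NE.emeasure_pair_measure_alt2[OF QD])
  have AB: "A \<times> B \<in> sets (seq_space \<Otimes>\<^sub>M seq_space)" using A B by auto
  have QAB: "coupled_pair c m c' m' -` (A \<times> B) \<inter> space coupling_space \<in> sets (N \<Otimes>\<^sub>M (exp_seq \<Otimes>\<^sub>M exp_seq))"
    using measurable_sets[OF measurable_coupled_pair AB] by (simp add: coupling_space_def)
  have "emeasure (distr coupling_space (seq_space \<Otimes>\<^sub>M seq_space) (coupled_pair c m c' m')) (A \<times> B) =
      emeasure (N \<Otimes>\<^sub>M (exp_seq \<Otimes>\<^sub>M exp_seq)) (coupled_pair c m c' m' -` (A \<times> B) \<inter> space coupling_space)"
    by (subst emeasure_distr[OF measurable_coupled_pair AB]) (simp add: coupling_space_def)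
  also have "\<dots> = (\<integral>\<^sup>+y. emeasure N ((\<lambda>\<omega>. (\<omega>, y)) -` (coupled_pair c m c' m' -` (A \<times> B) \<inter> space coupling_space)) \<partial>(exp_seq \<Otimes>\<^sub>M exp_seq))"
    by (rule P.emeasure_pair_measure_alt2[OF QAB])
  also have "\<dots> = (\<integral>\<^sup>+y. pA (fst y) * pD (snd y) \<partial>(exp_seq \<Otimes>\<^sub>M exp_seq))"
  proof (rule nn_integral_cong_AE)
    have "AE y in exp_seq \<Otimes>\<^sub>M exp_seq. arrival_seq (fst y) \<and> arrival_seq (snd y)"
      using AE_exp_seq by (intro AE_exp_seq_pair) (auto elim!: eventually_mono)
    then show "AE y in exp_seq \<Otimes>\<^sub>M exp_seq.
      emeasure N ((\<lambda>\<omega>. (\<omega>, y)) -` (coupled_pair c m c' m' -` (A \<times> B) \<inter> space coupling_space)) = pA (fst y) * pD (snd y)"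
      using AE_space
    proof eventually_elim
      case (elim y)
      obtain g h where y: "y = (g, h)" by fastforce
      have gh: "arrival_seq g" "arrival_seq h" "g \<in> space exp_seq" "h \<in> space exp_seq"
        using elim by (auto simp: y space_pair_measure)
      have e1: "(\<lambda>\<omega>. (\<omega>, y)) -` (coupled_pair c m c' m' -` (A \<times> B) \<inter> space coupling_space) =
          (\<lambda>\<omega>. (?WA (\<omega>, g), ?WD (\<omega>, h))) -` (A \<times> B) \<inter> space N"
        using gh by (auto simp: y coupled_pair_def coupling_space_def space_pair_measure)
      have e2: "(\<lambda>\<omega>. (\<omega>, g)) -` (?WA -` A \<inter> space (N \<Otimes>\<^sub>M exp_seq)) = (\<lambda>\<omega>. ?WA (\<omega>, g)) -` A \<inter> space N"
        and e3: "(\<lambda>\<omega>. (\<omega>, h)) -` (?WD -` B \<inter> space (N \<Otimes>\<^sub>M exp_seq)) = (\<lambda>\<omega>. ?WD (\<omega>, h)) -` B \<inter> space N"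
        using gh by (auto simp: space_pair_measure)
      have "A.prob ((\<lambda>\<omega>. (?WA (\<omega>, g), ?WD (\<omega>, h))) -` (A \<times> B) \<inter> space N) =
          A.prob ((\<lambda>\<omega>. ?WA (\<omega>, g)) -` A \<inter> space N) * A.prob ((\<lambda>\<omega>. ?WD (\<omega>, h)) -` B \<inter> space N)"
        by (rule A.indep_varD[OF indep_coupled_seq[OF m gh(1,2)] A B])
      then show ?case unfolding e1 unfolding pA_def pD_def y fst_conv snd_conv e2 e3
        by (simp add: A.emeasure_eq_measure ennreal_mult)
    qed
  qed
  also have "\<dots> = (\<integral>\<^sup>+g. \<integral>\<^sup>+h. pA g * pD h \<partial>exp_seq \<partial>exp_seq)"
    using pAm pDm by (subst E.nn_integral_fst[symmetric]) auto
  also have "\<dots> = (\<integral>\<^sup>+g. pA g * (\<integral>\<^sup>+h. pD h \<partial>exp_seq) \<partial>exp_seq)"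
    using pDm by (intro nn_integral_cong nn_integral_cmult)
  also have "\<dots> = emeasure ?LA A * emeasure ?LD B"
    unfolding LA LD using pAm by (rule nn_integral_multc)
  finally show "emeasure ?LA A * emeasure ?LD B =
      emeasure (distr coupling_space (seq_space \<Otimes>\<^sub>M seq_space) (coupled_pair c m c' m')) (A \<times> B)" by simp
qed

end

lemma left_jump:
  assumes f: "subordinator_path f" and w: "0 < w" and jump: "\<not> (f \<longlongrightarrow> f w) (at_left w)"
  obtains e where "0 < e" "\<And>v. 0 \<le> v \<Longrightarrow> v < w \<Longrightarrow> e < f w - f v"
proof -
  have "\<exists>e>0. \<forall>v. 0 \<le> v \<longrightarrow> v < w \<longrightarrow> e < f w - f v"
  proof (rule ccontr)
    assume "\<not> ?thesis"
    then have *: "\<exists>v. 0 \<le> v \<and> v < w \<and> f w - f v \<le> e" if "0 < e" for e using that by (force simp: not_less)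
    have "(f \<longlongrightarrow> f w) (at_left w)"
    proof (rule tendstoI)
      fix e :: real assume "0 < e"
      then obtain v where v: "0 \<le> v" "v < w" "f w - f v \<le> e / 2" using *[of "e / 2"] by auto
      have "eventually (\<lambda>u. u \<in> {v<..<w}) (at_left w)" by (rule eventually_at_left_real) fact
      then show "eventually (\<lambda>u. dist (f u) (f w) < e) (at_left w)"
      proof eventually_elim
        case (elim u)
        then have "f v < f u" "f u < f w" using v w by (auto simp: subordinator_path_less_iff[OF f])
        then show ?case using v \<open>0 < e\<close> by (simp add: dist_real_def)
      qed
    qed
    with jump show False by simp
  qed
  with that show ?thesis by blast
qed

context subordinator_pair
begin

text \<open>A common jump exceeding \<open>e\<close> before time \<open>K\<close> shows up in some cell of the grid of mesh \<open>1 / n\<close>.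
  Each of the \<open>K n\<close> cells has probability \<open>O(n\<^sup>-\<^sup>2)\<close> by independence.\<close>

lemma grid_jump_prob:
  assumes e: "0 < e" and n: "0 < n"
  shows "A.prob {\<omega> \<in> space N. \<exists>i<K * n. e < s \<omega> (real i / real n + 1 / real n) - s \<omega> (real i / real n) \<and>
      e < r \<omega> (real i / real n + 1 / real n) - r \<omega> (real i / real n)}
    \<le> real K / (1 - exp (- e)) ^ 2 / real n"
proof -
  define t where "t i = real i / real n" for i
  define h where "h = 1 / real n"
  have t0: "0 \<le> t i" for i by (simp add: t_def)
  have h0: "0 \<le> h" by (simp add: h_def)
  define X where "X i = {\<omega> \<in> space N. e < s \<omega> (t i + h) - s \<omega> (t i)}" for i
  define Y where "Y i = {\<omega> \<in> space N. e < r \<omega> (t i + h) - r \<omega> (t i)}" for i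
  define q where "q = h / (1 - exp (- e))"
  have sm: "(\<lambda>\<omega>. s \<omega> (t i + h) - s \<omega> (t i)) \<in> borel_measurable N" for i
    by (intro borel_measurable_diff A.meas add_nonneg_nonneg t0 h0)
  have rm: "(\<lambda>\<omega>. r \<omega> (t i + h) - r \<omega> (t i)) \<in> borel_measurable N" for i
    by (intro borel_measurable_diff D.meas add_nonneg_nonneg t0 h0)
  have XY: "X i \<in> A.events" "Y i \<in> A.events" for i
    using sm[of i] rm[of i] by (auto simp: X_def Y_def)
  have pX: "A.prob (X i) \<le> q" "A.prob (Y i) \<le> q" for i
    using A.prob_gt_le[OF e h0] D.prob_gt_le[OF e h0] A.prob_increment[OF t0 h0] D.prob_increment[OF t0 h0]
    by (simp_all add: X_def Y_def q_def)
  have pXY: "A.prob (X i \<inter> Y i) \<le> q ^ 2" for i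
  proof -
    define u where "u k = (if k = 0 then t i + h else t i)" for k :: nat
    have u0: "0 \<le> u k" for k using t0[of i] h0 by (simp add: u_def)
    define E where "E = {x \<in> space (PiM (UNIV :: nat set) (\<lambda>_. borel)). e < x 0 - x (1::nat)}"
    have E: "E \<in> sets (PiM (UNIV :: nat set) (\<lambda>_. borel :: real measure))" unfolding E_def by measurable
    have "(\<lambda>\<omega>. (\<lambda>k. s \<omega> (u k), \<lambda>k. r \<omega> (u k))) -` (E \<times> E) \<inter> space N = X i \<inter> Y i"
      "(\<lambda>\<omega> k. s \<omega> (u k)) -` E \<inter> space N = X i" "(\<lambda>\<omega> k. r \<omega> (u k)) -` E \<inter> space N = Y i"
      by (auto simp: E_def X_def Y_def u_def space_PiM)
    then have "A.prob (X i \<inter> Y i) = A.prob (X i) * A.prob (Y i)"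
      using A.indep_varD[OF indep[of u u, OF u0 u0] E E] by simp
    also have "\<dots> \<le> q * q" using pX[of i] by (intro mult_mono) (auto intro: order_trans[OF measure_nonneg])
    finally show ?thesis by (simp add: power2_eq_square)
  qed
  have "{\<omega> \<in> space N. \<exists>i<K * n. e < s \<omega> (t i + h) - s \<omega> (t i) \<and> e < r \<omega> (t i + h) - r \<omega> (t i)} =
      (\<Union>i\<in>{..<K * n}. X i \<inter> Y i)"
    by (auto simp: X_def Y_def)
  moreover have "A.prob (\<Union>i\<in>{..<K * n}. X i \<inter> Y i) \<le> (\<Sum>i<K * n. A.prob (X i \<inter> Y i))"
    using XY by (intro A.finite_measure_subadditive_finite) auto
  moreover have "\<dots> \<le> (\<Sum>i<K * n. q ^ 2)" by (intro sum_mono pXY)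
  moreover have "\<dots> = real K / (1 - exp (- e)) ^ 2 / real n"
  proof -
    have "real (K * n) * (1 / real n / d) ^ 2 = real K / d ^ 2 / real n" for d :: real
      using n by (cases "d = 0") (simp_all add: power2_eq_square field_simps)
    then show ?thesis by (simp add: q_def h_def)
  qed
  ultimately show ?thesis unfolding t_def h_def by simp
qed

lemma AE_no_common_jump:
  "AE \<omega> in N. \<forall>w>0. (s \<omega> \<longlongrightarrow> s \<omega> w) (at_left w) \<or> (r \<omega> \<longlongrightarrow> r \<omega> w) (at_left w)"
proof -
  define Z where "Z K e n = {\<omega> \<in> space N. \<exists>i<K * n. e < s \<omega> (real i / real n + 1 / real n) - s \<omega> (real i / real n) \<and>
      e < r \<omega> (real i / real n + 1 / real n) - r \<omega> (real i / real n)}" for K n :: nat and e :: real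
  have Zm: "Z K e n \<in> A.events" for K e n
  proof -
    have "Z K e n = (\<Union>i\<in>{..<K * n}. {\<omega> \<in> space N. e < s \<omega> (real i / real n + 1 / real n) - s \<omega> (real i / real n)} \<inter>
      {\<omega> \<in> space N. e < r \<omega> (real i / real n + 1 / real n) - r \<omega> (real i / real n)})"
      by (auto simp: Z_def)
    moreover have "(\<lambda>\<omega>. s \<omega> (real i / real n + 1 / real n) - s \<omega> (real i / real n)) \<in> borel_measurable N"
      "(\<lambda>\<omega>. r \<omega> (real i / real n + 1 / real n) - r \<omega> (real i / real n)) \<in> borel_measurable N" for i
      by (intro borel_measurable_diff A.meas D.meas; simp)+
    ultimately show ?thesis by auto
  qed
  have AE: "AE \<omega> in N. \<exists>n>0. \<omega> \<notin> Z K e n" if e: "0 < e" for K e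
  proof -
    have "(\<lambda>n. real K / (1 - exp (- e)) ^ 2 / real n) \<longlonglongrightarrow> 0"
      by (intro tendsto_divide_0[OF tendsto_const] filterlim_at_top_imp_at_infinity filterlim_real_sequentially)
    moreover have "A.prob (\<Inter>n\<in>{0<..}. Z K e n) \<le> real K / (1 - exp (- e)) ^ 2 / real n" if "0 < n" for n
    proof -
      have "A.prob (\<Inter>n\<in>{0<..}. Z K e n) \<le> A.prob (Z K e n)"
        using that by (intro A.finite_measure_mono Zm) auto
      also have "\<dots> \<le> real K / (1 - exp (- e)) ^ 2 / real n"
        unfolding Z_def by (rule grid_jump_prob[OF e that])
      finally show ?thesis .
    qed
    ultimately have "A.prob (\<Inter>n\<in>{0<..}. Z K e n) \<le> 0"
      by (intro tendsto_lowerbound[of _ 0 sequentially]) (auto intro!: eventually_sequentiallyI[of 1])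
    then have p0: "A.prob (\<Inter>n\<in>{0<..}. Z K e n) = 0" by (simp add: measure_le_0_iff)
    have "(\<Inter>n\<in>{0<..}. Z K e n) \<in> A.events" by (intro sets.countable_INT') (auto intro: Zm)
    then show ?thesis using p0 by (subst (asm) A.prob_eq_0) (auto elim!: eventually_mono)
  qed
  have "AE \<omega> in N. \<forall>K j. \<exists>n>0. \<omega> \<notin> Z K (inverse (real (Suc j))) n"
    by (intro AE_all_countable[THEN iffD2] allI AE) simp
  then show ?thesis using AE_space
  proof eventually_elim
    case (elim \<omega>)
    show ?case
    proof (intro allI impI, rule ccontr)
      fix w :: real assume w: "0 < w"
        and neg: "\<not> ((s \<omega> \<longlongrightarrow> s \<omega> w) (at_left w) \<or> (r \<omega> \<longlongrightarrow> r \<omega> w) (at_left w))"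
      obtain e1 where e1: "0 < e1" "\<And>v. 0 \<le> v \<Longrightarrow> v < w \<Longrightarrow> e1 < s \<omega> w - s \<omega> v"
        using left_jump[OF A.path w] neg by blast
      obtain e2 where e2: "0 < e2" "\<And>v. 0 \<le> v \<Longrightarrow> v < w \<Longrightarrow> e2 < r \<omega> w - r \<omega> v"
        using left_jump[OF D.path w] neg by blast
      obtain j where j: "inverse (real (Suc j)) < min e1 e2"
        using reals_Archimedean[of "min e1 e2"] e1 e2 by auto
      obtain K :: nat where K: "w \<le> real K" using real_arch_simple by blast
      obtain n where n: "0 < n" "\<omega> \<notin> Z K (inverse (real (Suc j))) n" using elim by blast
      define i where "i = nat (\<lceil>w * real n\<rceil> - 1)"
      have wn: "0 < w * real n" using w n by simp
      then have "real i = real_of_int \<lceil>w * real n\<rceil> - 1" by (simp add: i_def)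
      then have i: "real i < w * real n" "w * real n \<le> real i + 1" by linarith+
      have v: "real i / real n < w" "w \<le> real i / real n + 1 / real n" "0 \<le> real i / real n"
        using i n by (auto simp: field_simps)
      have "real i < real K * real n" using i(1) K n by (meson less_le_trans mult_right_mono of_nat_0_le_iff)
      then have iK: "i < K * n" by (metis of_nat_less_iff of_nat_mult)
      have "s \<omega> w \<le> s \<omega> (real i / real n + 1 / real n)" "r \<omega> w \<le> r \<omega> (real i / real n + 1 / real n)"
        using v w by (auto simp: subordinator_path_le_iff[OF A.path] subordinator_path_le_iff[OF D.path])
      then have "inverse (real (Suc j)) < s \<omega> (real i / real n + 1 / real n) - s \<omega> (real i / real n)"
        "inverse (real (Suc j)) < r \<omega> (real i / real n + 1 / real n) - r \<omega> (real i / real n)"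
        using e1(2)[OF v(3,1)] e2(2)[OF v(3,1)] j by linarith+
      then have "\<omega> \<in> Z K (inverse (real (Suc j))) n" using iK elim by (auto simp: Z_def)
      with n show False by simp
    qed
  qed
qed

end

subsection \<open>Measurability of the queue length process\<close>

lemma measurable_path_algebraI:
  assumes "\<And>x. x \<in> space M \<Longrightarrow> f x \<in> cadlag"
    and "\<And>t. 0 \<le> t \<Longrightarrow> (\<lambda>x. f x t) \<in> borel_measurable M"
  shows "f \<in> measurable M path_algebra"
  unfolding path_algebra_def
proof (rule measurable_measure_of)
  fix Y assume "Y \<in> {{f \<in> cadlag. f t \<in> A} |t A. 0 \<le> t \<and> A \<in> sets borel}"
  then obtain t and A :: "real set" where Y: "Y = {f \<in> cadlag. f t \<in> A}" "0 \<le> t" "A \<in> sets borel" by blast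
  have "f -` Y \<inter> space M = (\<lambda>x. f x t) -` A \<inter> space M" using assms(1) Y(1) by auto
  then show "f -` Y \<inter> space M \<in> sets M" using measurable_sets[OF assms(2)[OF Y(2)] Y(3)] by simp
qed (use assms(1) in auto)

lemma space_path_algebra: "space path_algebra = cadlag"
  unfolding path_algebra_def by (rule space_measure_of) auto

lemma path_functional_cong:
  assumes F: "F \<in> borel_measurable path_algebra" and fg: "f \<in> cadlag" "g \<in> cadlag"
    and eq: "\<And>t. 0 \<le> t \<Longrightarrow> f t = g t"
  shows "F f = (F g :: real)"
proof -
  have sat: "f \<in> A \<longleftrightarrow> g \<in> A"
    if "A \<in> sigma_sets cadlag {{f \<in> cadlag. f t \<in> A} | t A. 0 \<le> t \<and> A \<in> sets (borel :: real measure)}" for A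
    using that by induction (use fg eq in auto)
  have "F -` {F f} \<inter> space path_algebra \<in> sets path_algebra" by (rule measurable_sets[OF F]) simp
  then have "F -` {F f} \<inter> cadlag \<in> sigma_sets cadlag {{f \<in> cadlag. f t \<in> A} | t A. 0 \<le> t \<and> A \<in> sets (borel :: real measure)}"
    unfolding space_path_algebra unfolding path_algebra_def by (subst (asm) sets_measure_of) auto
  from sat[OF this] fg show ?thesis by auto
qed

lemma seq_topology_continuous:
  assumes F: "continuous_map (seq_topology conv) euclideanreal F"
    and x: "range x \<subseteq> cadlag" "f \<in> cadlag" "conv x f"
  shows "(\<lambda>n. F (x n)) \<longlonglongrightarrow> F f"
proof (rule tendstoI)
  fix e :: real assume e: "0 < e"
  have "openin (seq_topology conv) {y \<in> topspace (seq_topology conv). F y \<in> ball (F f) e}"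
    by (rule openin_continuous_map_preimage[OF F]) simp
  then have "seq_open conv {y \<in> cadlag. F y \<in> ball (F f) e}"
    by (simp add: openin_seq_topology topspace_seq_topology)
  then have "eventually (\<lambda>n. x n \<in> {y \<in> cadlag. F y \<in> ball (F f) e}) sequentially"
    using x e unfolding seq_open_def by (metis (mono_tags, lifting) centre_in_ball mem_Collect_eq)
  then show "eventually (\<lambda>n. dist (F (x n)) (F f) < e) sequentially"
    by eventually_elim (auto simp: dist_commute)
qed

lemma measurable_regulator:
  assumes nn: "\<And>z s. z \<in> space M \<Longrightarrow> 0 \<le> s \<Longrightarrow> 0 \<le> C z s"
    and rc: "\<And>z s. z \<in> space M \<Longrightarrow> 0 \<le> s \<Longrightarrow> (C z \<longlongrightarrow> C z s) (at_right s)"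
    and m: "\<And>s. 0 \<le> s \<Longrightarrow> (\<lambda>z. C z s) \<in> borel_measurable M" and t: "0 \<le> t"
  shows "(\<lambda>z. skorokhod_regulator (\<lambda>s. C z s - s) t) \<in> borel_measurable M"
proof (rule borel_measurableI_le)
  fix y :: real
  define D where "D = insert t (\<rat> \<inter> {0..t})"
  have D: "countable D" "\<And>q. q \<in> D \<Longrightarrow> 0 \<le> q" "\<And>q. q \<in> D \<Longrightarrow> q \<le> t"
    using t countable_rat by (auto simp: D_def)
  show "{z \<in> space M. skorokhod_regulator (\<lambda>s. C z s - s) t \<le> y} \<in> sets M"
  proof (cases "0 \<le> y")
    case False
    have "\<not> skorokhod_regulator (\<lambda>s. C z s - s) t \<le> y" if "z \<in> space M" for z
      using regulator_nonneg[of "C z" t] nn that t False by fastforce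
    then have "{z \<in> space M. skorokhod_regulator (\<lambda>s. C z s - s) t \<le> y} = {}" by auto
    then show ?thesis by (simp only: sets.empty_sets)
  next
    case y: True
    have "skorokhod_regulator (\<lambda>s. C z s - s) t \<le> y \<longleftrightarrow> (\<forall>q\<in>D. q - C z q \<le> y)" if z: "z \<in> space M" for z
    proof
      assume "skorokhod_regulator (\<lambda>s. C z s - s) t \<le> y"
      then show "\<forall>q\<in>D. q - C z q \<le> y"
        using regulator_ge[of "C z" _ t] nn[OF z] D by (meson order_trans)
    next
      assume q: "\<forall>q\<in>D. q - C z q \<le> y"
      show "skorokhod_regulator (\<lambda>s. C z s - s) t \<le> y"
      proof (rule regulator_le[where C = "C z"])
        fix s assume s: "0 \<le> s" "s \<le> t"
        show "s - C z s \<le> y"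
        proof (rule ccontr)
          assume neg: "\<not> s - C z s \<le> y"
          then have "s \<noteq> t" using q by (auto simp: D_def)
          then have st: "s < t" using s by simp
          have "((\<lambda>u. u - C z u) \<longlongrightarrow> s - C z s) (at_right s)" by (intro tendsto_intros rc z s)
          then have "eventually (\<lambda>u. y < u - C z u) (at_right s)" by (rule order_tendstoD) (use neg in simp)
          then obtain b where b: "s < b" "\<And>u. s < u \<Longrightarrow> u < b \<Longrightarrow> y < u - C z u"
            unfolding eventually_at_right_field by blast
          obtain p where p: "p \<in> \<rat>" "s < p" "p < min b t" using Rats_dense_in_real[of s "min b t"] b st by auto
          then have "p \<in> D" using s by (auto simp: D_def)
          then show False using q b(2)[of p] p by fastforce
        qed
      qed (use nn z t y in auto)
    qed
    then have "{z \<in> space M. skorokhod_regulator (\<lambda>s. C z s - s) t \<le> y} = {z \<in> space M. \<forall>q\<in>D. q - C z q \<le> y}" by auto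
    also have "\<dots> \<in> sets M"
    proof (rule sets.sets_Collect_countable_All'[OF _ D(1)])
      fix q assume "q \<in> D"
      then have "(\<lambda>z. C z q) \<in> borel_measurable M" using D m by auto
      then show "{z \<in> space M. q - C z q \<le> y} \<in> sets M" by measurable
    qed
    finally show ?thesis .
  qed
qed

lemma measurable_busy:
  assumes "\<And>z s. z \<in> space M \<Longrightarrow> 0 \<le> s \<Longrightarrow> 0 \<le> C z s"
    and "\<And>z s. z \<in> space M \<Longrightarrow> 0 \<le> s \<Longrightarrow> (C z \<longlongrightarrow> C z s) (at_right s)"
    and "\<And>s. 0 \<le> s \<Longrightarrow> (\<lambda>z. C z s) \<in> borel_measurable M" and "0 \<le> t"
  shows "(\<lambda>z. busy (C z) t) \<in> borel_measurable M"
  unfolding busy_def by (intro borel_measurable_diff measurable_regulator assms borel_measurable_const)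

lemma measurable_counting:
  assumes x: "\<And>z. z \<in> space M \<Longrightarrow> arrival_seq (x z)" and xm: "\<And>k. (\<lambda>z. partial_sum (x z) k) \<in> borel_measurable M"
    and u: "u \<in> borel_measurable M" and u0: "\<And>z. z \<in> space M \<Longrightarrow> 0 \<le> u z"
  shows "(\<lambda>z. counting (x z) (u z)) \<in> measurable M (count_space UNIV)"
proof (subst measurable_count_space_eq2_countable, safe)
  fix k :: nat
  have le: "{z \<in> space M. k \<le> counting (x z) (u z)} \<in> sets M" for k
  proof -
    have "{z \<in> space M. k \<le> counting (x z) (u z)} = {z \<in> space M. partial_sum (x z) k \<le> u z}"
      using le_counting_iff[OF x u0] by auto
    then show ?thesis using xm u by simp
  qed
  have "(\<lambda>z. counting (x z) (u z)) -` {k} \<inter> space M =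
      {z \<in> space M. k \<le> counting (x z) (u z)} - {z \<in> space M. Suc k \<le> counting (x z) (u z)}" by auto
  then show "(\<lambda>z. counting (x z) (u z)) -` {k} \<inter> space M \<in> sets M" using le by auto
qed auto

definition queue_path :: "nat \<Rightarrow> (nat \<Rightarrow> real) \<times> (nat \<Rightarrow> real) \<Rightarrow> real \<Rightarrow> real" where
  "queue_path n z = (if arrival_seq (fst z) \<and> arrival_seq (snd z)
    then (\<lambda>t. queue_length (fst z) (snd z) t / real n) else (\<lambda>_. 0))"

lemma step_path_queue_path: "step_path (queue_path n z)"
  unfolding queue_path_def using step_path_queue_length step_path_const by auto

lemma measurable_partial_sum:
  "(\<lambda>z. partial_sum (fst z) k) \<in> borel_measurable (seq_space \<Otimes>\<^sub>M seq_space)"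
  "(\<lambda>z. partial_sum (snd z) k) \<in> borel_measurable (seq_space \<Otimes>\<^sub>M seq_space)"
  unfolding partial_sum_def
  by (intro borel_measurable_sum measurable_compose[OF measurable_fst measurable_component_singleton]
      measurable_compose[OF measurable_snd measurable_component_singleton]; auto)+

lemma sets_arrival_seq:
  "{z \<in> space (seq_space \<Otimes>\<^sub>M seq_space). arrival_seq (fst z) \<and> arrival_seq (snd z)} \<in> sets (seq_space \<Otimes>\<^sub>M seq_space)"
proof -
  have m: "(\<lambda>z. fst z (Suc k)) \<in> borel_measurable (seq_space \<Otimes>\<^sub>M seq_space)"
    "(\<lambda>z. snd z (Suc k)) \<in> borel_measurable (seq_space \<Otimes>\<^sub>M seq_space)" for k
    by (auto intro!: measurable_compose[OF measurable_fst measurable_component_singleton]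
      measurable_compose[OF measurable_snd measurable_component_singleton])
  have eq: "arrival_seq x \<longleftrightarrow> (\<forall>k. 0 < x (Suc k)) \<and> (\<forall>K::nat. \<exists>k. real K < partial_sum x k)" for x
    unfolding arrival_seq_def by (metis One_nat_def Suc_le_D Suc_le_mono le0)
  show ?thesis unfolding eq
    using measurable_partial_sum m
    by (intro sets.sets_Collect_conj sets.sets_Collect_countable_All
        sets.sets_Collect_countable_Ex borel_measurable_less) auto
qed

lemma step_path_right_continuous:
  fixes f :: "real \<Rightarrow> real"
  shows "step_path f \<Longrightarrow> 0 \<le> t \<Longrightarrow> (f \<longlongrightarrow> f t) (at_right t)"
  using step_path_cadlag[of f] by (simp add: cadlag_def)

lemma step_path_cumulative_input: "arrival_seq x \<Longrightarrow> step_path (cumulative_input x y)"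
proof -
  assume x: "arrival_seq x"
  have "step_path (\<lambda>t. counting x t)"
    using step_path_counting_comp[OF x, of "\<lambda>t. t"] by (simp add: mono_on_def)
  from step_path_comp[OF this, of "partial_sum y"] show ?thesis by (simp add: cumulative_input_def[abs_def])
qed

lemma measurable_queue_path: "queue_path n \<in> measurable (seq_space \<Otimes>\<^sub>M seq_space) path_algebra"
proof (rule measurable_path_algebraI)
  show "queue_path n z \<in> cadlag" for z by (rule step_path_cadlag[OF step_path_queue_path])
  fix t :: real assume t: "0 \<le> t"
  define G where "G = {z \<in> space (seq_space \<Otimes>\<^sub>M seq_space). arrival_seq (fst z) \<and> arrival_seq (snd z)}"
  define K where "K = restrict_space (seq_space \<Otimes>\<^sub>M seq_space) G"
  have sK: "arrival_seq (fst z)" "arrival_seq (snd z)" if "z \<in> space K" for z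
    using that by (auto simp: K_def space_restrict_space G_def)
  have ps: "(\<lambda>z. partial_sum (fst z) k) \<in> borel_measurable K" "(\<lambda>z. partial_sum (snd z) k) \<in> borel_measurable K" for k
    unfolding K_def by (intro measurable_restrict_space1 measurable_partial_sum)+
  have cx: "(\<lambda>z. counting (fst z) s) \<in> measurable K (count_space UNIV)" if "0 \<le> s" for s
    by (rule measurable_counting) (use sK ps that in auto)
  have ci: "(\<lambda>z. cumulative_input (fst z) (snd z) s) \<in> borel_measurable K" if "0 \<le> s" for s
    unfolding cumulative_input_def
    by (rule measurable_compose_countable'[OF ps(2) cx[OF that]]) auto
  have bt: "(\<lambda>z. busy_time (fst z) (snd z) t) \<in> borel_measurable K"
    unfolding busy_time_eq
    by (rule measurable_busy) (use sK ci t in \<open>auto intro: cumulative_input_nonneg step_path_right_continuous step_path_cumulative_input\<close>)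
  have dp: "(\<lambda>z. departures (fst z) (snd z) t) \<in> measurable K (count_space UNIV)"
    unfolding departures_def by (rule measurable_counting) (use sK ps bt t in \<open>auto intro: busy_time_nonneg\<close>)
  have "(\<lambda>z. queue_length (fst z) (snd z) t / real n) \<in> borel_measurable K"
    unfolding queue_length_def
    by (intro borel_measurable_divide borel_measurable_diff borel_measurable_const
        measurable_compose[OF cx[OF t]] measurable_compose[OF dp]) auto
  then have "(\<lambda>z. if z \<in> G then queue_length (fst z) (snd z) t / real n else 0) \<in> borel_measurable (seq_space \<Otimes>\<^sub>M seq_space)"
    unfolding K_def using sets_arrival_seq by (subst (asm) measurable_restrict_space_iff) (auto simp: G_def)
  then show "(\<lambda>z. queue_path n z t) \<in> borel_measurable (seq_space \<Otimes>\<^sub>M seq_space)"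
    by (rule measurable_cong[THEN iffD1, rotated]) (auto simp: queue_path_def G_def)
qed

lemma regulator_scale:
  assumes C: "\<And>s. 0 \<le> s \<Longrightarrow> 0 \<le> C s" and c: "0 < c" and t: "0 \<le> t"
  shows "skorokhod_regulator (\<lambda>s. C (c * s) / c - s) t = skorokhod_regulator (\<lambda>s. C s - s) (c * t) / c"
proof (rule antisym)
  have C': "0 \<le> C (c * s) / c" if "0 \<le> s" for s using C[of "c * s"] c that by simp
  show "skorokhod_regulator (\<lambda>s. C (c * s) / c - s) t \<le> skorokhod_regulator (\<lambda>s. C s - s) (c * t) / c"
  proof (rule regulator_le[where C = "\<lambda>s. C (c * s) / c"])
    fix s assume s: "0 \<le> s" "s \<le> t"
    have "c * s - C (c * s) \<le> skorokhod_regulator (\<lambda>s. C s - s) (c * t)"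
      by (rule regulator_ge) (use C s c in auto)
    then have "(c * s - C (c * s)) / c \<le> skorokhod_regulator (\<lambda>s. C s - s) (c * t) / c"
      using c by (intro divide_right_mono) auto
    then show "s - C (c * s) / c \<le> skorokhod_regulator (\<lambda>s. C s - s) (c * t) / c"
      using c by (simp add: diff_divide_distrib)
  qed (use C' t c regulator_nonneg[of C "c * t"] C in auto)
  have "skorokhod_regulator (\<lambda>s. C s - s) (c * t) \<le> c * skorokhod_regulator (\<lambda>s. C (c * s) / c - s) t"
  proof (rule regulator_le)
    fix s assume s: "0 \<le> s" "s \<le> c * t"
    have "s / c - C (c * (s / c)) / c \<le> skorokhod_regulator (\<lambda>s. C (c * s) / c - s) t"
      by (rule regulator_ge[where C = "\<lambda>s. C (c * s) / c"]) (use C' s c in \<open>auto simp: field_simps\<close>)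
    then show "s - C s \<le> c * skorokhod_regulator (\<lambda>s. C (c * s) / c - s) t"
      using c by (simp add: field_simps)
  qed (use C t c regulator_nonneg[of "\<lambda>s. C (c * s) / c" t] C' in auto)
  then show "skorokhod_regulator (\<lambda>s. C s - s) (c * t) / c \<le> skorokhod_regulator (\<lambda>s. C (c * s) / c - s) t"
    using c by (simp add: field_simps)
qed

lemma queue_length_divide:
  assumes y: "arrival_seq y" and c: "0 < c" and t: "0 \<le> t"
  shows "queue_length (\<lambda>k. x k / c) (\<lambda>k. y k / c) t = queue_length x y (c * t)"
proof -
  have ci: "cumulative_input (\<lambda>k. x k / c) (\<lambda>k. y k / c) s = cumulative_input x y (c * s) / c" for s
    using c by (simp add: cumulative_input_def counting_divide partial_sum_divide)
  have "busy_time (\<lambda>k. x k / c) (\<lambda>k. y k / c) t = busy_time x y (c * t) / c"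
    unfolding busy_time_eq busy_def ci
    using c by (subst regulator_scale[OF cumulative_input_nonneg[OF y] c t]) (simp add: field_simps)
  then show ?thesis
    using c by (simp add: queue_length_def departures_def counting_divide)
qed

lemma queue_length_cong:
  assumes "\<And>k. 1 \<le> k \<Longrightarrow> x k = x' k" "\<And>k. 1 \<le> k \<Longrightarrow> y k = y' k"
  shows "queue_length x y = queue_length x' y'"
proof -
  have "partial_sum x = partial_sum x'" "partial_sum y = partial_sum y'"
    using assms by (auto intro: partial_sum_cong)
  then have "counting x = counting x'" "counting y = counting y'" "cumulative_input x y = cumulative_input x' y'"
    by (auto simp: counting_def fun_eq_iff cumulative_input_def)
  then show ?thesis
    by (intro ext) (simp add: queue_length_def departures_def busy_time_eq)
qed

lemma arrival_seq_cong:
  assumes "\<And>k. 1 \<le> k \<Longrightarrow> x k = x' k"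
  shows "arrival_seq x \<longleftrightarrow> arrival_seq x'"
  using partial_sum_cong[OF assms] assms by (simp add: arrival_seq_def)

lemma queue_path_restrict:
  "queue_path n (\<lambda>k\<in>{1..}. x k, \<lambda>k\<in>{1..}. y k) = queue_path n (x, y)"
  using queue_length_cong[of "\<lambda>k\<in>{1..}. x k" x "\<lambda>k\<in>{1..}. y k" y]
    arrival_seq_cong[of "\<lambda>k\<in>{1..}. x k" x] arrival_seq_cong[of "\<lambda>k\<in>{1..}. y k" y]
  by (simp add: queue_path_def)

subsection \<open>Convergence in distribution by coupling\<close>

lemma measurable_completion_AE:
  assumes g: "g \<in> measurable M K" and eq: "AE \<omega> in M. f \<omega> = g \<omega>"
    and f: "\<And>\<omega>. \<omega> \<in> space M \<Longrightarrow> f \<omega> \<in> space K"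
  shows "f \<in> measurable (completion M) K"
proof (rule measurableI)
  fix A assume A: "A \<in> sets K"
  have 1: "{\<omega> \<in> space M. f \<omega> \<noteq> g \<omega>} \<in> sets (completion M)"
    using sets_completion_AE[of "\<lambda>\<omega>. f \<omega> \<noteq> g \<omega>" M] eq by (simp add: pred_def)
  have "AE \<omega> in M. \<not> (f \<omega> \<in> A \<and> f \<omega> \<noteq> g \<omega>)" using eq by eventually_elim simp
  then have 2: "{\<omega> \<in> space M. f \<omega> \<in> A \<and> f \<omega> \<noteq> g \<omega>} \<in> sets (completion M)"
    using sets_completion_AE[of "\<lambda>\<omega>. f \<omega> \<in> A \<and> f \<omega> \<noteq> g \<omega>" M] by (simp add: pred_def)
  have 3: "g -` A \<inter> space M \<in> sets (completion M)" using measurable_sets[OF g A] by simp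
  have "f -` A \<inter> space (completion M) =
      (g -` A \<inter> space M - {\<omega> \<in> space M. f \<omega> \<noteq> g \<omega>}) \<union> {\<omega> \<in> space M. f \<omega> \<in> A \<and> f \<omega> \<noteq> g \<omega>}"
    by auto
  then show "f -` A \<inter> space (completion M) \<in> sets (completion M)"
    using sets.Un[OF sets.Diff[OF 3 1] 2] by simp
qed (use f in simp)

lemma integral_completion_AE:
  fixes f g :: "'a \<Rightarrow> real"
  assumes g: "g \<in> borel_measurable M" and eq: "AE \<omega> in M. f \<omega> = g \<omega>"
  shows "(\<integral>\<omega>. f \<omega> \<partial>completion M) = (\<integral>\<omega>. g \<omega> \<partial>M)"
proof -
  have "(\<integral>\<omega>. f \<omega> \<partial>completion M) = (\<integral>\<omega>. g \<omega> \<partial>completion M)"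
    using measurable_completion_AE[OF g eq] measurable_completion[OF g] AE_completion[OF eq]
    by (intro integral_cong_AE) auto
  then show ?thesis using integral_completion[OF g] by simp
qed

lemma measurable_path_eval: "0 \<le> t \<Longrightarrow> (\<lambda>f. f t) \<in> borel_measurable path_algebra"
proof (rule measurableI)
  fix A :: "real set" assume t: "0 \<le> t" and A: "A \<in> sets borel"
  have "(\<lambda>f. f t) -` A \<inter> space path_algebra = {f \<in> cadlag. f t \<in> A}" by (auto simp: space_path_algebra)
  also have "\<dots> \<in> sets path_algebra" unfolding path_algebra_def
    using t A by (subst sets_measure_of) (auto intro!: sigma_sets.Basic)
  finally show "(\<lambda>f. f t) -` A \<inter> space path_algebra \<in> sets path_algebra" .
qed simp

lemma cadlag_process_version:
  assumes Z: "Z \<in> measurable M path_algebra" and eq: "AE \<omega> in M. \<forall>t\<ge>0. Y \<omega> t = Z \<omega> t"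
  shows "cadlag_process M Y"
  unfolding cadlag_process_def
proof (intro conjI allI impI)
  fix t :: real assume t: "0 \<le> t"
  show "(\<lambda>\<omega>. Y \<omega> t) \<in> borel_measurable (completion M)"
    by (rule measurable_completion_AE[OF measurable_compose[OF Z measurable_path_eval[OF t]]])
       (use eq t in \<open>auto elim!: eventually_mono\<close>)
next
  show "AE \<omega> in M. Y \<omega> \<in> cadlag"
    using eq AE_space
  proof eventually_elim
    case (elim \<omega>)
    have "Z \<omega> \<in> cadlag" using measurable_space[OF Z] elim(2) by (simp add: space_path_algebra)
    then show ?case using cadlag_cong[of "Y \<omega>" "Z \<omega>"] elim(1) by simp
  qed
qed

lemma integral_path_functional:
  assumes Z: "Z \<in> measurable M path_algebra" and eq: "AE \<omega> in M. \<forall>t\<ge>0. Y \<omega> t = Z \<omega> t"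
    and F: "F \<in> borel_measurable path_algebra"
  shows "(\<integral>\<omega>. F (Y \<omega>) \<partial>completion M) = (\<integral>\<omega>. F (Z \<omega>) \<partial>M :: real)"
proof (rule integral_completion_AE[OF measurable_compose[OF Z F]])
  show "AE \<omega> in M. F (Y \<omega>) = F (Z \<omega>)"
    using eq AE_space
  proof eventually_elim
    case (elim \<omega>)
    have "Z \<omega> \<in> cadlag" using measurable_space[OF Z] elim(2) by (simp add: space_path_algebra)
    moreover have "Y \<omega> \<in> cadlag" using calculation cadlag_cong[of "Y \<omega>" "Z \<omega>"] elim(1) by simp
    ultimately show ?case using elim(1) by (intro path_functional_cong[OF F]) auto
  qed
qed

lemma converges_in_distribution_coupling:
  fixes W :: "nat \<Rightarrow> 'c \<Rightarrow> 'd"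
  assumes \<Omega>: "prob_space \<Omega>"
    and H: "\<And>n. H n \<in> measurable K path_algebra"
    and V: "\<And>n. 0 < n \<Longrightarrow> V n \<in> measurable M K" and W: "\<And>n. W n \<in> measurable \<Omega> K"
    and law: "\<And>n. 0 < n \<Longrightarrow> distr M K (V n) = distr \<Omega> K (W n)"
    and X: "\<And>n. 0 < n \<Longrightarrow> AE \<omega> in M. \<forall>t\<ge>0. X n \<omega> t = H n (V n \<omega>) t"
    and X0: "\<And>\<omega> t. X 0 \<omega> t = 0"
    and Z: "Z \<in> measurable N path_algebra" and \<pi>: "\<pi> \<in> measurable \<Omega> N" "distr \<Omega> N \<pi> = N"
    and Y: "AE \<omega> in N. \<forall>t\<ge>0. Y \<omega> t = Z \<omega> t"
    and conv: "AE w in \<Omega>. conv (\<lambda>n. H n (W n w)) (Z (\<pi> w))"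
  shows "converges_in_distribution (seq_topology conv) M X N Y"
  unfolding converges_in_distribution_def
proof (intro conjI allI impI)
  interpret \<Omega>: prob_space \<Omega> by fact
  show "cadlag_process N Y" by (rule cadlag_process_version[OF Z Y])
  show "cadlag_process M (X n)" for n
  proof (cases "n = 0")
    case True
    have "(\<lambda>_. \<lambda>_. 0) \<in> measurable M path_algebra"
      by (rule measurable_path_algebraI) (auto intro: step_path_cadlag step_path_const)
    then show ?thesis using True X0 by (intro cadlag_process_version) auto
  next
    case False
    then show ?thesis by (intro cadlag_process_version[OF measurable_compose[OF V H] X]) auto
  qed
  fix F assume F: "F \<in> borel_measurable path_algebra \<and> continuous_map (seq_topology conv) euclideanreal F \<and> bounded (F ` cadlag)"
  then have Fm: "F \<in> borel_measurable path_algebra" by simp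
  have "\<exists>B. \<forall>f\<in>cadlag. \<bar>F f\<bar> \<le> B" using F by (auto simp: bounded_iff)
  then obtain B where B: "\<And>f. f \<in> cadlag \<Longrightarrow> \<bar>F f\<bar> \<le> B" by blast
  have Hc: "H n (W n w) \<in> cadlag" if "w \<in> space \<Omega>" for n w
    using measurable_space[OF H measurable_space[OF W that]] by (simp add: space_path_algebra)
  have Zc: "Z (\<pi> w) \<in> cadlag" if "w \<in> space \<Omega>" for w
    using measurable_space[OF Z measurable_space[OF \<pi>(1) that]] by (simp add: space_path_algebra)
  have "(\<lambda>n. \<integral>w. F (H n (W n w)) \<partial>\<Omega>) \<longlonglongrightarrow> (\<integral>w. F (Z (\<pi> w)) \<partial>\<Omega>)"
  proof (rule integral_dominated_convergence[where w = "\<lambda>_. B"])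
    show "(\<lambda>w. F (Z (\<pi> w))) \<in> borel_measurable \<Omega>"
      by (rule measurable_compose[OF \<pi>(1) measurable_compose[OF Z Fm]])
    show "(\<lambda>w. F (H n (W n w))) \<in> borel_measurable \<Omega>" for n
      by (rule measurable_compose[OF W measurable_compose[OF H Fm]])
    show "AE w in \<Omega>. (\<lambda>n. F (H n (W n w))) \<longlonglongrightarrow> F (Z (\<pi> w))"
      using conv AE_space
    proof eventually_elim
      case (elim w)
      show ?case
        by (rule seq_topology_continuous[of conv F "\<lambda>n. H n (W n w)" "Z (\<pi> w)"])
           (use F Hc Zc elim in auto)
    qed
    show "AE w in \<Omega>. norm (F (H n (W n w))) \<le> B" for n
      using AE_space by eventually_elim (use B Hc in auto)
  qed simp
  moreover have "(\<integral>w. F (Z (\<pi> w)) \<partial>\<Omega>) = (\<integral>\<omega>. F (Y \<omega>) \<partial>completion N)"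
  proof -
    have "(\<integral>w. F (Z (\<pi> w)) \<partial>\<Omega>) = (\<integral>\<omega>. F (Z \<omega>) \<partial>distr \<Omega> N \<pi>)"
      by (rule integral_distr[symmetric, OF \<pi>(1) measurable_compose[OF Z Fm]])
    then show ?thesis using \<pi>(2) integral_path_functional[OF Z Y Fm] by simp
  qed
  moreover have "(\<integral>\<omega>. F (X n \<omega>) \<partial>completion M) = (\<integral>w. F (H n (W n w)) \<partial>\<Omega>)" if n: "0 < n" for n
  proof -
    have "(\<integral>\<omega>. F (X n \<omega>) \<partial>completion M) = (\<integral>\<omega>. F (H n (V n \<omega>)) \<partial>M)"
      by (rule integral_path_functional[OF measurable_compose[OF V[OF n] H] X[OF n] Fm])
    also have "\<dots> = (\<integral>z. F (H n z) \<partial>distr M K (V n))"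
      by (rule integral_distr[symmetric, OF V[OF n] measurable_compose[OF H Fm]])
    also have "\<dots> = (\<integral>w. F (H n (W n w)) \<partial>\<Omega>)"
      unfolding law[OF n] by (rule integral_distr[OF W measurable_compose[OF H Fm]])
    finally show ?thesis .
  qed
  then have "eventually (\<lambda>n. (\<integral>w. F (H n (W n w)) \<partial>\<Omega>) = (\<integral>\<omega>. F (X n \<omega>) \<partial>completion M)) sequentially"
    by (intro eventually_sequentiallyI[of 1]) auto
  ultimately show "(\<lambda>n. \<integral>\<omega>. F (X n \<omega>) \<partial>completion M) \<longlonglongrightarrow> (\<integral>\<omega>. F (Y \<omega>) \<partial>completion N)"
    using Lim_transform_eventually by fastforce
qed

lemma U_conv_cong:
  assumes "U_conv x f" and eq: "eventually (\<lambda>n. x n = y n) sequentially"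
  shows "U_conv y f"
  unfolding U_conv_def
proof (intro allI impI uniform_limitI)
  fix T e :: real assume "0 < T" "0 < e"
  then have "eventually (\<lambda>n. \<forall>t\<in>{0..T}. dist (x n t) (f t) < e) sequentially"
    using assms(1) by (auto simp: U_conv_def intro: uniform_limitD)
  with eq show "eventually (\<lambda>n. \<forall>t\<in>{0..T}. dist (y n t) (f t) < e) sequentially"
    by eventually_elim simp
qed

lemma scaled_path_left_continuous:
  assumes w: "0 < w" and f: "(f \<longlongrightarrow> f w) (at_left w)"
  shows "(scaled_path c f \<longlongrightarrow> scaled_path c f w) (at_left w)"
proof -
  have "eventually (\<lambda>u. c * f u = scaled_path c f u) (at_left w)"
    unfolding eventually_at_left_field using w by (intro exI[of _ 0]) (auto simp: scaled_path_def)
  moreover have "((\<lambda>u. c * f u) \<longlongrightarrow> c * f w) (at_left w)" by (intro tendsto_intros f)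
  ultimately have "(scaled_path c f \<longlongrightarrow> c * f w) (at_left w)" by (rule Lim_transform_eventually[rotated])
  then show ?thesis using w by (simp add: scaled_path_def)
qed

context subordinator_pair
begin

definition pair_input :: "real \<Rightarrow> real \<Rightarrow> 'b \<Rightarrow> real \<Rightarrow> real" where
  "pair_input c c' \<omega> t = scaled_path c' (r \<omega>) (inverse_path (scaled_path c (s \<omega>)) t)"

definition balanced_limit :: "real \<Rightarrow> real \<Rightarrow> 'b \<Rightarrow> real \<Rightarrow> real" where
  "balanced_limit c c' \<omega> t = inverse_path (scaled_path c (s \<omega>)) t
    - inverse_path (scaled_path c' (r \<omega>)) (busy (pair_input c c' \<omega>) t)"

context
  fixes c c' :: real
  assumes c: "0 < c" and c': "0 < c'"
begin

lemma scaled_paths: "subordinator_path (scaled_path c (s \<omega>))" "subordinator_path (scaled_path c' (r \<omega>))"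
  using c c' by (auto intro: subordinator_path_scaled A.path D.path)

lemma pair_input_nonneg: "0 \<le> pair_input c c' \<omega> t"
  unfolding pair_input_def
  by (intro subordinator_path_nonneg[OF scaled_paths(2)] inverse_path_nonneg[OF scaled_paths(1)])

lemma pair_input_mono: "mono (pair_input c c' \<omega>)"
  unfolding pair_input_def
  using monoD[OF mono_inverse_path[OF scaled_paths(1)]] inverse_path_nonneg[OF scaled_paths(1)]
  by (auto simp: mono_def subordinator_path_le_iff[OF scaled_paths(2)])

lemma pair_input_right_continuous: "(pair_input c c' \<omega> \<longlongrightarrow> pair_input c c' \<omega> t) (at_right t)"
proof (rule order_tendstoI)
  fix y assume "y < pair_input c c' \<omega> t"
  then have "y < pair_input c c' \<omega> u" if "t < u" for u
    using monoD[OF pair_input_mono, of t u] that by (meson less_imp_le less_le_trans)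
  then show "eventually (\<lambda>u. y < pair_input c c' \<omega> u) (at_right t)"
    unfolding eventually_at_right_field by (intro exI[of _ "t + 1"]) auto
next
  let ?v = "inverse_path (scaled_path c (s \<omega>))" and ?d = "scaled_path c' (r \<omega>)"
  fix y assume y: "pair_input c c' \<omega> t < y"
  have v0: "0 \<le> ?v t" for t by (rule inverse_path_nonneg[OF scaled_paths(1)])
  have "(?d \<longlongrightarrow> ?d (?v t)) (at_right (?v t))" using scaled_paths(2) v0 by (simp add: subordinator_path_def)
  then have "eventually (\<lambda>u. ?d u < y) (at_right (?v t))"
    by (rule order_tendstoD) (use y in \<open>simp add: pair_input_def\<close>)
  then obtain b where b: "?v t < b" "\<And>u. ?v t < u \<Longrightarrow> u < b \<Longrightarrow> ?d u < y"
    unfolding eventually_at_right_field by blast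
  have "(?v \<longlongrightarrow> ?v t) (at_right t)"
    using isCont_inverse_path[OF scaled_paths(1)] unfolding isCont_def by (rule filterlim_mono) (auto simp: at_le)
  then have "eventually (\<lambda>u. ?v u < b) (at_right t)" using b(1) by (rule order_tendstoD)
  moreover have "eventually (\<lambda>u. t < u) (at_right t)" by (simp add: eventually_at_right_less)
  ultimately show "eventually (\<lambda>u. pair_input c c' \<omega> u < y) (at_right t)"
  proof eventually_elim
    case (elim u)
    have "?v t \<le> ?v u" using monoD[OF mono_inverse_path[OF scaled_paths(1)]] elim by simp
    then show ?case using b(2)[of "?v u"] elim(1) y unfolding pair_input_def by (cases "?v t = ?v u") auto
  qed
qed

lemma measurable_inverse_scaled: "(\<lambda>\<omega>. inverse_path (scaled_path c (s \<omega>)) t) \<in> borel_measurable N"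
  unfolding inverse_path_scaled[OF c] by (intro A.measurable_inverse_path borel_measurable_const)

lemma measurable_pair_input: "(\<lambda>\<omega>. pair_input c c' \<omega> t) \<in> borel_measurable N"
  unfolding pair_input_def
  by (rule D.measurable_scaled_path_pair[OF measurable_ident_sets[OF refl] measurable_inverse_scaled])

lemma continuous_balanced_limit: "continuous_on {0..} (balanced_limit c c' \<omega>)"
  unfolding balanced_limit_def
proof (intro continuous_intros continuous_on_inverse_path[OF scaled_paths(1)])
  show "continuous_on {0..} (\<lambda>t. inverse_path (scaled_path c' (r \<omega>)) (busy (pair_input c c' \<omega>) t))"
    by (rule continuous_on_compose2[OF continuous_on_inverse_path[OF scaled_paths(2), of UNIV] continuous_on_busy])
       (use pair_input_nonneg monoD[OF pair_input_mono] in \<open>auto simp: mono_on_def\<close>)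
qed

lemma measurable_balanced_limit: "balanced_limit c c' \<in> measurable N path_algebra"
proof (rule measurable_path_algebraI)
  show "balanced_limit c c' \<omega> \<in> cadlag" for \<omega> by (rule continuous_cadlag[OF continuous_balanced_limit])
  fix t :: real assume t: "0 \<le> t"
  have "(\<lambda>\<omega>. busy (pair_input c c' \<omega>) t) \<in> borel_measurable N"
    by (rule measurable_busy) (use t pair_input_nonneg pair_input_right_continuous measurable_pair_input in auto)
  then have "(\<lambda>\<omega>. busy (pair_input c c' \<omega>) t / c') \<in> borel_measurable N" by simp
  then show "(\<lambda>\<omega>. balanced_limit c c' \<omega> t) \<in> borel_measurable N"
    unfolding balanced_limit_def inverse_path_scaled[OF c']
    by (intro borel_measurable_diff measurable_inverse_scaled D.measurable_inverse_path)
qed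

lemma measurable_inverse_limit: "(\<lambda>\<omega>. inverse_path (scaled_path c (s \<omega>))) \<in> measurable N path_algebra"
  by (rule measurable_path_algebraI)
     (auto intro: continuous_cadlag continuous_on_inverse_path scaled_paths measurable_inverse_scaled)

lemma AE_coupled_queues:
  assumes p: "filterlim p at_top sequentially" and q: "filterlim q at_top sequentially"
  shows "AE w in coupling_space. coupled_queues (scaled_path c (s (fst w))) (scaled_path c' (r (fst w)))
    (fst (snd w)) (snd (snd w)) p q"
  using AE_coupling_space_snd[OF AE_exp_seq]
  by eventually_elim (auto intro!: coupled_queues.intro scaled_paths p q)

lemma queue_path_coupled_pair:
  assumes w: "coupled_queues (scaled_path c (s (fst w))) (scaled_path c' (r (fst w))) (fst (snd w)) (snd (snd w)) p q"
  shows "eventually (\<lambda>n. (\<lambda>t. queue_length (sampled (scaled_path c (s (fst w))) (fst (snd w)) (p n))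
      (sampled (scaled_path c' (r (fst w))) (snd (snd w)) (q n)) t / real n) =
    queue_path n (coupled_pair c (p n) c' (q n) w)) sequentially"
  using coupled_queues.ev_arrival[OF w]
  by eventually_elim
    (simp only: coupled_pair_def A.coupled_seq_def D.coupled_seq_def case_prod_beta fst_conv snd_conv queue_path_restrict,
     simp add: queue_path_def)

lemma U_conv_coupled:
  assumes w: "coupled_queues (scaled_path c (s (fst w))) (scaled_path c' (r (fst w))) (fst (snd w)) (snd (snd w)) p q"
    and conv: "U_conv (\<lambda>n t. queue_length (sampled (scaled_path c (s (fst w))) (fst (snd w)) (p n))
      (sampled (scaled_path c' (r (fst w))) (snd (snd w)) (q n)) t / real n) f"
  shows "U_conv (\<lambda>n. queue_path n (coupled_pair c (p n) c' (q n) w)) f"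
  by (rule U_conv_cong[OF conv queue_path_coupled_pair[OF w]])

end

lemma queue_converges:
  fixes M :: "'a measure"
  assumes M: "prob_space M" and queue: "mittag_leffler_queue M a b l \<mu> T S"
    and pos: "0 < a" "0 < b" "0 < l" "0 < \<mu>"
  defines "c \<equiv> l powr (- 1 / a)" and "c' \<equiv> \<mu> powr (- 1 / b)"
  assumes Z: "Z \<in> measurable N path_algebra" and Y: "AE \<omega> in N. \<forall>t\<ge>0. Y \<omega> t = Z \<omega> t"
    and conv: "AE w in coupling_space. conv (\<lambda>n. queue_path n
      (coupled_pair c (real n powr (\<gamma> * a)) c' (real n powr (\<gamma> * b)) w)) (Z (fst w))"
  shows "converges_in_distribution (seq_topology conv) M
    (\<lambda>n \<omega> t. queue_length (\<lambda>k. T k \<omega>) (\<lambda>k. S k \<omega>) (real n powr \<gamma> * t) / real n) N Y"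
proof -
  interpret M: prob_space M by fact
  have T: "\<And>k. 1 \<le> k \<Longrightarrow> mittag_leffler_distributed M a l (T k)" "M.indep_vars (\<lambda>_. borel) T {1..}"
    and S: "\<And>k. 1 \<le> k \<Longrightarrow> mittag_leffler_distributed M b \<mu> (S k)" "M.indep_vars (\<lambda>_. borel) S {1..}"
    and TS: "M.indep_var seq_space (\<lambda>\<omega>. \<lambda>k\<in>{1..}. T k \<omega>) seq_space (\<lambda>\<omega>. \<lambda>k\<in>{1..}. S k \<omega>)"
    using queue by (auto simp: mittag_leffler_queue_def)
  define C where "C n = real n powr \<gamma>" for n
  define V where "V n \<omega> = (\<lambda>k\<in>{1..}. T k \<omega> / C n, \<lambda>k\<in>{1..}. S k \<omega> / C n)" for n \<omega>
  define W where "W n = coupled_pair c (real n powr (\<gamma> * a)) c' (real n powr (\<gamma> * b))" for n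
  have C: "0 < C n" if "0 < n" for n using that by (simp add: C_def)
  have Vi: "M.indep_var seq_space (\<lambda>\<omega>. \<lambda>k\<in>{1..}. T k \<omega> / C n) seq_space (\<lambda>\<omega>. \<lambda>k\<in>{1..}. S k \<omega> / C n)" for n
  proof -
    define E where "E x = (\<lambda>k\<in>{1..}. x k / C n)" for x :: "nat \<Rightarrow> real"
    have E: "E \<in> measurable seq_space seq_space" unfolding E_def
      by (intro measurable_restrict borel_measurable_divide measurable_component_singleton) auto
    show ?thesis using M.indep_var_compose[OF TS E E]
      by (simp add: E_def comp_def cong: restrict_cong)
  qed
  have Vm: "V n \<in> measurable M (seq_space \<Otimes>\<^sub>M seq_space)" for n
    unfolding V_def using Vi[of n] by (auto simp: M.indep_var_distribution_eq)
  have Wm: "W n \<in> measurable coupling_space (seq_space \<Otimes>\<^sub>M seq_space)" for n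
    unfolding W_def by (rule measurable_coupled_pair)
  have law: "distr M (seq_space \<Otimes>\<^sub>M seq_space) (V n) = distr coupling_space (seq_space \<Otimes>\<^sub>M seq_space) (W n)"
    if n: "0 < n" for n
  proof -
    have "distr M (seq_space \<Otimes>\<^sub>M seq_space) (V n) =
        distr M seq_space (\<lambda>\<omega>. \<lambda>k\<in>{1..}. T k \<omega> / C n) \<Otimes>\<^sub>M distr M seq_space (\<lambda>\<omega>. \<lambda>k\<in>{1..}. S k \<omega> / C n)"
      using Vi[of n] by (simp add: M.indep_var_distribution_eq V_def[abs_def])
    also have "\<dots> = PiM {1..} (\<lambda>_. A.coupled_law c (C n powr a)) \<Otimes>\<^sub>M PiM {1..} (\<lambda>_. D.coupled_law c' (C n powr b))"
      unfolding c_def c'_def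
      by (intro arg_cong2[where f = "(\<Otimes>\<^sub>M)"] A.mittag_leffler_seq_law[OF M T] D.mittag_leffler_seq_law[OF M S] pos C n)
    also have "\<dots> = distr coupling_space (seq_space \<Otimes>\<^sub>M seq_space) (W n)"
      unfolding W_def C_def powr_powr using n by (intro coupled_pair_law[symmetric]) auto
    finally show ?thesis .
  qed
  have arr: "AE \<omega> in M. arrival_seq (\<lambda>k. T k \<omega>) \<and> arrival_seq (\<lambda>k. S k \<omega>)" if n: "0 < n" for n :: nat
  proof -
    have c0: "0 < c" "0 < c'" using pos by (auto simp: c_def c'_def)
    have "AE w in coupling_space. arrival_seq (fst (W n w)) \<and> arrival_seq (snd (W n w))"
      using AE_coupling_space_snd[OF AE_exp_seq]
    proof eventually_elim
      case (elim w)
      have "arrival_seq (sampled (scaled_path c (s (fst w))) (fst (snd w)) (real n powr (\<gamma> * a)))"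
        "arrival_seq (sampled (scaled_path c' (r (fst w))) (snd (snd w)) (real n powr (\<gamma> * b)))"
        using elim n by (auto intro!: arrival_seq_sampled scaled_paths c0)
      then show ?case
        using arrival_seq_cong[of "\<lambda>k\<in>{1..}. f k" f for f :: "nat \<Rightarrow> real"]
        by (simp add: W_def coupled_pair_def A.coupled_seq_def D.coupled_seq_def case_prod_beta)
    qed
    then have "AE z in distr M (seq_space \<Otimes>\<^sub>M seq_space) (V n). arrival_seq (fst z) \<and> arrival_seq (snd z)"
      unfolding law[OF n] by (subst AE_distr_iff[OF Wm sets_arrival_seq])
    then have "AE \<omega> in M. arrival_seq (fst (V n \<omega>)) \<and> arrival_seq (snd (V n \<omega>))"
      by (subst (asm) AE_distr_iff[OF Vm sets_arrival_seq])
    then show ?thesis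
    proof eventually_elim
      case (elim \<omega>)
      have "arrival_seq (\<lambda>k. T k \<omega> / C n)" "arrival_seq (\<lambda>k. S k \<omega> / C n)"
        using elim arrival_seq_cong[of "\<lambda>k\<in>{1..}. f k" f for f :: "nat \<Rightarrow> real"] by (simp_all add: V_def)
      from this[THEN arrival_seq_divide, of "1 / C n"] C[OF n] show ?case by simp
    qed
  qed
  show ?thesis
  proof (rule converges_in_distribution_coupling[OF prob_space_coupling_space measurable_queue_path Vm Wm law])
    fix n :: nat assume n: "0 < n"
    show "AE \<omega> in M. \<forall>t\<ge>0. queue_length (\<lambda>k. T k \<omega>) (\<lambda>k. S k \<omega>) (real n powr \<gamma> * t) / real n = queue_path n (V n \<omega>) t"
      using arr[OF n]
    proof eventually_elim
      case (elim \<omega>)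
      show ?case unfolding V_def queue_path_restrict
        using elim C[OF n] queue_length_divide[of "\<lambda>k. S k \<omega>" "C n" _ "\<lambda>k. T k \<omega>"]
        by (auto simp: queue_path_def arrival_seq_divide C_def)
    qed
  next
    show "fst \<in> measurable coupling_space N" by (simp add: coupling_space_def)
    interpret E: prob_space exp_seq by (rule prob_space_exp_seq)
    interpret EE: pair_prob_space exp_seq exp_seq ..
    show "distr coupling_space N fst = N" unfolding coupling_space_def by (rule EE.distr_pair_fst)
    show "AE w in coupling_space. conv (\<lambda>n. queue_path n (W n w)) (Z (fst w))" using conv by (simp add: W_def)
  qed (use Z Y in auto)
qed

end

lemma indep_processes_measurable:
  assumes N: "prob_space N" and ind: "indep_processes N X Y" and t: "0 \<le> t"
  shows "(\<lambda>\<omega>. X \<omega> t) \<in> borel_measurable N" "(\<lambda>\<omega>. Y \<omega> t) \<in> borel_measurable N"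
proof -
  interpret prob_space N by fact
  note rv = indep_var_rv1[OF ind[unfolded indep_processes_def]] indep_var_rv2[OF ind[unfolded indep_processes_def]]
  have c: "(\<lambda>f. f t) \<in> borel_measurable (PiM {0..} (\<lambda>_. borel))"
    by (rule measurable_component_singleton) (use t in simp)
  show "(\<lambda>\<omega>. X \<omega> t) \<in> borel_measurable N" "(\<lambda>\<omega>. Y \<omega> t) \<in> borel_measurable N"
    using measurable_compose[OF rv(1) c] measurable_compose[OF rv(2) c] t by simp_all
qed

lemma subordinator_pair_of_indep_processes:
  assumes s: "subordinator N a s" and r: "subordinator N b r" and ind: "indep_processes N \<sigma> \<tau>"
    and eq: "AE \<omega> in N. s \<omega> = \<sigma> \<omega>" "AE \<omega> in N. r \<omega> = \<tau> \<omega>"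
  shows "subordinator_pair N a b s r"
proof (intro subordinator_pair.intro subordinator_pair_axioms.intro s r)
  interpret A: subordinator N a s by fact
  interpret D: subordinator N b r by fact
  fix u v :: "nat \<Rightarrow> real" assume u: "\<And>k. 0 \<le> u k" and v: "\<And>k. 0 \<le> v k"
  have E: "(\<lambda>x k. x (w k)) \<in> measurable (PiM {0..} (\<lambda>_. borel)) (PiM UNIV (\<lambda>_. borel))"
    if "\<And>k. 0 \<le> w k" for w :: "nat \<Rightarrow> real"
    by (rule measurable_abs_UNIV) (use that in \<open>auto intro: measurable_component_singleton\<close>)
  have "A.indep_var (PiM UNIV (\<lambda>_. borel)) (\<lambda>\<omega> k. \<sigma> \<omega> (u k)) (PiM UNIV (\<lambda>_. borel)) (\<lambda>\<omega> k. \<tau> \<omega> (v k))"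
    using A.indep_var_compose[OF ind[unfolded indep_processes_def] E[OF u] E[OF v]] u v
    by (simp add: comp_def)
  then show "A.indep_var (PiM UNIV (\<lambda>_. borel)) (\<lambda>\<omega> k. s \<omega> (u k)) (PiM UNIV (\<lambda>_. borel)) (\<lambda>\<omega> k. r \<omega> (v k))"
  proof (rule A.indep_var_AE_cong)
    show "(\<lambda>\<omega> k. s \<omega> (u k)) \<in> measurable N (PiM UNIV (\<lambda>_. borel))"
      by (intro measurable_abs_UNIV A.meas u)
    show "(\<lambda>\<omega> k. r \<omega> (v k)) \<in> measurable N (PiM UNIV (\<lambda>_. borel))"
      by (intro measurable_abs_UNIV D.meas v)
    show "AE \<omega> in N. (\<lambda>k. \<sigma> \<omega> (u k)) = (\<lambda>k. s \<omega> (u k))" using eq(1) by eventually_elim simp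
    show "AE \<omega> in N. (\<lambda>k. \<tau> \<omega> (v k)) = (\<lambda>k. r \<omega> (v k))" using eq(2) by eventually_elim simp
  qed
qed

lemma powr_filterlim_at_top: "0 < x \<Longrightarrow> filterlim (\<lambda>n. real n powr x) at_top sequentially"
  by real_asymp

lemma powr_over_id_tendsto_1: "x = 1 \<Longrightarrow> (\<lambda>n. real n powr x / real n) \<longlonglongrightarrow> 1"
  by (rule tendsto_eventually) (use eventually_gt_at_top[of 0] in \<open>eventually_elim, simp\<close>)

lemma powr_over_id_tendsto_0: "x < 1 \<Longrightarrow> (\<lambda>n. real n powr x / real n) \<longlonglongrightarrow> 0"
  by real_asymp

theorem theorem3p7:
  fixes M :: "'a measure" and N :: "'b measure"
    and T S :: "nat \<Rightarrow> 'a \<Rightarrow> real"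
    and \<sigma>a \<sigma>d :: "'b \<Rightarrow> real \<Rightarrow> real"
    and \<alpha> \<beta> l \<mu> \<gamma> :: real
    and Q :: "nat \<Rightarrow> 'a \<Rightarrow> real \<Rightarrow> real"
    and La Ld B :: "'b \<Rightarrow> real \<Rightarrow> real"
  assumes "prob_space M" and "prob_space N"
    and "0 < \<alpha>" "\<alpha> \<le> 1" "0 < \<beta>" "\<beta> \<le> 1" "min \<alpha> \<beta> < 1"
    and "0 < l" "0 < \<mu>"
    and "mittag_leffler_queue M \<alpha> \<beta> l \<mu> T S"
    and "stable_subordinator N \<alpha> \<sigma>a" "stable_subordinator N \<beta> \<sigma>d"
    and "indep_processes N \<sigma>a \<sigma>d"
    and "\<gamma> = min (1 / \<alpha>) (1 / \<beta>)"
    and "Q = (\<lambda>n \<omega> t. queue_length (\<lambda>k. T k \<omega>) (\<lambda>k. S k \<omega>) (real n powr \<gamma> * t) / real n)"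
    and "La = (\<lambda>\<omega>. inverse_path (\<sigma>a \<omega>))"
    and "Ld = (\<lambda>\<omega>. inverse_path (\<sigma>d \<omega>))"
    and "B = (\<lambda>\<omega> t. t - skorokhod_regulator
                (\<lambda>s. \<mu> powr (- 1 / \<alpha>) * \<sigma>d \<omega> (La \<omega> (l powr (1 / \<alpha>) * s)) - s) t)"
  shows "(\<alpha> > \<beta> \<longrightarrow>
           converges_in_distribution U_topology M Q N (\<lambda>\<omega> t. La \<omega> (l powr (1 / \<alpha>) * t))) \<and>
         (\<alpha> = \<beta> \<longrightarrow>
           converges_in_distribution M1_topology M Q N
             (\<lambda>\<omega> t. La \<omega> (l powr (1 / \<alpha>) * t) - Ld \<omega> (\<mu> powr (1 / \<alpha>) * B \<omega> t))) \<and>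
         (\<alpha> < \<beta> \<longrightarrow>
           converges_in_distribution U_topology M Q N (\<lambda>\<omega> t. 0))"
proof -
  note M = assms(1) and N = assms(2) and pos = \<open>0 < \<alpha>\<close> \<open>0 < \<beta>\<close> \<open>0 < l\<close> \<open>0 < \<mu>\<close>
    and queue = assms(10) and ind = assms(13) and \<gamma> = assms(14) and Q = assms(15) and La = assms(16)
    and Ld = assms(17) and B = assms(18)
  interpret N: prob_space N by fact
  obtain s where s: "subordinator N \<alpha> s" "AE \<omega> in N. s \<omega> = \<sigma>a \<omega>"
    by (rule N.stable_subordinator_version[OF assms(11) indep_processes_measurable(1)[OF N ind] pos(1)])
  obtain r where r: "subordinator N \<beta> r" "AE \<omega> in N. r \<omega> = \<sigma>d \<omega>"
    by (rule N.stable_subordinator_version[OF assms(12) indep_processes_measurable(2)[OF N ind] pos(2)])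
  interpret subordinator_pair N \<alpha> \<beta> s r
    by (rule subordinator_pair_of_indep_processes[OF s(1) r(1) ind s(2) r(2)])
  define c where "c = l powr (- 1 / \<alpha>)"
  define c' where "c' = \<mu> powr (- 1 / \<beta>)"
  define p where "p n = real n powr (\<gamma> * \<alpha>)" for n
  define q where "q n = real n powr (\<gamma> * \<beta>)" for n
  have c0: "0 < c" "0 < c'" using pos by (auto simp: c_def c'_def)
  have div_c: "t / c = l powr (1 / \<alpha>) * t" "t / c' = \<mu> powr (1 / \<beta>) * t" for t
    using pos by (simp_all add: c_def c'_def powr_minus_divide)
  have \<gamma>0: "0 < \<gamma>" using pos by (simp add: \<gamma>)
  have pq: "filterlim p at_top sequentially" "filterlim q at_top sequentially"
    unfolding p_def q_def using \<gamma>0 pos by (auto intro!: powr_filterlim_at_top)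
  note converges = queue_converges[OF M queue pos, where \<gamma> = \<gamma>, folded c_def c'_def p_def q_def Q]
  note queues = AE_coupled_queues[OF c0 pq]
  show ?thesis
  proof (intro conjI impI)
    assume lt: "\<beta> < \<alpha>"
    then have "\<gamma> = 1 / \<alpha>" using pos by (simp add: \<gamma> frac_le)
    then have e: "\<gamma> * \<alpha> = 1" "\<gamma> * \<beta> < 1" using pos lt by auto
    have lims: "(\<lambda>n. p n / real n) \<longlonglongrightarrow> 1" "(\<lambda>n. q n / real n) \<longlonglongrightarrow> 0"
      unfolding p_def q_def using powr_over_id_tendsto_1[OF e(1)] powr_over_id_tendsto_0[OF e(2)] by simp_all
    show "converges_in_distribution U_topology M Q N (\<lambda>\<omega> t. La \<omega> (l powr (1 / \<alpha>) * t))"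
      unfolding U_topology_def
    proof (rule converges[OF measurable_inverse_limit[OF c0]])
      show "AE \<omega> in N. \<forall>t\<ge>0. La \<omega> (l powr (1 / \<alpha>) * t) = inverse_path (scaled_path c (s \<omega>)) t"
        using s(2) by eventually_elim (simp add: La inverse_path_scaled[OF c0(1)] div_c)
      show "AE w in coupling_space. U_conv (\<lambda>n. queue_path n (coupled_pair c (p n) c' (q n) w))
          (inverse_path (scaled_path c (s (fst w))))"
        using queues
        by eventually_elim (intro U_conv_coupled[OF c0] coupled_queues.queue_fast_service lims)
    qed
  next
    assume eq: "\<alpha> = \<beta>"
    then have e: "\<gamma> * \<alpha> = 1" "\<gamma> * \<beta> = 1" using pos by (auto simp: \<gamma>)
    have lims: "(\<lambda>n. p n / real n) \<longlonglongrightarrow> 1" "(\<lambda>n. q n / real n) \<longlonglongrightarrow> 1"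
      unfolding p_def q_def using powr_over_id_tendsto_1[OF e(1)] powr_over_id_tendsto_1[OF e(2)] by blast+
    show "converges_in_distribution M1_topology M Q N
        (\<lambda>\<omega> t. La \<omega> (l powr (1 / \<alpha>) * t) - Ld \<omega> (\<mu> powr (1 / \<alpha>) * B \<omega> t))"
      unfolding M1_topology_def
    proof (rule converges[OF measurable_balanced_limit[OF c0]])
      show "AE \<omega> in N. \<forall>t\<ge>0. La \<omega> (l powr (1 / \<alpha>) * t) - Ld \<omega> (\<mu> powr (1 / \<alpha>) * B \<omega> t) = balanced_limit c c' \<omega> t"
        using s(2) r(2)
      proof eventually_elim
        case (elim \<omega>)
        have v: "inverse_path (scaled_path c (\<sigma>a \<omega>)) t = La \<omega> (l powr (1 / \<alpha>) * t)" for t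
          by (simp add: La inverse_path_scaled[OF c0(1)] div_c)
        have "0 \<le> La \<omega> t" for t using inverse_path_nonneg[OF A.path[of \<omega>], of t] by (simp add: La elim)
        then have "pair_input c c' \<omega> t = \<mu> powr (- 1 / \<alpha>) * \<sigma>d \<omega> (La \<omega> (l powr (1 / \<alpha>) * t))" for t
          unfolding pair_input_def elim v by (simp add: scaled_path_def c'_def eq)
        then have "busy (pair_input c c' \<omega>) t = B \<omega> t" for t by (simp add: busy_def B)
        then show ?case
          unfolding balanced_limit_def elim v by (simp add: inverse_path_scaled[OF c0(2)] div_c Ld eq)
      qed
      show "AE w in coupling_space. M1_conv (\<lambda>n. queue_path n (coupled_pair c (p n) c' (q n) w))
          (balanced_limit c c' (fst w))"
        using queues AE_coupling_space_fst[OF AE_no_common_jump]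
      proof eventually_elim
        case (elim w)
        have "U_conv (\<lambda>n. queue_path n (coupled_pair c (p n) c' (q n) w)) (balanced_limit c c' (fst w))"
          unfolding balanced_limit_def[abs_def] pair_input_def[abs_def]
          by (intro U_conv_coupled[OF c0] coupled_queues.queue_balanced elim(1) lims)
             (use elim(2) in \<open>auto intro: scaled_path_left_continuous\<close>)
        then show ?case
          by (rule M1_conv_of_U_conv) (simp_all add: step_path_queue_path continuous_balanced_limit[OF c0])
      qed
    qed
  next
    assume lt: "\<alpha> < \<beta>"
    then have "\<gamma> = 1 / \<beta>" using pos by (simp add: \<gamma> frac_le)
    then have "\<gamma> * \<alpha> < 1" using pos lt by auto
    then have lim: "(\<lambda>n. p n / real n) \<longlonglongrightarrow> 0"
      unfolding p_def by (rule powr_over_id_tendsto_0)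
    show "converges_in_distribution U_topology M Q N (\<lambda>\<omega> t. 0)"
      unfolding U_topology_def
    proof (rule converges)
      show "(\<lambda>_ _. 0) \<in> measurable N path_algebra"
        by (rule measurable_path_algebraI) (auto intro: step_path_cadlag step_path_const)
      show "AE w in coupling_space. U_conv (\<lambda>n. queue_path n (coupled_pair c (p n) c' (q n) w)) (\<lambda>_. 0)"
        using queues
        by eventually_elim (intro U_conv_coupled[OF c0] coupled_queues.queue_slow_arrivals lim)
    qed simp
  qed
qed

end
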